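(* Let $k$ be a field of characteristic $\neq 2$ and $n$ a positive integer. Then a Hopf algebra $E$ over $k$ factorizes through $H_4$ and $k[C_n]$ if and only if $E \cong H_{4n, \omega}$ for some $\omega \in U_n(k)$, where $H_{4n, \omega}$ denotes the Hopf algebra generated by $g$, $x$ and $c$ subject to the relations $$g^{2} = c^n = 1, \quad x^{2} = 0, \quad x g = -g x, \quad c g = g c, \quad c x = \omega \, x c$$ with the coalgebra structure and antipode given by $$\Delta(g) = g \otimes g, \quad \Delta(c) = c \otimes c, \quad \Delta(x) = x \otimes 1 + g \otimes x,$$ $$\varepsilon(c) = \varepsilon(g) = 1, \quad \varepsilon(x) = 0, \quad S(c) = c^{n-1}, \quad S(g) = g, \quad S(x) = -gx.$$ Moreover, $H_{4n, \omega}$ is a pointed non-semisimple $4n$-dimensional Hopf algebra.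
   Context: $U_n(k) = \{\omega \in k \mid \omega^n = 1\}$. $C_n$ is the cyclic group of order $n$ and $k[C_n]$ its group Hopf algebra. $H_4$ is Sweedler's $4$-dimensional Hopf algebra with $k$-basis $\{1, g, x, gx\}$, relations $g^2 = 1$, $x^2 = 0$, $xg = -gx$, and $\Delta(g) = g \otimes g$, $\Delta(x) = x \otimes 1 + g \otimes x$, $\varepsilon(g) = 1$, $\varepsilon(x) = 0$, $S(g) = g$, $S(x) = -gx$. A Hopf algebra $E$ factorizes through two Hopf algebras $A$ and $H$ if there exist injective Hopf algebra maps $i : A \to E$ and $j : H \to E$ such that the map $A \otimes H \to E$, $a \otimes h \mapsto i(a) j(h)$ is bijective. *)

theory Defs
  imports
    "HOL-Algebra.Algebra"
    "Jordan_Normal_Form.Missing_VectorSpace"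
begin

section \<open>Algebras over a field\<close>

text \<open>
  The locale \<^locale>\<open>algebra\<close> of the library requires commutative multiplication, so it cannot be
  used here. A \<open>K\<close>-algebra is carried by the library record for modules, whose \<open>mult\<close> and \<open>one\<close>
  fields are the ring structure.
\<close>

locale k_algebra = vectorspace K A + A: ring A for K (structure) and A (structure) +
  assumes smult_mult_left:
    "\<lbrakk>r \<in> carrier K; a \<in> carrier A; b \<in> carrier A\<rbrakk>
      \<Longrightarrow> (r \<odot>\<^bsub>A\<^esub> a) \<otimes>\<^bsub>A\<^esub> b = r \<odot>\<^bsub>A\<^esub> (a \<otimes>\<^bsub>A\<^esub> b)"
  and smult_mult_right:
    "\<lbrakk>r \<in> carrier K; a \<in> carrier A; b \<in> carrier A\<rbrakk>
      \<Longrightarrow> a \<otimes>\<^bsub>A\<^esub> (r \<odot>\<^bsub>A\<^esub> b) = r \<odot>\<^bsub>A\<^esub> (a \<otimes>\<^bsub>A\<^esub> b)"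

definition alg_hom ::
  "('k, 'c) ring_scheme \<Rightarrow> ('k, 'a, 'm) module_scheme \<Rightarrow> ('k, 'b, 'n) module_scheme \<Rightarrow> ('a \<Rightarrow> 'b) set"
  where "alg_hom K A B = ring_hom A B \<inter> module_hom K A B"

definition self_algebra :: "('k, 'c) ring_scheme \<Rightarrow> ('k, 'k) module" where
  "self_algebra K =
    \<lparr>carrier = carrier K, monoid.mult = monoid.mult K, monoid.one = \<one>\<^bsub>K\<^esub>,
     ring.zero = \<zero>\<^bsub>K\<^esub>, ring.add = ring.add K, smult = monoid.mult K\<rparr>"

definition opposite :: "('k, 'a, 'm) module_scheme \<Rightarrow> ('k, 'a, 'm) module_scheme" where
  "opposite A = A\<lparr>monoid.mult := (\<lambda>a b. b \<otimes>\<^bsub>A\<^esub> a)\<rparr>"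

definition quot_algebra :: "('k, 'a, 'm) module_scheme \<Rightarrow> 'a set \<Rightarrow> ('k, 'a set) module" where
  "quot_algebra A I =
    ring.extend (A Quot I) (module.fields (\<lambda>r S. \<Union>a\<in>S. I +>\<^bsub>A\<^esub> (r \<odot>\<^bsub>A\<^esub> a)))"

text \<open>
  The monoid algebra \<open>K[M]\<close>: finitely supported functions on \<open>M\<close>, with \<open>basis_elt K m\<close> the basis
  element attached to \<open>m\<close>. Group algebras and free algebras are instances, and the underlying
  vector space of \<open>K[M]\<close> is the free vector space on the set \<open>M\<close>.
\<close>

definition basis_elt :: "('k, 'c) ring_scheme \<Rightarrow> 'm \<Rightarrow> 'm \<Rightarrow> 'k" where
  "basis_elt K m = (\<lambda>p. if p = m then \<one>\<^bsub>K\<^esub> else \<zero>\<^bsub>K\<^esub>)"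

definition monoid_algebra ::
  "('k, 'c) ring_scheme \<Rightarrow> ('m, 'd) monoid_scheme \<Rightarrow> ('k, 'm \<Rightarrow> 'k) module" where
  "monoid_algebra K M =
    \<lparr>carrier = {f. range f \<subseteq> carrier K \<and> finite {m. f m \<noteq> \<zero>\<^bsub>K\<^esub>} \<and> {m. f m \<noteq> \<zero>\<^bsub>K\<^esub>} \<subseteq> carrier M},
     monoid.mult = (\<lambda>f h m. \<Oplus>\<^bsub>K\<^esub>pq\<in>{(p, q). f p \<noteq> \<zero>\<^bsub>K\<^esub> \<and> h q \<noteq> \<zero>\<^bsub>K\<^esub> \<and> p \<otimes>\<^bsub>M\<^esub> q = m}.
                       f (fst pq) \<otimes>\<^bsub>K\<^esub> h (snd pq)),
     monoid.one = basis_elt K \<one>\<^bsub>M\<^esub>,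
     ring.zero = (\<lambda>m. \<zero>\<^bsub>K\<^esub>),
     ring.add = (\<lambda>f h m. f m \<oplus>\<^bsub>K\<^esub> h m),
     smult = (\<lambda>r f m. r \<otimes>\<^bsub>K\<^esub> f m)\<rparr>"

text \<open>The linear extension to \<open>K[M]\<close> of a function \<open>b\<close> given on the basis \<open>M\<close>.\<close>

definition lin_ext ::
  "('k, 'c) ring_scheme \<Rightarrow> ('k, 'a, 'n) module_scheme \<Rightarrow> ('m \<Rightarrow> 'a) \<Rightarrow> ('m \<Rightarrow> 'k) \<Rightarrow> 'a" where
  "lin_ext K V b f = (\<Oplus>\<^bsub>V\<^esub>m\<in>{m. f m \<noteq> \<zero>\<^bsub>K\<^esub>}. f m \<odot>\<^bsub>V\<^esub> b m)"


section \<open>Tensor products\<close>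

text \<open>
  \<open>A \<otimes> B\<close> is the free vector space on \<open>A \<times> B\<close> modulo the subspace spanned by the bilinearity
  relators. Taking the free vector space in the guise of the monoid algebra of the multiplicative
  monoid \<open>A \<times> B\<close> makes the quotient carry the product \<open>(a \<otimes> b)(a' \<otimes> b') = aa' \<otimes> bb'\<close> of the
  tensor product of algebras.
\<close>

abbreviation free_on_prod ::
  "('k, 'c) ring_scheme \<Rightarrow> ('k, 'a, 'm) module_scheme \<Rightarrow> ('k, 'b, 'n) module_scheme
    \<Rightarrow> ('k, 'a \<times> 'b \<Rightarrow> 'k) module" where
  "free_on_prod K A B \<equiv> monoid_algebra K (A \<times>\<times> B)"

definition tensor_relators ::
  "('k, 'c) ring_scheme \<Rightarrow> ('k, 'a, 'm) module_scheme \<Rightarrow> ('k, 'b, 'n) module_scheme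
    \<Rightarrow> ('a \<times> 'b \<Rightarrow> 'k) set" where
  "tensor_relators K A B =
    (let F = free_on_prod K A B; e = (\<lambda>a b. basis_elt K (a, b)) in
      {e (a \<oplus>\<^bsub>A\<^esub> a') b \<ominus>\<^bsub>F\<^esub> (e a b \<oplus>\<^bsub>F\<^esub> e a' b) | a a' b.
         a \<in> carrier A \<and> a' \<in> carrier A \<and> b \<in> carrier B} \<union>
      {e a (b \<oplus>\<^bsub>B\<^esub> b') \<ominus>\<^bsub>F\<^esub> (e a b \<oplus>\<^bsub>F\<^esub> e a b') | a b b'.
         a \<in> carrier A \<and> b \<in> carrier B \<and> b' \<in> carrier B} \<union>
      {e (r \<odot>\<^bsub>A\<^esub> a) b \<ominus>\<^bsub>F\<^esub> (r \<odot>\<^bsub>F\<^esub> e a b) | r a b.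
         r \<in> carrier K \<and> a \<in> carrier A \<and> b \<in> carrier B} \<union>
      {e a (r \<odot>\<^bsub>B\<^esub> b) \<ominus>\<^bsub>F\<^esub> (r \<odot>\<^bsub>F\<^esub> e a b) | r a b.
         r \<in> carrier K \<and> a \<in> carrier A \<and> b \<in> carrier B})"

definition tensor_null ::
  "('k, 'c) ring_scheme \<Rightarrow> ('k, 'a, 'm) module_scheme \<Rightarrow> ('k, 'b, 'n) module_scheme
    \<Rightarrow> ('a \<times> 'b \<Rightarrow> 'k) set" where
  "tensor_null K A B = module.span K (free_on_prod K A B) (tensor_relators K A B)"

definition tensor ::
  "('k, 'c) ring_scheme \<Rightarrow> ('k, 'a, 'm) module_scheme \<Rightarrow> ('k, 'b, 'n) module_scheme
    \<Rightarrow> ('k, ('a \<times> 'b \<Rightarrow> 'k) set) module" where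
  "tensor K A B = quot_algebra (free_on_prod K A B) (tensor_null K A B)"

definition pure_tensor ::
  "('k, 'c) ring_scheme \<Rightarrow> ('k, 'a, 'm) module_scheme \<Rightarrow> ('k, 'b, 'n) module_scheme
    \<Rightarrow> 'a \<Rightarrow> 'b \<Rightarrow> ('a \<times> 'b \<Rightarrow> 'k) set" where
  "pure_tensor K A B a b = tensor_null K A B +>\<^bsub>free_on_prod K A B\<^esub> basis_elt K (a, b)"

text \<open>
  \<open>tensor_lift K V \<beta>\<close> is the linear map \<open>A \<otimes> B \<rightarrow> V\<close> with \<open>a \<otimes> b \<mapsto> \<beta> (a, b)\<close>. It is meant for
  bilinear \<open>\<beta>\<close>, for which the linear extension is constant on each coset.
\<close>

definition tensor_lift ::
  "('k, 'c) ring_scheme \<Rightarrow> ('k, 'v, 'n) module_scheme \<Rightarrow> ('a \<times> 'b \<Rightarrow> 'v)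
    \<Rightarrow> ('a \<times> 'b \<Rightarrow> 'k) set \<Rightarrow> 'v" where
  "tensor_lift K V \<beta> z = the_elem (lin_ext K V \<beta> ` z)"

definition tensor_map ::
  "('k, 'c) ring_scheme \<Rightarrow> ('k, 'a, 'm) module_scheme \<Rightarrow> ('k, 'b, 'n) module_scheme
    \<Rightarrow> ('a' \<Rightarrow> 'a) \<Rightarrow> ('b' \<Rightarrow> 'b) \<Rightarrow> ('a' \<times> 'b' \<Rightarrow> 'k) set \<Rightarrow> ('a \<times> 'b \<Rightarrow> 'k) set" where
  "tensor_map K A B f h = tensor_lift K (tensor K A B) (\<lambda>(a, b). pure_tensor K A B (f a) (h b))"

text \<open>The associativity isomorphism \<open>(A \<otimes> A) \<otimes> A \<rightarrow> A \<otimes> (A \<otimes> A)\<close>.\<close>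

definition tensor_assoc where
  "tensor_assoc K A =
    (let AA = tensor K A A; T = tensor K A AA in
      tensor_lift K T (\<lambda>(z, c).
        tensor_lift K T (\<lambda>(a, b). pure_tensor K A AA a (pure_tensor K A A b c)) z))"


section \<open>Hopf algebras\<close>

record ('k, 'a) hopf_data = "('k, 'a) module" +
  comult :: "'a \<Rightarrow> ('a \<times> 'a \<Rightarrow> 'k) set"
  counit :: "'a \<Rightarrow> 'k"
  antipode :: "'a \<Rightarrow> 'a"

locale hopf_algebra = k_algebra K A
  for K :: "('k, 'c) ring_scheme" (structure) and A :: "('k, 'a, 'm) hopf_data_scheme" (structure) +
  assumes comult_hom: "comult A \<in> alg_hom K A (tensor K A A)"
    and counit_hom: "counit A \<in> alg_hom K A (self_algebra K)"
    and coassoc: "a \<in> carrier A \<Longrightarrow>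
      tensor_assoc K A (tensor_map K (tensor K A A) A (comult A) id (comult A a))
        = tensor_map K A (tensor K A A) id (comult A) (comult A a)"
    and counit_left: "a \<in> carrier A \<Longrightarrow>
      tensor_lift K A (\<lambda>(a, b). counit A a \<odot>\<^bsub>A\<^esub> b) (comult A a) = a"
    and counit_right: "a \<in> carrier A \<Longrightarrow>
      tensor_lift K A (\<lambda>(a, b). counit A b \<odot>\<^bsub>A\<^esub> a) (comult A a) = a"
    and antipode_linear: "antipode A \<in> module_hom K A A"
    and antipode_left: "a \<in> carrier A \<Longrightarrow>
      tensor_lift K A (\<lambda>(a, b). antipode A a \<otimes>\<^bsub>A\<^esub> b) (comult A a) = counit A a \<odot>\<^bsub>A\<^esub> \<one>\<^bsub>A\<^esub>"
    and antipode_right: "a \<in> carrier A \<Longrightarrow>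
      tensor_lift K A (\<lambda>(a, b). a \<otimes>\<^bsub>A\<^esub> antipode A b) (comult A a) = counit A a \<odot>\<^bsub>A\<^esub> \<one>\<^bsub>A\<^esub>"

definition hopf_hom ::
  "('k, 'c) ring_scheme \<Rightarrow> ('k, 'a, 'm) hopf_data_scheme \<Rightarrow> ('k, 'b, 'n) hopf_data_scheme
    \<Rightarrow> ('a \<Rightarrow> 'b) set" where
  "hopf_hom K A B =
    {f \<in> alg_hom K A B. \<forall>a\<in>carrier A.
      comult B (f a) = tensor_map K B B f f (comult A a) \<and>
      counit B (f a) = counit A a \<and>
      antipode B (f a) = f (antipode A a)}"

definition hopf_isomorphic ::
  "('k, 'c) ring_scheme \<Rightarrow> ('k, 'a, 'm) hopf_data_scheme \<Rightarrow> ('k, 'b, 'n) hopf_data_scheme \<Rightarrow> bool"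
  where "hopf_isomorphic K A B \<longleftrightarrow> (\<exists>f\<in>hopf_hom K A B. bij_betw f (carrier A) (carrier B))"

definition factorizes ::
  "('k, 'c) ring_scheme \<Rightarrow> ('k, 'e, 'l) hopf_data_scheme \<Rightarrow> ('k, 'a, 'm) hopf_data_scheme
    \<Rightarrow> ('k, 'b, 'n) hopf_data_scheme \<Rightarrow> bool" where
  "factorizes K E A H \<longleftrightarrow>
    (\<exists>i\<in>hopf_hom K A E. \<exists>j\<in>hopf_hom K H E.
      inj_on i (carrier A) \<and> inj_on j (carrier H) \<and>
      bij_betw (tensor_lift K E (\<lambda>(a, h). i a \<otimes>\<^bsub>E\<^esub> j h)) (carrier (tensor K A H)) (carrier E))"

definition subcoalgebra ::
  "('k, 'c) ring_scheme \<Rightarrow> ('k, 'a, 'm) hopf_data_scheme \<Rightarrow> 'a set \<Rightarrow> bool" where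
  "subcoalgebra K A D \<longleftrightarrow> submodule K D A \<and>
    comult A ` D \<subseteq> module.span K (tensor K A A) {pure_tensor K A A a b | a b. a \<in> D \<and> b \<in> D}"

definition simple_subcoalgebra ::
  "('k, 'c) ring_scheme \<Rightarrow> ('k, 'a, 'm) hopf_data_scheme \<Rightarrow> 'a set \<Rightarrow> bool" where
  "simple_subcoalgebra K A D \<longleftrightarrow> subcoalgebra K A D \<and> D \<noteq> {\<zero>\<^bsub>A\<^esub>} \<and>
    (\<forall>D'. subcoalgebra K A D' \<and> D' \<subseteq> D \<longrightarrow> D' = {\<zero>\<^bsub>A\<^esub>} \<or> D' = D)"

definition pointed ::
  "('k, 'c) ring_scheme \<Rightarrow> ('k, 'a, 'm) hopf_data_scheme \<Rightarrow> bool" where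
  "pointed K A \<longleftrightarrow> (\<forall>D. simple_subcoalgebra K A D \<longrightarrow>
    vectorspace.fin_dim K (A\<lparr>carrier := D\<rparr>) \<and> vectorspace.dim K (A\<lparr>carrier := D\<rparr>) = 1)"

text \<open>
  A ring is semisimple if it is semisimple as a left module over itself, that is, if every left
  ideal is a direct summand. A Hopf algebra is semisimple if its underlying ring is.
\<close>

definition left_ideal :: "'a set \<Rightarrow> ('a, 'm) ring_scheme \<Rightarrow> bool" where
  "left_ideal L R \<longleftrightarrow> additive_subgroup L R \<and> (\<forall>r\<in>carrier R. \<forall>a\<in>L. r \<otimes>\<^bsub>R\<^esub> a \<in> L)"

definition semisimple :: "('a, 'm) ring_scheme \<Rightarrow> bool" where
  "semisimple R \<longleftrightarrow> (\<forall>L. left_ideal L R \<longrightarrow>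
    (\<exists>L'. left_ideal L' R \<and> L \<inter> L' = {\<zero>\<^bsub>R\<^esub>} \<and> L <+>\<^bsub>R\<^esub> L' = carrier R))"


section \<open>Group Hopf algebras\<close>

definition group_hopf_algebra ::
  "('k, 'c) ring_scheme \<Rightarrow> ('g, 'd) monoid_scheme \<Rightarrow> ('k, 'g \<Rightarrow> 'k) hopf_data" where
  "group_hopf_algebra K G =
    (let A = monoid_algebra K G; e = basis_elt K in
      module.extend A (hopf_data.fields
        (lin_ext K (tensor K A A) (\<lambda>g. pure_tensor K A A (e g) (e g)))
        (lin_ext K (self_algebra K) (\<lambda>g. \<one>\<^bsub>K\<^esub>))
        (lin_ext K A (\<lambda>g. e (inv\<^bsub>G\<^esub> g)))))"


section \<open>Hopf algebras given by generators and relations\<close>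

definition free_algebra :: "('k, 'c) ring_scheme \<Rightarrow> 'g set \<Rightarrow> ('k, 'g list \<Rightarrow> 'k) module" where
  "free_algebra K S = monoid_algebra K \<lparr>carrier = lists S, monoid.mult = (@), monoid.one = []\<rparr>"

text \<open>The algebra map from a free algebra to \<open>B\<close> with prescribed values \<open>v\<close> on the generators.\<close>

definition free_ext ::
  "('k, 'c) ring_scheme \<Rightarrow> ('k, 'b, 'n) module_scheme \<Rightarrow> ('g \<Rightarrow> 'b) \<Rightarrow> ('g list \<Rightarrow> 'k) \<Rightarrow> 'b" where
  "free_ext K B v = lin_ext K B (\<lambda>w. foldr (monoid.mult B) (map v w) \<one>\<^bsub>B\<^esub>)"

definition rel_ideal ::
  "('k, 'c) ring_scheme \<Rightarrow> 'g set \<Rightarrow> (('g list \<Rightarrow> 'k) \<times> ('g list \<Rightarrow> 'k)) set \<Rightarrow> ('g list \<Rightarrow> 'k) set"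
  where
  "rel_ideal K S R = Idl\<^bsub>free_algebra K S\<^esub> {l \<ominus>\<^bsub>free_algebra K S\<^esub> r | l r. (l, r) \<in> R}"

definition presented_algebra ::
  "('k, 'c) ring_scheme \<Rightarrow> 'g set \<Rightarrow> (('g list \<Rightarrow> 'k) \<times> ('g list \<Rightarrow> 'k)) set
    \<Rightarrow> ('k, ('g list \<Rightarrow> 'k) set) module" where
  "presented_algebra K S R = quot_algebra (free_algebra K S) (rel_ideal K S R)"

definition presented_gen ::
  "('k, 'c) ring_scheme \<Rightarrow> 'g set \<Rightarrow> (('g list \<Rightarrow> 'k) \<times> ('g list \<Rightarrow> 'k)) set
    \<Rightarrow> 'g \<Rightarrow> ('g list \<Rightarrow> 'k) set" where
  "presented_gen K S R s = rel_ideal K S R +>\<^bsub>free_algebra K S\<^esub> basis_elt K [s]"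

text \<open>
  The comultiplication and the counit are the algebra maps, and the antipode the algebra
  anti-endomorphism, with the values \<open>cm\<close>, \<open>cu\<close> and \<open>an\<close> on the generators. These maps exist only
  if the prescribed values respect the relations; \<open>the_elem\<close> does not check this.
\<close>

definition presented_hopf ::
  "('k, 'c) ring_scheme \<Rightarrow> 'g set \<Rightarrow> (('g list \<Rightarrow> 'k) \<times> ('g list \<Rightarrow> 'k)) set
    \<Rightarrow> ('g \<Rightarrow> (('g list \<Rightarrow> 'k) set \<times> ('g list \<Rightarrow> 'k) set \<Rightarrow> 'k) set)
    \<Rightarrow> ('g \<Rightarrow> 'k) \<Rightarrow> ('g \<Rightarrow> ('g list \<Rightarrow> 'k) set)
    \<Rightarrow> ('k, ('g list \<Rightarrow> 'k) set) hopf_data" where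
  "presented_hopf K S R cm cu an =
    (let Q = presented_algebra K S R in
      module.extend Q (hopf_data.fields
        (\<lambda>q. the_elem (free_ext K (tensor K Q Q) cm ` q))
        (\<lambda>q. the_elem (free_ext K (self_algebra K) cu ` q))
        (\<lambda>q. the_elem (free_ext K (opposite Q) an ` q))))"

datatype gen = Gen_g | Gen_x | Gen_c


subsection \<open>Sweedler's Hopf algebra\<close>

definition H4_rels ::
  "('k, 'c) ring_scheme \<Rightarrow> ((gen list \<Rightarrow> 'k) \<times> (gen list \<Rightarrow> 'k)) set" where
  "H4_rels K =
    (let F = free_algebra K {Gen_g, Gen_x};
         g = basis_elt K [Gen_g]; x = basis_elt K [Gen_x] in
      {(g [^]\<^bsub>F\<^esub> (2::nat), \<one>\<^bsub>F\<^esub>),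
       (x [^]\<^bsub>F\<^esub> (2::nat), \<zero>\<^bsub>F\<^esub>),
       (x \<otimes>\<^bsub>F\<^esub> g, \<ominus>\<^bsub>F\<^esub> (g \<otimes>\<^bsub>F\<^esub> x))})"

text \<open>
  Since \<open>Gen_c\<close> is not a generator of \<open>H\<^sub>4\<close>, the values in the last clause of each case
  expression are irrelevant.
\<close>

definition H4 :: "('k, 'c) ring_scheme \<Rightarrow> ('k, (gen list \<Rightarrow> 'k) set) hopf_data" where
  "H4 K =
    (let gens = {Gen_g, Gen_x}; R = H4_rels K;
         Q = presented_algebra K gens R; T = tensor K Q Q;
         g = presented_gen K gens R Gen_g; x = presented_gen K gens R Gen_x in
      presented_hopf K gens R
        (\<lambda>s. case s of
            Gen_g \<Rightarrow> pure_tensor K Q Q g g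
          | Gen_x \<Rightarrow> pure_tensor K Q Q x \<one>\<^bsub>Q\<^esub> \<oplus>\<^bsub>T\<^esub> pure_tensor K Q Q g x
          | Gen_c \<Rightarrow> \<one>\<^bsub>T\<^esub>)
        (\<lambda>s. case s of Gen_g \<Rightarrow> \<one>\<^bsub>K\<^esub> | Gen_x \<Rightarrow> \<zero>\<^bsub>K\<^esub> | Gen_c \<Rightarrow> \<one>\<^bsub>K\<^esub>)
        (\<lambda>s. case s of Gen_g \<Rightarrow> g | Gen_x \<Rightarrow> \<ominus>\<^bsub>Q\<^esub> (g \<otimes>\<^bsub>Q\<^esub> x) | Gen_c \<Rightarrow> \<one>\<^bsub>Q\<^esub>))"


subsection \<open>The Hopf algebras \<open>H\<^bsub>4n,\<omega>\<^esub>\<close>\<close>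

definition U :: "nat \<Rightarrow> ('k, 'c) ring_scheme \<Rightarrow> 'k set" where
  "U n K = {\<omega> \<in> carrier K. \<omega> [^]\<^bsub>K\<^esub> n = \<one>\<^bsub>K\<^esub>}"

definition H4n_rels ::
  "('k, 'c) ring_scheme \<Rightarrow> nat \<Rightarrow> 'k \<Rightarrow> ((gen list \<Rightarrow> 'k) \<times> (gen list \<Rightarrow> 'k)) set" where
  "H4n_rels K n \<omega> =
    (let F = free_algebra K {Gen_g, Gen_x, Gen_c};
         g = basis_elt K [Gen_g]; x = basis_elt K [Gen_x]; c = basis_elt K [Gen_c] in
      {(g [^]\<^bsub>F\<^esub> (2::nat), \<one>\<^bsub>F\<^esub>),
       (c [^]\<^bsub>F\<^esub> n, \<one>\<^bsub>F\<^esub>),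
       (x [^]\<^bsub>F\<^esub> (2::nat), \<zero>\<^bsub>F\<^esub>),
       (x \<otimes>\<^bsub>F\<^esub> g, \<ominus>\<^bsub>F\<^esub> (g \<otimes>\<^bsub>F\<^esub> x)),
       (c \<otimes>\<^bsub>F\<^esub> g, g \<otimes>\<^bsub>F\<^esub> c),
       (c \<otimes>\<^bsub>F\<^esub> x, \<omega> \<odot>\<^bsub>F\<^esub> (x \<otimes>\<^bsub>F\<^esub> c))})"

definition H4n ::
  "('k, 'c) ring_scheme \<Rightarrow> nat \<Rightarrow> 'k \<Rightarrow> ('k, (gen list \<Rightarrow> 'k) set) hopf_data" where
  "H4n K n \<omega> =
    (let gens = {Gen_g, Gen_x, Gen_c}; R = H4n_rels K n \<omega>;
         Q = presented_algebra K gens R; T = tensor K Q Q;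
         g = presented_gen K gens R Gen_g; x = presented_gen K gens R Gen_x;
         c = presented_gen K gens R Gen_c in
      presented_hopf K gens R
        (\<lambda>s. case s of
            Gen_g \<Rightarrow> pure_tensor K Q Q g g
          | Gen_x \<Rightarrow> pure_tensor K Q Q x \<one>\<^bsub>Q\<^esub> \<oplus>\<^bsub>T\<^esub> pure_tensor K Q Q g x
          | Gen_c \<Rightarrow> pure_tensor K Q Q c c)
        (\<lambda>s. case s of Gen_g \<Rightarrow> \<one>\<^bsub>K\<^esub> | Gen_x \<Rightarrow> \<zero>\<^bsub>K\<^esub> | Gen_c \<Rightarrow> \<one>\<^bsub>K\<^esub>)
        (\<lambda>s. case s of
            Gen_g \<Rightarrow> g
          | Gen_x \<Rightarrow> \<ominus>\<^bsub>Q\<^esub> (g \<otimes>\<^bsub>Q\<^esub> x)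
          | Gen_c \<Rightarrow> c [^]\<^bsub>Q\<^esub> (n - 1)))"

end

theory Submission
  imports Defs
begin

text \<open>
  Let \<open>E\<close> factorize through \<open>H\<^sub>4\<close> and \<open>k[C\<^sub>n]\<close>, and let \<open>G\<close>, \<open>Y\<close>, \<open>C\<close> be the images in \<open>E\<close> of \<open>g\<close>, \<open>x\<close> and a
  generator of \<open>C\<^sub>n\<close>. The monomials \<open>G\<^sup>a Y\<^sup>s C\<^sup>d\<close> form a basis of \<open>E\<close>, and their comultiplication
  is known: \<open>G\<^sup>a C\<^sup>d\<close> is group-like, and \<open>G\<^sup>a Y C\<^sup>d\<close> is skew-primitive between two of these.
  Only the commutation of \<open>C\<close> with \<open>G\<close> and \<open>Y\<close> is unknown. Put \<open>C' = C\<^bsup>n-1\<^esup>\<close>, the inverse of \<open>C\<close>.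
  Then \<open>CYC'\<close> is skew-primitive between \<open>1\<close> and the group-like \<open>CGC'\<close>, and the coalgebra structure
  leaves no choice for it: applying the coordinate functionals to one factor of \<open>\<Delta>(CYC')\<close> gives
  \<open>CGC' = G\<close> and \<open>CYC' = \<omega> Y + \<alpha> (G - 1)\<close> with \<open>\<omega> \<noteq> 0\<close>. Since \<open>G\<close> anticommutes with \<open>Y\<close> and commutes
  with \<open>C\<close>, it anticommutes with \<open>CYC'\<close>, so that \<open>2\<alpha> = 0\<close> and, the characteristic not being \<open>2\<close>,
  \<open>\<alpha> = 0\<close>. Finally \<open>C\<^sup>n = 1\<close> forces \<open>\<omega>\<^sup>n = 1\<close>. This is \<open>sweedler_hopf_if_factorizes\<close>.

  Now \<open>G\<close>, \<open>Y\<close>, \<open>C\<close> satisfy the relations of \<open>H\<^bsub>4n,\<omega>\<^esub>\<close>, so the presentation gives an algebra map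
  \<open>H\<^bsub>4n,\<omega>\<^esub> \<rightarrow> E\<close>. It takes monomials to monomials, hence is bijective, and it respects the Hopf
  structure because that structure is determined on the monomials
  (\<open>isomorphic_if_sweedler_hopf\<close>). Conversely, a basis of monomials in \<open>E\<close> exhibits \<open>E\<close> as
  \<open>H\<^sub>4 \<otimes> k[C\<^sub>n]\<close> (\<open>factorizes_if_sweedler_hopf\<close>).

  Two observations keep the verification that \<open>H\<^bsub>4n,\<omega>\<^esub>\<close> is a Hopf algebra short. First, an
  algebra with elements \<open>g\<close>, \<open>x\<close>, \<open>c\<close> satisfying the relations (\<open>sweedler_relations\<close>) yields such
  elements in its tensor square, in the ground field and in its opposite algebra; this is exactly
  the existence of \<open>\<Delta>\<close>, \<open>\<epsilon>\<close> and \<open>S\<close>. Second, the remaining axioms are identities between linear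
  maps and may be checked on the monomials, where they hold because these are group-like or
  skew-primitive (\<open>hopf_algebraI\<close>). The algebra \<open>H\<^sub>4\<close> is treated at the same time as the case
  \<open>c = 1\<close>, \<open>n = 1\<close>, \<open>\<omega> = 1\<close>. The monomials are independent in \<open>H\<^bsub>4n,\<omega>\<^esub>\<close> because they act
  independently on a space of functions (\<open>regular_model\<close>); this gives the dimension. For
  pointedness, the same coordinate functionals find a group-like element in every nonzero
  subcoalgebra. The left ideal generated by \<open>x\<close> is nonzero and has square zero, so it has no
  complement, and \<open>H\<^bsub>4n,\<omega>\<^esub>\<close> is not semisimple.
\<close>

section \<open>Algebras, linear maps and spanning sets\<close>

lemma vectorspaceI:
  assumes K: "field K"
    and ac: "\<And>x y. x \<in> carrier V \<Longrightarrow> y \<in> carrier V \<Longrightarrow> x \<oplus>\<^bsub>V\<^esub> y \<in> carrier V"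
    and zc: "\<zero>\<^bsub>V\<^esub> \<in> carrier V"
    and sc: "\<And>r x. r \<in> carrier K \<Longrightarrow> x \<in> carrier V \<Longrightarrow> r \<odot>\<^bsub>V\<^esub> x \<in> carrier V"
    and aa: "\<And>x y z. x \<in> carrier V \<Longrightarrow> y \<in> carrier V \<Longrightarrow> z \<in> carrier V \<Longrightarrow>
        (x \<oplus>\<^bsub>V\<^esub> y) \<oplus>\<^bsub>V\<^esub> z = x \<oplus>\<^bsub>V\<^esub> (y \<oplus>\<^bsub>V\<^esub> z)"
    and comm: "\<And>x y. x \<in> carrier V \<Longrightarrow> y \<in> carrier V \<Longrightarrow> x \<oplus>\<^bsub>V\<^esub> y = y \<oplus>\<^bsub>V\<^esub> x"
    and zl: "\<And>x. x \<in> carrier V \<Longrightarrow> \<zero>\<^bsub>V\<^esub> \<oplus>\<^bsub>V\<^esub> x = x"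
    and neg: "\<And>x. x \<in> carrier V \<Longrightarrow> \<exists>y\<in>carrier V. y \<oplus>\<^bsub>V\<^esub> x = \<zero>\<^bsub>V\<^esub>"
    and sl: "\<And>r s x. r \<in> carrier K \<Longrightarrow> s \<in> carrier K \<Longrightarrow> x \<in> carrier V \<Longrightarrow>
        (r \<oplus>\<^bsub>K\<^esub> s) \<odot>\<^bsub>V\<^esub> x = r \<odot>\<^bsub>V\<^esub> x \<oplus>\<^bsub>V\<^esub> s \<odot>\<^bsub>V\<^esub> x"
    and sr: "\<And>r x y. r \<in> carrier K \<Longrightarrow> x \<in> carrier V \<Longrightarrow> y \<in> carrier V \<Longrightarrow>
        r \<odot>\<^bsub>V\<^esub> (x \<oplus>\<^bsub>V\<^esub> y) = r \<odot>\<^bsub>V\<^esub> x \<oplus>\<^bsub>V\<^esub> r \<odot>\<^bsub>V\<^esub> y"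
    and sa: "\<And>r s x. r \<in> carrier K \<Longrightarrow> s \<in> carrier K \<Longrightarrow> x \<in> carrier V \<Longrightarrow>
        (r \<otimes>\<^bsub>K\<^esub> s) \<odot>\<^bsub>V\<^esub> x = r \<odot>\<^bsub>V\<^esub> (s \<odot>\<^bsub>V\<^esub> x)"
    and so: "\<And>x. x \<in> carrier V \<Longrightarrow> \<one>\<^bsub>K\<^esub> \<odot>\<^bsub>V\<^esub> x = x"
  shows "vectorspace K V"
proof -
  interpret K: field K by fact
  have "abelian_group V"
    by (rule abelian_groupI) (use ac zc aa comm zl neg in auto)
  then have "module K V"
    by (intro moduleI) (use K.is_cring sc sl sr sa so in auto)
  then show ?thesis
    using K by (simp add: vectorspace_def)
qed

lemma k_algebraI:
  assumes V: "vectorspace K A"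
    and mc: "\<And>x y. x \<in> carrier A \<Longrightarrow> y \<in> carrier A \<Longrightarrow> x \<otimes>\<^bsub>A\<^esub> y \<in> carrier A"
    and oc: "\<one>\<^bsub>A\<^esub> \<in> carrier A"
    and ma: "\<And>x y z. x \<in> carrier A \<Longrightarrow> y \<in> carrier A \<Longrightarrow> z \<in> carrier A \<Longrightarrow>
        (x \<otimes>\<^bsub>A\<^esub> y) \<otimes>\<^bsub>A\<^esub> z = x \<otimes>\<^bsub>A\<^esub> (y \<otimes>\<^bsub>A\<^esub> z)"
    and ol: "\<And>x. x \<in> carrier A \<Longrightarrow> \<one>\<^bsub>A\<^esub> \<otimes>\<^bsub>A\<^esub> x = x"
    and or: "\<And>x. x \<in> carrier A \<Longrightarrow> x \<otimes>\<^bsub>A\<^esub> \<one>\<^bsub>A\<^esub> = x"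
    and dl: "\<And>x y z. x \<in> carrier A \<Longrightarrow> y \<in> carrier A \<Longrightarrow> z \<in> carrier A \<Longrightarrow>
        (x \<oplus>\<^bsub>A\<^esub> y) \<otimes>\<^bsub>A\<^esub> z = x \<otimes>\<^bsub>A\<^esub> z \<oplus>\<^bsub>A\<^esub> y \<otimes>\<^bsub>A\<^esub> z"
    and dr: "\<And>x y z. x \<in> carrier A \<Longrightarrow> y \<in> carrier A \<Longrightarrow> z \<in> carrier A \<Longrightarrow>
        z \<otimes>\<^bsub>A\<^esub> (x \<oplus>\<^bsub>A\<^esub> y) = z \<otimes>\<^bsub>A\<^esub> x \<oplus>\<^bsub>A\<^esub> z \<otimes>\<^bsub>A\<^esub> y"
    and sl: "\<And>r x y. r \<in> carrier K \<Longrightarrow> x \<in> carrier A \<Longrightarrow> y \<in> carrier A \<Longrightarrow>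
        (r \<odot>\<^bsub>A\<^esub> x) \<otimes>\<^bsub>A\<^esub> y = r \<odot>\<^bsub>A\<^esub> (x \<otimes>\<^bsub>A\<^esub> y)"
    and sr: "\<And>r x y. r \<in> carrier K \<Longrightarrow> x \<in> carrier A \<Longrightarrow> y \<in> carrier A \<Longrightarrow>
        x \<otimes>\<^bsub>A\<^esub> (r \<odot>\<^bsub>A\<^esub> y) = r \<odot>\<^bsub>A\<^esub> (x \<otimes>\<^bsub>A\<^esub> y)"
  shows "k_algebra K A"
proof -
  interpret vectorspace K A by fact
  have "ring A"
  proof (rule ringI)
    show "abelian_group A" ..
    show "Group.monoid A" by (rule monoidI) (use mc oc ma ol or in auto)
  qed (use dl dr in auto)
  then show ?thesis
    unfolding k_algebra_def k_algebra_axioms_def using V sl sr by auto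
qed

lemma vectorspace_cong:
  assumes "vectorspace K V" "carrier W = carrier V" "ring.add W = ring.add V" "ring.zero W = ring.zero V" "smult W = smult V"
  shows "vectorspace K W"
proof -
  interpret vectorspace K V by fact
  have K: "field K" ..
  show ?thesis
  proof (rule vectorspaceI[OF K], unfold assms(2-5))
    show "\<exists>y\<in>carrier V. y \<oplus>\<^bsub>V\<^esub> x = \<zero>\<^bsub>V\<^esub>" if "x \<in> carrier V" for x
      using that M.l_neg by blast
  qed (auto simp: M.a_ac smult_l_distr smult_r_distr smult_assoc1)
qed

lemma k_algebra_cong:
  assumes "k_algebra K A" "carrier B = carrier A" "ring.add B = ring.add A" "ring.zero B = ring.zero A"
    "smult B = smult A" "monoid.mult B = monoid.mult A" "monoid.one B = monoid.one A"
  shows "k_algebra K B"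
proof -
  interpret k_algebra K A by fact
  have "vectorspace K A" ..
  then have V: "vectorspace K B" by (rule vectorspace_cong) (use assms in auto)
  show ?thesis
    by (rule k_algebraI[OF V], unfold assms(2-7))
      (auto simp: A.m_assoc A.l_distr A.r_distr smult_mult_left smult_mult_right)
qed

lemma module_homI:
  assumes "\<And>x. x \<in> carrier V \<Longrightarrow> f x \<in> carrier W"
    "\<And>x y. x \<in> carrier V \<Longrightarrow> y \<in> carrier V \<Longrightarrow> f (x \<oplus>\<^bsub>V\<^esub> y) = f x \<oplus>\<^bsub>W\<^esub> f y"
    "\<And>r x. r \<in> carrier K \<Longrightarrow> x \<in> carrier V \<Longrightarrow> f (r \<odot>\<^bsub>V\<^esub> x) = r \<odot>\<^bsub>W\<^esub> f x"
  shows "f \<in> module_hom K V W"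
  using assms by (auto simp: module_hom_def)

lemma module_hom_in_carrier: "f \<in> module_hom K V W \<Longrightarrow> x \<in> carrier V \<Longrightarrow> f x \<in> carrier W"
  by (auto simp: module_hom_def)

lemmas module_homD = module_hom_in_carrier module_hom_add module_hom_smult

lemma module_hom_zero:
  assumes "module K V" "module K W" "f \<in> module_hom K V W"
  shows "f \<zero>\<^bsub>V\<^esub> = \<zero>\<^bsub>W\<^esub>"
proof -
  interpret mod_hom K V W f using assms by (simp add: mod_hom_def mod_hom_axioms_def)
  show ?thesis by simp
qed

lemma module_hom_finsum:
  assumes "module K V" "module K W" "f \<in> module_hom K V W"
    and "finite I" "v \<in> I \<rightarrow> carrier V"
  shows "f (\<Oplus>\<^bsub>V\<^esub>i\<in>I. v i) = (\<Oplus>\<^bsub>W\<^esub>i\<in>I. f (v i))"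
proof -
  interpret V: module K V by fact
  interpret W: module K W by fact
  show ?thesis using assms(4,5)
  proof (induction rule: finite_induct)
    case empty
    then show ?case using module_hom_zero[OF assms(1-3)] by simp
  next
    case (insert i I)
    have "v i \<in> carrier V" "v \<in> I \<rightarrow> carrier V" using insert by auto
    then show ?case using insert module_homD[OF assms(3)]
      by (subst V.finsum_insert W.finsum_insert, auto)+
  qed
qed

lemma module_hom_comp:
  assumes "f \<in> module_hom K V W" "g \<in> module_hom K W Y"
  shows "(\<lambda>x. g (f x)) \<in> module_hom K V Y"
  using assms by (auto simp: module_hom_def Pi_iff)

lemma module_hom_id: "(\<lambda>x. x) \<in> module_hom K V V" "id \<in> module_hom K V V"
  by (auto simp: module_hom_def)

lemma alg_homI:
  assumes "f \<in> module_hom K A B"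
    "\<And>x y. x \<in> carrier A \<Longrightarrow> y \<in> carrier A \<Longrightarrow> f (x \<otimes>\<^bsub>A\<^esub> y) = f x \<otimes>\<^bsub>B\<^esub> f y"
    "f \<one>\<^bsub>A\<^esub> = \<one>\<^bsub>B\<^esub>"
  shows "f \<in> alg_hom K A B"
  using assms by (auto simp: alg_hom_def module_hom_def intro!: ring_hom_memI)

lemma alg_homD:
  assumes "f \<in> alg_hom K A B"
  shows "f \<in> module_hom K A B" "f \<in> ring_hom A B"
    "\<And>x. x \<in> carrier A \<Longrightarrow> f x \<in> carrier B"
    "\<And>x y. x \<in> carrier A \<Longrightarrow> y \<in> carrier A \<Longrightarrow> f (x \<otimes>\<^bsub>A\<^esub> y) = f x \<otimes>\<^bsub>B\<^esub> f y"
    "\<And>x y. x \<in> carrier A \<Longrightarrow> y \<in> carrier A \<Longrightarrow> f (x \<oplus>\<^bsub>A\<^esub> y) = f x \<oplus>\<^bsub>B\<^esub> f y"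
    "\<And>r x. r \<in> carrier K \<Longrightarrow> x \<in> carrier A \<Longrightarrow> f (r \<odot>\<^bsub>A\<^esub> x) = r \<odot>\<^bsub>B\<^esub> f x"
    "f \<one>\<^bsub>A\<^esub> = \<one>\<^bsub>B\<^esub>"
  using assms by (auto simp: alg_hom_def module_hom_def ring_hom_def)

lemma alg_hom_pow:
  assumes "k_algebra K A" "k_algebra K B" "f \<in> alg_hom K A B" "x \<in> carrier A"
  shows "f (x [^]\<^bsub>A\<^esub> (m::nat)) = f x [^]\<^bsub>B\<^esub> m"
proof -
  interpret A: k_algebra K A by fact
  interpret B: k_algebra K B by fact
  show ?thesis
    by (induction m) (use assms alg_homD[OF assms(3)] in auto)
qed

lemma self_algebra_simps [simp]:
  "carrier (self_algebra K) = carrier K" "monoid.mult (self_algebra K) = monoid.mult K"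
  "monoid.one (self_algebra K) = monoid.one K" "ring.zero (self_algebra K) = ring.zero K"
  "ring.add (self_algebra K) = ring.add K" "smult (self_algebra K) = monoid.mult K"
  by (simp_all add: self_algebra_def)

lemma k_algebra_self_algebra:
  assumes "field K" shows "k_algebra K (self_algebra K)"
proof -
  interpret K: field K by fact
  have "vectorspace K (self_algebra K)"
  proof (rule vectorspaceI[OF assms])
    show "\<exists>y\<in>carrier (self_algebra K). y \<oplus>\<^bsub>self_algebra K\<^esub> x = \<zero>\<^bsub>self_algebra K\<^esub>"
      if "x \<in> carrier (self_algebra K)" for x
      using that by (auto intro!: bexI[of _ "\<ominus>\<^bsub>K\<^esub> x"] K.l_neg)
  qed (auto simp: K.l_distr K.r_distr K.a_ac K.m_ac)
  then show ?thesis
    by (rule k_algebraI) (auto simp: K.l_distr K.r_distr K.a_ac K.m_ac)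
qed

lemma opposite_simps [simp]:
  "carrier (opposite A) = carrier A" "monoid.mult (opposite A) = (\<lambda>a b. b \<otimes>\<^bsub>A\<^esub> a)"
  "monoid.one (opposite A) = monoid.one A" "ring.zero (opposite A) = ring.zero A"
  "ring.add (opposite A) = ring.add A" "smult (opposite A) = smult A"
  by (simp_all add: opposite_def)

lemma k_algebra_opposite:
  assumes "k_algebra K A" shows "k_algebra K (opposite A)"
proof -
  interpret k_algebra K A by fact
  have "vectorspace K A" ..
  then have "vectorspace K (opposite A)" by (rule vectorspace_cong) auto
  then show ?thesis
    by (rule k_algebraI) (auto simp: A.m_assoc A.l_distr A.r_distr smult_mult_left smult_mult_right)
qed

text \<open>The elements with a property that is stable under linear combinations form a submodule.\<close>

lemma (in module) span_induct:
  assumes "module.span R M B = carrier M" "x \<in> carrier M"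
    and B: "\<And>b. b \<in> B \<Longrightarrow> P b"
    and zero: "P \<zero>\<^bsub>M\<^esub>"
    and add: "\<And>x y. x \<in> carrier M \<Longrightarrow> y \<in> carrier M \<Longrightarrow> P x \<Longrightarrow> P y \<Longrightarrow> P (x \<oplus>\<^bsub>M\<^esub> y)"
    and smult: "\<And>r x. r \<in> carrier R \<Longrightarrow> x \<in> carrier M \<Longrightarrow> P x \<Longrightarrow> P (r \<odot>\<^bsub>M\<^esub> x)"
    and sub: "B \<subseteq> carrier M"
  shows "P x"
proof -
  have "submodule R {x \<in> carrier M. P x} M"
    using zero add smult module_axioms by (auto simp: submodule_def)
  from span_is_subset[OF _ this, of B] B sub have "span B \<subseteq> {x \<in> carrier M. P x}" by blast
  then show ?thesis using assms(1,2) by auto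
qed

lemma module_hom_eq_on_span:
  assumes V: "module K V" and W: "module K W"
    and f: "f \<in> module_hom K V W" and g: "g \<in> module_hom K V W"
    and B: "module.span K V B = carrier V" "B \<subseteq> carrier V"
    and eq: "\<And>b. b \<in> B \<Longrightarrow> f b = g b" and x: "x \<in> carrier V"
  shows "f x = g x"
proof -
  interpret V: module K V by fact
  show ?thesis
    by (rule V.span_induct[OF B(1) x])
      (use B eq module_homD[OF f] module_homD[OF g] module_hom_zero[OF V W f] module_hom_zero[OF V W g] in auto)
qed

lemma span_cong:
  fixes V :: "('k, 'b, 'm) module_scheme" and W :: "('k, 'b, 'n) module_scheme"
  assumes "module K V" "module K W" "carrier W = carrier V" "ring.add W = ring.add V" "smult W = smult V"
    "ring.zero W = ring.zero V"
  shows "module.span K W = module.span K V"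
proof -
  have "finsum W f S = finsum V f S" for f and S :: "'b set"
    using assms by (simp add: finsum_def finprod_def)
  then show ?thesis
    by (intro ext) (simp add: module.span_def[OF assms(1)] module.span_def[OF assms(2)]
      module.lincomb_def[OF assms(1)] module.lincomb_def[OF assms(2)] assms)
qed

lemma alg_hom_minus:
  assumes "k_algebra K A" "k_algebra K B" "f \<in> alg_hom K A B" "z \<in> carrier A"
  shows "f (\<ominus>\<^bsub>A\<^esub> z) = \<ominus>\<^bsub>B\<^esub> f z"
proof -
  interpret A: k_algebra K A by fact
  interpret B: k_algebra K B by fact
  interpret mod_hom K A B f by unfold_locales (rule alg_homD(1)[OF assms(3)])
  show ?thesis using assms(4) by simp
qed

lemma nat_pow_cong:
  assumes "monoid.mult B = monoid.mult A" "monoid.one B = monoid.one A"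
  shows "z [^]\<^bsub>B\<^esub> (m::nat) = z [^]\<^bsub>A\<^esub> m"
  using assms by (simp add: nat_pow_def)

lemma a_inv_cong:
  assumes "carrier B = carrier A" "ring.add B = ring.add A" "ring.zero B = ring.zero A"
  shows "\<ominus>\<^bsub>B\<^esub> z = \<ominus>\<^bsub>A\<^esub> z"
  using assms by (simp add: a_inv_def m_inv_def)

lemma alg_hom_cong:
  assumes "carrier A' = carrier A" "ring.add A' = ring.add A" "smult A' = smult A"
    "monoid.mult A' = monoid.mult A" "monoid.one A' = monoid.one A"
    "carrier B' = carrier B" "ring.add B' = ring.add B" "smult B' = smult B"
    "monoid.mult B' = monoid.mult B" "monoid.one B' = monoid.one B"
  shows "alg_hom K A' B' = alg_hom K A B"
  by (simp add: alg_hom_def module_hom_def ring_hom_def assms)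

lemma span_surj_image:
  assumes V: "vectorspace K V" and W: "vectorspace K W" and f: "f \<in> module_hom K V W"
    and surj: "f ` carrier V = carrier W" and B: "module.span K V B = carrier V" "B \<subseteq> carrier V"
  shows "module.span K W (f ` B) = carrier W"
proof -
  interpret V: vectorspace K V by fact
  interpret W: vectorspace K W by fact
  have fB: "f ` B \<subseteq> carrier W" using B(2) module_homD(1)[OF f] by auto
  interpret N: submodule K "W.span (f ` B)" W by (rule W.span_is_submodule[OF fB])
  have *: "f z \<in> W.span (f ` B)" if z: "z \<in> carrier V" for z
    by (rule V.span_induct[OF B(1) z _ _ _ _ B(2)])
      (use W.in_own_span[OF fB] module_homD[OF f] module_hom_zero[OF V.module_axioms W.module_axioms f] in auto)
  have "carrier W \<subseteq> W.span (f ` B)"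
    unfolding surj[symmetric] by (rule image_subsetI[OF *])
  with W.span_is_subset2[OF fB] show ?thesis by (rule antisym)
qed

lemma module_hom_inverse:
  assumes V: "module K V" and f: "f \<in> module_hom K V W" and bij: "bij_betw f (carrier V) (carrier W)"
  shows "inv_into (carrier V) f \<in> module_hom K W V"
proof -
  interpret V: module K V by fact
  let ?h = "inv_into (carrier V) f"
  note f' = module_homD[OF f]
  have h: "?h b \<in> carrier V" "f (?h b) = b" if "b \<in> carrier W" for b
    using bij that by (auto simp: bij_betw_def inv_into_into f_inv_into_f)
  have eq: "?h b = a" if "a \<in> carrier V" "f a = b" for a b
    using bij that by (auto simp: bij_betw_def)
  show ?thesis
    by (intro module_homI) (auto intro!: eq simp: h f')
qed

lemma alg_hom_inverse:
  assumes A: "k_algebra K A" and f: "f \<in> alg_hom K A B" and bij: "bij_betw f (carrier A) (carrier B)"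
  shows "inv_into (carrier A) f \<in> alg_hom K B A"
proof -
  interpret A: k_algebra K A by fact
  note f' = alg_homD[OF f]
  have h: "inv_into (carrier A) f b \<in> carrier A" "f (inv_into (carrier A) f b) = b" if "b \<in> carrier B" for b
    using bij that by (auto simp: bij_betw_def inv_into_into f_inv_into_f)
  have eq: "inv_into (carrier A) f b = a" if "a \<in> carrier A" "f a = b" for a b
    using bij that by (auto simp: bij_betw_def)
  show ?thesis
  proof (rule alg_homI)
    have "module K A" ..
    then show "inv_into (carrier A) f \<in> module_hom K B A" by (rule module_hom_inverse[OF _ f'(1) bij])
  qed (auto intro!: eq simp: h f')
qed

lemma pow_two:
  assumes "k_algebra K A" "z \<in> carrier A" shows "z [^]\<^bsub>A\<^esub> (2::nat) = z \<otimes>\<^bsub>A\<^esub> z"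
proof -
  interpret k_algebra K A by fact
  show ?thesis using assms(2) by (simp add: numeral_2_eq_2)
qed

section \<open>Monoid algebras\<close>

lemma monoid_algebra_simps [simp]:
  "carrier (monoid_algebra K M) =
    {f. range f \<subseteq> carrier K \<and> finite {m. f m \<noteq> \<zero>\<^bsub>K\<^esub>} \<and> {m. f m \<noteq> \<zero>\<^bsub>K\<^esub>} \<subseteq> carrier M}"
  "\<one>\<^bsub>monoid_algebra K M\<^esub> = basis_elt K \<one>\<^bsub>M\<^esub>"
  "\<zero>\<^bsub>monoid_algebra K M\<^esub> = (\<lambda>m. \<zero>\<^bsub>K\<^esub>)"
  "f \<oplus>\<^bsub>monoid_algebra K M\<^esub> h = (\<lambda>m. f m \<oplus>\<^bsub>K\<^esub> h m)"
  "r \<odot>\<^bsub>monoid_algebra K M\<^esub> f = (\<lambda>m. r \<otimes>\<^bsub>K\<^esub> f m)"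
  by (simp_all add: monoid_algebra_def)

context field begin

lemma monoid_algebra_carrierI:
  assumes "\<And>m. f m \<in> carrier R" "finite P" "P \<subseteq> carrier M" "\<And>m. m \<notin> P \<Longrightarrow> f m = \<zero>"
  shows "f \<in> carrier (monoid_algebra R M)"
proof -
  have "{m. f m \<noteq> \<zero>} \<subseteq> P" using assms by auto
  then show ?thesis using assms finite_subset by auto
qed

lemma basis_elt_in_carrier:
  assumes "m \<in> carrier M" shows "basis_elt R m \<in> carrier (monoid_algebra R M)"
  by (rule monoid_algebra_carrierI[of _ "{m}"]) (use assms in \<open>auto simp: basis_elt_def\<close>)

lemma monoid_algebra_vectorspace: "vectorspace R (monoid_algebra R M)"
proof (rule vectorspaceI)
  show "field R" ..
  show "f \<oplus>\<^bsub>monoid_algebra R M\<^esub> h \<in> carrier (monoid_algebra R M)"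
    if "f \<in> carrier (monoid_algebra R M)" "h \<in> carrier (monoid_algebra R M)" for f h
    by (rule monoid_algebra_carrierI[of _ "{m. f m \<noteq> \<zero>} \<union> {m. h m \<noteq> \<zero>}"])
      (use that in \<open>auto simp: image_subset_iff\<close>)
  show "r \<odot>\<^bsub>monoid_algebra R M\<^esub> f \<in> carrier (monoid_algebra R M)"
    if "r \<in> carrier R" "f \<in> carrier (monoid_algebra R M)" for r f
    by (rule monoid_algebra_carrierI[of _ "{m. f m \<noteq> \<zero>}"])
      (use that in \<open>auto simp: image_subset_iff\<close>)
  show "\<exists>h\<in>carrier (monoid_algebra R M). h \<oplus>\<^bsub>monoid_algebra R M\<^esub> f = \<zero>\<^bsub>monoid_algebra R M\<^esub>"
    if f: "f \<in> carrier (monoid_algebra R M)" for f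
  proof
    show "(\<lambda>m. \<ominus> f m) \<in> carrier (monoid_algebra R M)"
      by (rule monoid_algebra_carrierI[of _ "{m. f m \<noteq> \<zero>}"]) (use f in \<open>auto simp: image_subset_iff\<close>)
    show "(\<lambda>m. \<ominus> f m) \<oplus>\<^bsub>monoid_algebra R M\<^esub> f = \<zero>\<^bsub>monoid_algebra R M\<^esub>"
      using f by (auto simp: l_neg image_subset_iff)
  qed
qed (auto simp: fun_eq_iff image_subset_iff l_distr r_distr a_ac m_ac)

text \<open>By induction on the support: a function is a multiple of a basis element plus a function that
  vanishes at one point more.\<close>

lemma monoid_algebra_induct:
  assumes f: "f \<in> carrier (monoid_algebra R M)"
    and zero: "P \<zero>\<^bsub>monoid_algebra R M\<^esub>"
    and basis: "\<And>m. m \<in> carrier M \<Longrightarrow> P (basis_elt R m)"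
    and add: "\<And>f h. f \<in> carrier (monoid_algebra R M) \<Longrightarrow> h \<in> carrier (monoid_algebra R M) \<Longrightarrow>
        P f \<Longrightarrow> P h \<Longrightarrow> P (f \<oplus>\<^bsub>monoid_algebra R M\<^esub> h)"
    and smult: "\<And>r f. r \<in> carrier R \<Longrightarrow> f \<in> carrier (monoid_algebra R M) \<Longrightarrow> P f \<Longrightarrow>
        P (r \<odot>\<^bsub>monoid_algebra R M\<^esub> f)"
  shows "P f"
proof -
  interpret F: vectorspace R "monoid_algebra R M" by (rule monoid_algebra_vectorspace)
  have "P f" if "finite S" "{m. f m \<noteq> \<zero>} = S" "f \<in> carrier (monoid_algebra R M)" for S f
    using that
  proof (induction S arbitrary: f rule: finite_induct)
    case empty
    then have "f = \<zero>\<^bsub>monoid_algebra R M\<^esub>" by auto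
    then show ?case using zero by simp
  next
    case (insert m S)
    define f' where "f' = f(m := \<zero>)"
    have fm: "f m \<in> carrier R" "m \<in> carrier M" and fK: "\<And>p. f p \<in> carrier R" using insert.prems by auto
    have f': "f' \<in> carrier (monoid_algebra R M)"
      by (rule monoid_algebra_carrierI[of _ "{m. f m \<noteq> \<zero>}"]) (use insert.prems in \<open>auto simp: f'_def\<close>)
    have "{m. f' m \<noteq> \<zero>} = S" using insert by (auto simp: f'_def)
    then have "P f'" using insert.IH f' by auto
    moreover have "P (f m \<odot>\<^bsub>monoid_algebra R M\<^esub> basis_elt R m)"
      by (intro smult basis basis_elt_in_carrier fm)
    ultimately have "P f'" and "P (f m \<odot>\<^bsub>monoid_algebra R M\<^esub> basis_elt R m)" by auto
    then have "P (f' \<oplus>\<^bsub>monoid_algebra R M\<^esub> (f m \<odot>\<^bsub>monoid_algebra R M\<^esub> basis_elt R m))"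
      by (intro add f' F.smult_closed basis_elt_in_carrier fm)
    also have "f' \<oplus>\<^bsub>monoid_algebra R M\<^esub> (f m \<odot>\<^bsub>monoid_algebra R M\<^esub> basis_elt R m) = f"
      using fm fK by (auto simp: f'_def basis_elt_def)
    finally show ?case .
  qed
  then show ?thesis using f by auto
qed

text \<open>The support in the definition of \<^const>\<open>lin_ext\<close> may be enlarged to any finite set, which is
  what makes additivity visible.\<close>

lemma lin_ext_eq:
  assumes V: "module R V" and b: "b \<in> carrier M \<rightarrow> carrier V" and f: "f \<in> carrier (monoid_algebra R M)"
    and P: "finite P" "{m. f m \<noteq> \<zero>} \<subseteq> P" "P \<subseteq> carrier M"
  shows "lin_ext R V b f = (\<Oplus>\<^bsub>V\<^esub>m\<in>P. f m \<odot>\<^bsub>V\<^esub> b m)"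
proof -
  interpret V: module R V by fact
  have K: "f m \<in> carrier R" for m using f by auto
  show ?thesis unfolding lin_ext_def
    by (rule V.add.finprod_mono_neutral_cong_left[simplified])
      (use P b K in \<open>auto simp: Pi_iff subset_iff\<close>)
qed

lemma lin_ext_hom:
  fixes M :: "('m, 'd) monoid_scheme"
  assumes V: "module R V" and b: "b \<in> carrier M \<rightarrow> carrier V"
  shows "lin_ext R V b \<in> module_hom R (monoid_algebra R M) V"
proof (rule module_homI)
  interpret V: module R V by fact
  interpret F: vectorspace R "monoid_algebra R M" by (rule monoid_algebra_vectorspace)
  fix f assume f: "f \<in> carrier (monoid_algebra R M)"
  then have K: "f m \<in> carrier R" for m by auto
  show "lin_ext R V b f \<in> carrier V"
    unfolding lin_ext_def
    by (rule V.finsum_closed) (use f b K in \<open>auto simp: Pi_iff subset_iff\<close>)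
  show "lin_ext R V b (r \<odot>\<^bsub>monoid_algebra R M\<^esub> f) = r \<odot>\<^bsub>V\<^esub> lin_ext R V b f" if r: "r \<in> carrier R" for r
  proof -
    have "lin_ext R V b (r \<odot>\<^bsub>monoid_algebra R M\<^esub> f) =
        (\<Oplus>\<^bsub>V\<^esub>m\<in>{m. f m \<noteq> \<zero>}. (r \<odot>\<^bsub>monoid_algebra R M\<^esub> f) m \<odot>\<^bsub>V\<^esub> b m)"
      by (rule lin_ext_eq[OF V b]) (use f r F.smult_closed[OF r f] in auto)
    also have "\<dots> = (\<Oplus>\<^bsub>V\<^esub>m\<in>{m. f m \<noteq> \<zero>}. r \<odot>\<^bsub>V\<^esub> (f m \<odot>\<^bsub>V\<^esub> b m))"
      by (rule V.finsum_cong') (use f b r in \<open>auto simp: V.smult_assoc1 Pi_iff subset_iff\<close>)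
    also have "\<dots> = r \<odot>\<^bsub>V\<^esub> lin_ext R V b f"
      unfolding lin_ext_def by (rule V.finsum_smult_ldistr[symmetric]) (use f b r K in \<open>auto simp: Pi_iff subset_iff\<close>)
    finally show ?thesis .
  qed
  fix h assume h: "h \<in> carrier (monoid_algebra R M)"
  let ?P = "{m. f m \<noteq> \<zero>} \<union> {m. h m \<noteq> \<zero>}"
  have P: "finite ?P" "?P \<subseteq> carrier M" and K': "h m \<in> carrier R" for m using f h by auto
  have "lin_ext R V b (f \<oplus>\<^bsub>monoid_algebra R M\<^esub> h) =
      (\<Oplus>\<^bsub>V\<^esub>m\<in>?P. (f \<oplus>\<^bsub>monoid_algebra R M\<^esub> h) m \<odot>\<^bsub>V\<^esub> b m)"
    by (rule lin_ext_eq[OF V b F.a_closed[OF f h] P(1) _ P(2)]) auto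
  also have "\<dots> = (\<Oplus>\<^bsub>V\<^esub>m\<in>?P. f m \<odot>\<^bsub>V\<^esub> b m \<oplus>\<^bsub>V\<^esub> h m \<odot>\<^bsub>V\<^esub> b m)"
    by (rule V.finsum_cong') (use P b K K' in \<open>auto simp: V.smult_l_distr Pi_iff subset_iff\<close>)
  also have "\<dots> = (\<Oplus>\<^bsub>V\<^esub>m\<in>?P. f m \<odot>\<^bsub>V\<^esub> b m) \<oplus>\<^bsub>V\<^esub> (\<Oplus>\<^bsub>V\<^esub>m\<in>?P. h m \<odot>\<^bsub>V\<^esub> b m)"
    by (rule V.finsum_addf) (use P b K K' in \<open>auto simp: Pi_iff subset_iff\<close>)
  also have "\<dots> = lin_ext R V b f \<oplus>\<^bsub>V\<^esub> lin_ext R V b h"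
    using lin_ext_eq[OF V b f P(1) _ P(2)] lin_ext_eq[OF V b h P(1) _ P(2)] by simp
  finally show "lin_ext R V b (f \<oplus>\<^bsub>monoid_algebra R M\<^esub> h) = lin_ext R V b f \<oplus>\<^bsub>V\<^esub> lin_ext R V b h" .
qed

lemma lin_ext_basis:
  fixes M :: "('m, 'd) monoid_scheme"
  assumes V: "module R V" and b: "b \<in> carrier M \<rightarrow> carrier V" and m: "m \<in> carrier M"
  shows "lin_ext R V b (basis_elt R m) = b m"
proof -
  interpret V: module R V by fact
  have "lin_ext R V b (basis_elt R m) = (\<Oplus>\<^bsub>V\<^esub>p\<in>{m}. basis_elt R m p \<odot>\<^bsub>V\<^esub> b p)"
    by (rule lin_ext_eq[OF V b basis_elt_in_carrier[OF m]]) (use m in \<open>auto simp: basis_elt_def\<close>)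
  moreover have "b m \<in> carrier V" using b m by auto
  ultimately show ?thesis by (auto simp: basis_elt_def)
qed

lemma monoid_algebra_mult_eval:
  assumes f: "f \<in> carrier (monoid_algebra R M)" and h: "h \<in> carrier (monoid_algebra R M)"
    and P: "finite P" "{m. f m \<noteq> \<zero>} \<subseteq> P" and Q: "finite Q" "{m. h m \<noteq> \<zero>} \<subseteq> Q"
  shows "(f \<otimes>\<^bsub>monoid_algebra R M\<^esub> h) m =
    (\<Oplus>pq\<in>{(p, q) \<in> P \<times> Q. p \<otimes>\<^bsub>M\<^esub> q = m}. f (fst pq) \<otimes> h (snd pq))"
proof -
  have K: "f m \<in> carrier R" "h m \<in> carrier R" for m using f h by auto
  have fin: "finite {(p, q) \<in> P \<times> Q. p \<otimes>\<^bsub>M\<^esub> q = m}"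
    by (rule finite_subset[of _ "P \<times> Q"]) (use P Q in auto)
  show ?thesis unfolding monoid_algebra_def
    by (simp, rule add.finprod_mono_neutral_cong_left[simplified])
      (use fin P Q K in auto)
qed

end

locale monoid_over_field = K: field K + M: Group.monoid M for K (structure) and M (structure)
begin

abbreviation "F \<equiv> monoid_algebra K M"

sublocale F: vectorspace K F by (rule K.monoid_algebra_vectorspace)

lemma mult_closed:
  assumes f: "f \<in> carrier F" and h: "h \<in> carrier F"
  shows "f \<otimes>\<^bsub>F\<^esub> h \<in> carrier F"
proof (rule K.monoid_algebra_carrierI)
  let ?P = "{m. f m \<noteq> \<zero>\<^bsub>K\<^esub>}" and ?Q = "{m. h m \<noteq> \<zero>\<^bsub>K\<^esub>}"
  have P: "finite ?P" "finite ?Q" using f h by auto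
  note eval = K.monoid_algebra_mult_eval[OF f h P(1) subset_refl P(2) subset_refl]
  show "(f \<otimes>\<^bsub>F\<^esub> h) m \<in> carrier K" for m
    unfolding eval by (rule K.finsum_closed) (use f h in \<open>auto simp: image_subset_iff\<close>)
  show "finite ((\<lambda>(p, q). p \<otimes>\<^bsub>M\<^esub> q) ` (?P \<times> ?Q))" using P by auto
  show "(\<lambda>(p, q). p \<otimes>\<^bsub>M\<^esub> q) ` (?P \<times> ?Q) \<subseteq> carrier M" using f h by auto
  fix m assume "m \<notin> (\<lambda>(p, q). p \<otimes>\<^bsub>M\<^esub> q) ` (?P \<times> ?Q)"
  then have "{(p, q) \<in> ?P \<times> ?Q. p \<otimes>\<^bsub>M\<^esub> q = m} = {}" by auto
  then show "(f \<otimes>\<^bsub>F\<^esub> h) m = \<zero>\<^bsub>K\<^esub>" unfolding eval by (simp only: K.finsum_empty)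
qed

lemma mult_add_left:
  assumes f: "f \<in> carrier F" and f': "f' \<in> carrier F" and h: "h \<in> carrier F"
  shows "(f \<oplus>\<^bsub>F\<^esub> f') \<otimes>\<^bsub>F\<^esub> h = f \<otimes>\<^bsub>F\<^esub> h \<oplus>\<^bsub>F\<^esub> f' \<otimes>\<^bsub>F\<^esub> h"
proof
  fix m
  let ?P = "{m. f m \<noteq> \<zero>\<^bsub>K\<^esub>} \<union> {m. f' m \<noteq> \<zero>\<^bsub>K\<^esub>}" and ?Q = "{m. h m \<noteq> \<zero>\<^bsub>K\<^esub>}"
  let ?S = "{(p, q) \<in> ?P \<times> ?Q. p \<otimes>\<^bsub>M\<^esub> q = m}"
  have P: "finite ?P" "finite ?Q" and K: "f m \<in> carrier K" "f' m \<in> carrier K" "h m \<in> carrier K" for m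
    using f f' h by auto
  have "((f \<oplus>\<^bsub>F\<^esub> f') \<otimes>\<^bsub>F\<^esub> h) m = (\<Oplus>\<^bsub>K\<^esub>pq\<in>?S. (f \<oplus>\<^bsub>F\<^esub> f') (fst pq) \<otimes>\<^bsub>K\<^esub> h (snd pq))"
    by (rule K.monoid_algebra_mult_eval[OF F.a_closed[OF f f'] h P(1) _ P(2)]) auto
  also have "\<dots> = (\<Oplus>\<^bsub>K\<^esub>pq\<in>?S. f (fst pq) \<otimes>\<^bsub>K\<^esub> h (snd pq) \<oplus>\<^bsub>K\<^esub> f' (fst pq) \<otimes>\<^bsub>K\<^esub> h (snd pq))"
    by (rule K.finsum_cong') (use K in \<open>auto simp: K.l_distr\<close>)
  also have "\<dots> = (\<Oplus>\<^bsub>K\<^esub>pq\<in>?S. f (fst pq) \<otimes>\<^bsub>K\<^esub> h (snd pq)) \<oplus>\<^bsub>K\<^esub> (\<Oplus>\<^bsub>K\<^esub>pq\<in>?S. f' (fst pq) \<otimes>\<^bsub>K\<^esub> h (snd pq))"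
    by (rule K.finsum_addf) (use K in auto)
  also have "\<dots> = (f \<otimes>\<^bsub>F\<^esub> h) m \<oplus>\<^bsub>K\<^esub> (f' \<otimes>\<^bsub>F\<^esub> h) m"
    using K.monoid_algebra_mult_eval[OF f h P(1) _ P(2), of m]
      K.monoid_algebra_mult_eval[OF f' h P(1) _ P(2), of m] by simp
  finally show "((f \<oplus>\<^bsub>F\<^esub> f') \<otimes>\<^bsub>F\<^esub> h) m = (f \<otimes>\<^bsub>F\<^esub> h \<oplus>\<^bsub>F\<^esub> f' \<otimes>\<^bsub>F\<^esub> h) m" by simp
qed

lemma mult_add_right:
  assumes f: "f \<in> carrier F" and h: "h \<in> carrier F" and h': "h' \<in> carrier F"
  shows "f \<otimes>\<^bsub>F\<^esub> (h \<oplus>\<^bsub>F\<^esub> h') = f \<otimes>\<^bsub>F\<^esub> h \<oplus>\<^bsub>F\<^esub> f \<otimes>\<^bsub>F\<^esub> h'"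
proof
  fix m
  let ?Q = "{m. h m \<noteq> \<zero>\<^bsub>K\<^esub>} \<union> {m. h' m \<noteq> \<zero>\<^bsub>K\<^esub>}" and ?P = "{m. f m \<noteq> \<zero>\<^bsub>K\<^esub>}"
  let ?S = "{(p, q) \<in> ?P \<times> ?Q. p \<otimes>\<^bsub>M\<^esub> q = m}"
  have P: "finite ?P" "finite ?Q" and K: "f m \<in> carrier K" "h' m \<in> carrier K" "h m \<in> carrier K" for m
    using f h' h by auto
  have "(f \<otimes>\<^bsub>F\<^esub> (h \<oplus>\<^bsub>F\<^esub> h')) m = (\<Oplus>\<^bsub>K\<^esub>pq\<in>?S. f (fst pq) \<otimes>\<^bsub>K\<^esub> (h \<oplus>\<^bsub>F\<^esub> h') (snd pq))"
    by (rule K.monoid_algebra_mult_eval[OF f F.a_closed[OF h h'] P(1) _ P(2)]) auto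
  also have "\<dots> = (\<Oplus>\<^bsub>K\<^esub>pq\<in>?S. f (fst pq) \<otimes>\<^bsub>K\<^esub> h (snd pq) \<oplus>\<^bsub>K\<^esub> f (fst pq) \<otimes>\<^bsub>K\<^esub> h' (snd pq))"
    by (rule K.finsum_cong') (use K in \<open>auto simp: K.r_distr\<close>)
  also have "\<dots> = (\<Oplus>\<^bsub>K\<^esub>pq\<in>?S. f (fst pq) \<otimes>\<^bsub>K\<^esub> h (snd pq)) \<oplus>\<^bsub>K\<^esub> (\<Oplus>\<^bsub>K\<^esub>pq\<in>?S. f (fst pq) \<otimes>\<^bsub>K\<^esub> h' (snd pq))"
    by (rule K.finsum_addf) (use K in auto)
  also have "\<dots> = (f \<otimes>\<^bsub>F\<^esub> h) m \<oplus>\<^bsub>K\<^esub> (f \<otimes>\<^bsub>F\<^esub> h') m"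
    using K.monoid_algebra_mult_eval[OF f h P(1) _ P(2), of m]
      K.monoid_algebra_mult_eval[OF f h' P(1) _ P(2), of m] by simp
  finally show "(f \<otimes>\<^bsub>F\<^esub> (h \<oplus>\<^bsub>F\<^esub> h')) m = (f \<otimes>\<^bsub>F\<^esub> h \<oplus>\<^bsub>F\<^esub> f \<otimes>\<^bsub>F\<^esub> h') m" by simp
qed

lemma mult_smult:
  assumes f: "f \<in> carrier F" and h: "h \<in> carrier F" and r: "r \<in> carrier K"
  shows "(r \<odot>\<^bsub>F\<^esub> f) \<otimes>\<^bsub>F\<^esub> h = r \<odot>\<^bsub>F\<^esub> (f \<otimes>\<^bsub>F\<^esub> h)" "f \<otimes>\<^bsub>F\<^esub> (r \<odot>\<^bsub>F\<^esub> h) = r \<odot>\<^bsub>F\<^esub> (f \<otimes>\<^bsub>F\<^esub> h)"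
proof -
  let ?P = "{m. f m \<noteq> \<zero>\<^bsub>K\<^esub>}" and ?Q = "{m. h m \<noteq> \<zero>\<^bsub>K\<^esub>}"
  let ?S = "\<lambda>m. {(p, q) \<in> ?P \<times> ?Q. p \<otimes>\<^bsub>M\<^esub> q = m}"
  have P: "finite ?P" "finite ?Q" and K: "f m \<in> carrier K" "h m \<in> carrier K" for m
    using f h by auto
  have fin: "finite (?S m)" for m
    by (rule finite_subset[of _ "?P \<times> ?Q"]) (use P in auto)
  have *: "(r \<odot>\<^bsub>F\<^esub> (f \<otimes>\<^bsub>F\<^esub> h)) m = (\<Oplus>\<^bsub>K\<^esub>pq\<in>?S m. r \<otimes>\<^bsub>K\<^esub> (f (fst pq) \<otimes>\<^bsub>K\<^esub> h (snd pq)))" for m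
    using K.monoid_algebra_mult_eval[OF f h P(1) _ P(2), of m] r K
      K.finsum_rdistr[OF fin r, of "\<lambda>pq. f (fst pq) \<otimes>\<^bsub>K\<^esub> h (snd pq)"] by simp
  have "((r \<odot>\<^bsub>F\<^esub> f) \<otimes>\<^bsub>F\<^esub> h) m = (\<Oplus>\<^bsub>K\<^esub>pq\<in>?S m. (r \<odot>\<^bsub>F\<^esub> f) (fst pq) \<otimes>\<^bsub>K\<^esub> h (snd pq))" for m
    by (rule K.monoid_algebra_mult_eval[OF F.smult_closed[OF r f] h P(1) _ P(2)]) (use r in auto)
  also have "(\<Oplus>\<^bsub>K\<^esub>pq\<in>?S m. (r \<odot>\<^bsub>F\<^esub> f) (fst pq) \<otimes>\<^bsub>K\<^esub> h (snd pq)) = (r \<odot>\<^bsub>F\<^esub> (f \<otimes>\<^bsub>F\<^esub> h)) m" for m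
    unfolding * by (rule K.finsum_cong') (use K r in \<open>auto simp: K.m_assoc\<close>)
  finally show "(r \<odot>\<^bsub>F\<^esub> f) \<otimes>\<^bsub>F\<^esub> h = r \<odot>\<^bsub>F\<^esub> (f \<otimes>\<^bsub>F\<^esub> h)" by blast
  have "(f \<otimes>\<^bsub>F\<^esub> (r \<odot>\<^bsub>F\<^esub> h)) m = (\<Oplus>\<^bsub>K\<^esub>pq\<in>?S m. f (fst pq) \<otimes>\<^bsub>K\<^esub> (r \<odot>\<^bsub>F\<^esub> h) (snd pq))" for m
    by (rule K.monoid_algebra_mult_eval[OF f F.smult_closed[OF r h] P(1) _ P(2)]) (use r in auto)
  also have "(\<Oplus>\<^bsub>K\<^esub>pq\<in>?S m. f (fst pq) \<otimes>\<^bsub>K\<^esub> (r \<odot>\<^bsub>F\<^esub> h) (snd pq)) = (r \<odot>\<^bsub>F\<^esub> (f \<otimes>\<^bsub>F\<^esub> h)) m" for m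
    unfolding * by (rule K.finsum_cong') (use K r in \<open>auto simp: K.m_lcomm\<close>)
  finally show "f \<otimes>\<^bsub>F\<^esub> (r \<odot>\<^bsub>F\<^esub> h) = r \<odot>\<^bsub>F\<^esub> (f \<otimes>\<^bsub>F\<^esub> h)" by blast
qed

lemma mult_basis_elt:
  assumes p: "p \<in> carrier M" and q: "q \<in> carrier M"
  shows "basis_elt K p \<otimes>\<^bsub>F\<^esub> basis_elt K q = basis_elt K (p \<otimes>\<^bsub>M\<^esub> q)"
proof
  fix m
  have "(basis_elt K p \<otimes>\<^bsub>F\<^esub> basis_elt K q) m =
      (\<Oplus>\<^bsub>K\<^esub>pq\<in>{(p', q') \<in> {p} \<times> {q}. p' \<otimes>\<^bsub>M\<^esub> q' = m}. basis_elt K p (fst pq) \<otimes>\<^bsub>K\<^esub> basis_elt K q (snd pq))"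
    by (rule K.monoid_algebra_mult_eval) (use p q K.basis_elt_in_carrier in \<open>auto simp: basis_elt_def\<close>)
  also have "{(p', q') \<in> {p} \<times> {q}. p' \<otimes>\<^bsub>M\<^esub> q' = m} = (if p \<otimes>\<^bsub>M\<^esub> q = m then {(p, q)} else {})"
    by auto
  finally show "(basis_elt K p \<otimes>\<^bsub>F\<^esub> basis_elt K q) m = basis_elt K (p \<otimes>\<^bsub>M\<^esub> q) m"
    by (auto simp: basis_elt_def)
qed

text \<open>The product is bilinear, so associativity is inherited from \<open>M\<close> through the basis elements.\<close>

lemma k_algebra_monoid_algebra: "k_algebra K F"
proof -
  note closed = F.a_closed F.smult_closed mult_closed
  note bilin = mult_add_left mult_add_right mult_smult F.smult_r_distr
  have null: "f \<otimes>\<^bsub>F\<^esub> \<zero>\<^bsub>F\<^esub> = \<zero>\<^bsub>F\<^esub>" "\<zero>\<^bsub>F\<^esub> \<otimes>\<^bsub>F\<^esub> f = \<zero>\<^bsub>F\<^esub>" if "f \<in> carrier F" for f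
    using mult_smult[OF that F.zero_closed K.zero_closed] mult_smult[OF F.zero_closed that K.zero_closed]
      F.smult_l_null[OF F.zero_closed] F.smult_l_null[OF mult_closed[OF F.zero_closed that]]
      F.smult_l_null[OF mult_closed[OF that F.zero_closed]] by metis+
  have one: "\<one>\<^bsub>F\<^esub> \<in> carrier F" using K.basis_elt_in_carrier[of "\<one>\<^bsub>M\<^esub>" M] by simp
  have assoc: "(f \<otimes>\<^bsub>F\<^esub> h) \<otimes>\<^bsub>F\<^esub> k = f \<otimes>\<^bsub>F\<^esub> (h \<otimes>\<^bsub>F\<^esub> k)"
    if f: "f \<in> carrier F" and h: "h \<in> carrier F" and k: "k \<in> carrier F" for f h k
    using f
  proof (rule K.monoid_algebra_induct)
    fix p assume p: "p \<in> carrier M"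
    let ?p = "basis_elt K p"
    have pc: "?p \<in> carrier F" using p by (rule K.basis_elt_in_carrier)
    show "(?p \<otimes>\<^bsub>F\<^esub> h) \<otimes>\<^bsub>F\<^esub> k = ?p \<otimes>\<^bsub>F\<^esub> (h \<otimes>\<^bsub>F\<^esub> k)"
      using h
    proof (rule K.monoid_algebra_induct)
      fix q assume q: "q \<in> carrier M"
      let ?q = "basis_elt K q"
      have qc: "?q \<in> carrier F" using q by (rule K.basis_elt_in_carrier)
      show "(?p \<otimes>\<^bsub>F\<^esub> ?q) \<otimes>\<^bsub>F\<^esub> k = ?p \<otimes>\<^bsub>F\<^esub> (?q \<otimes>\<^bsub>F\<^esub> k)"
        using k
      proof (rule K.monoid_algebra_induct)
        fix r assume "r \<in> carrier M"
        then show "(?p \<otimes>\<^bsub>F\<^esub> ?q) \<otimes>\<^bsub>F\<^esub> basis_elt K r = ?p \<otimes>\<^bsub>F\<^esub> (?q \<otimes>\<^bsub>F\<^esub> basis_elt K r)"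
          using p q by (simp add: mult_basis_elt M.m_assoc del: monoid_algebra_simps)
      qed (use pc qc in \<open>simp_all add: bilin closed null del: monoid_algebra_simps\<close>)
    qed (use pc k in \<open>simp_all add: bilin closed null del: monoid_algebra_simps\<close>)
  qed (use h k in \<open>simp_all add: bilin closed null del: monoid_algebra_simps\<close>)
  have unit: "\<one>\<^bsub>F\<^esub> \<otimes>\<^bsub>F\<^esub> f = f \<and> f \<otimes>\<^bsub>F\<^esub> \<one>\<^bsub>F\<^esub> = f" if "f \<in> carrier F" for f
    using that
  proof (rule K.monoid_algebra_induct)
    fix p assume "p \<in> carrier M"
    then show "\<one>\<^bsub>F\<^esub> \<otimes>\<^bsub>F\<^esub> basis_elt K p = basis_elt K p \<and> basis_elt K p \<otimes>\<^bsub>F\<^esub> \<one>\<^bsub>F\<^esub> = basis_elt K p"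
      using mult_basis_elt[of "\<one>\<^bsub>M\<^esub>" p] mult_basis_elt[of p "\<one>\<^bsub>M\<^esub>"] by simp
  qed (use one in \<open>auto simp add: bilin closed null simp del: monoid_algebra_simps\<close>)
  show ?thesis
    by (rule k_algebraI[OF K.monoid_algebra_vectorspace])
      (use one unit in \<open>auto simp add: bilin closed assoc simp del: monoid_algebra_simps\<close>)
qed

text \<open>The universal property of \<open>K[M]\<close>. Both sides of the multiplicativity identity are bilinear, so
  it is enough to compare them on basis elements, where it is the hypothesis on \<open>b\<close>.\<close>

lemma lin_ext_alg_hom:
  assumes B: "k_algebra K B" and b: "b \<in> carrier M \<rightarrow> carrier B" and one: "b \<one>\<^bsub>M\<^esub> = \<one>\<^bsub>B\<^esub>"
    and mult: "\<And>p q. p \<in> carrier M \<Longrightarrow> q \<in> carrier M \<Longrightarrow> b (p \<otimes>\<^bsub>M\<^esub> q) = b p \<otimes>\<^bsub>B\<^esub> b q"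
  shows "lin_ext K B b \<in> alg_hom K F B"
proof -
  interpret B: k_algebra K B by fact
  interpret FA: k_algebra K F by (rule k_algebra_monoid_algebra)
  have Bm: "module K B" ..
  let ?f = "lin_ext K B b"
  have hom: "?f \<in> module_hom K F B" by (rule K.lin_ext_hom[OF Bm b])
  note L = module_homD[OF hom] module_hom_zero[OF F.module_axioms Bm hom] K.lin_ext_basis[OF Bm b]
  note bilin = mult_add_left mult_add_right mult_smult F.smult_r_distr
  note null = FA.A.l_null FA.A.r_null
  show ?thesis
  proof (rule alg_homI[OF hom])
    show "?f \<one>\<^bsub>F\<^esub> = \<one>\<^bsub>B\<^esub>" using L one by simp
    fix f h assume f: "f \<in> carrier F" and h: "h \<in> carrier F"
    show "?f (f \<otimes>\<^bsub>F\<^esub> h) = ?f f \<otimes>\<^bsub>B\<^esub> ?f h"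
      using f
    proof (rule K.monoid_algebra_induct)
      fix p assume p: "p \<in> carrier M"
      have pc: "basis_elt K p \<in> carrier F" using p by (rule K.basis_elt_in_carrier)
      show "?f (basis_elt K p \<otimes>\<^bsub>F\<^esub> h) = ?f (basis_elt K p) \<otimes>\<^bsub>B\<^esub> ?f h"
        using h
      proof (rule K.monoid_algebra_induct)
        fix q assume q: "q \<in> carrier M"
        show "?f (basis_elt K p \<otimes>\<^bsub>F\<^esub> basis_elt K q) = ?f (basis_elt K p) \<otimes>\<^bsub>B\<^esub> ?f (basis_elt K q)"
          using p q by (simp add: mult_basis_elt L mult del: monoid_algebra_simps)
      qed (use pc in \<open>simp_all add: L null bilin B.A.r_distr B.smult_mult_right mult_closed del: monoid_algebra_simps\<close>)
    qed (use h in \<open>simp_all add: L null bilin B.A.l_distr B.smult_mult_left mult_closed del: monoid_algebra_simps\<close>)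
  qed
qed

end

declare monoid_algebra_simps [simp del]

lemma (in monoid_over_field) span_basis_elts:
  "F.span (basis_elt K ` carrier M) = carrier F"
proof (rule antisym)
  have B: "basis_elt K ` carrier M \<subseteq> carrier F"
    by (intro image_subsetI K.basis_elt_in_carrier)
  show "F.span (basis_elt K ` carrier M) \<subseteq> carrier F" by (rule F.span_is_subset2[OF B])
  interpret N: submodule K "F.span (basis_elt K ` carrier M)" F by (rule F.span_is_submodule[OF B])
  show "carrier F \<subseteq> F.span (basis_elt K ` carrier M)"
  proof
    fix f assume "f \<in> carrier F"
    then show "f \<in> F.span (basis_elt K ` carrier M)"
      by (rule K.monoid_algebra_induct) (use F.in_own_span[OF B] in auto)
  qed
qed

section \<open>Quotient algebras\<close>

text \<open>The operations of the quotient are defined by unions over cosets. Everything about them is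
  derived from their values on the classes \<open>proj a\<close>.\<close>

locale algebra_ideal = k_algebra K A + ideal I A for K (structure) and A (structure) and I
begin

definition "proj a = I +>\<^bsub>A\<^esub> a"

abbreviation "Q \<equiv> quot_algebra A I"

lemma proj_eq_iff:
  assumes "a \<in> carrier A" "b \<in> carrier A"
  shows "proj a = proj b \<longleftrightarrow> a \<ominus>\<^bsub>A\<^esub> b \<in> I"
  using A.quotient_eq_iff_same_a_r_cos[OF ideal_axioms assms] by (simp add: proj_def)

text \<open>A ring ideal is a subspace, since \<open>r a = (r 1) a\<close>.\<close>

lemma smult_ideal:
  assumes "r \<in> carrier K" "a \<in> I"
  shows "r \<odot>\<^bsub>A\<^esub> a \<in> I"
proof -
  have a: "a \<in> carrier A" using assms a_Hcarr by blast
  have "r \<odot>\<^bsub>A\<^esub> a = (r \<odot>\<^bsub>A\<^esub> \<one>\<^bsub>A\<^esub>) \<otimes>\<^bsub>A\<^esub> a"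
    using a assms smult_mult_left[of r "\<one>\<^bsub>A\<^esub>" a] by simp
  also have "\<dots> \<in> I" using assms by (intro I_l_closed) auto
  finally show ?thesis .
qed

lemma mem_projE:
  assumes "x \<in> proj a"
  obtains i where "i \<in> I" "x = i \<oplus>\<^bsub>A\<^esub> a"
  using assms by (auto simp: proj_def a_r_coset_def')

lemma self_in_proj:
  assumes "a \<in> carrier A" shows "a \<in> proj a"
  using assms by (simp add: proj_def a_rcos_self)

lemma quot_algebra_simps:
  "carrier Q = proj ` carrier A" "S \<oplus>\<^bsub>Q\<^esub> T = S <+>\<^bsub>A\<^esub> T" "\<one>\<^bsub>Q\<^esub> = proj \<one>\<^bsub>A\<^esub>"
  "\<zero>\<^bsub>Q\<^esub> = I" "S \<otimes>\<^bsub>Q\<^esub> T = [mod I:] S \<Otimes>\<^bsub>A\<^esub> T" "r \<odot>\<^bsub>Q\<^esub> S = (\<Union>a\<in>S. I +>\<^bsub>A\<^esub> (r \<odot>\<^bsub>A\<^esub> a))"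
  by (auto simp: quot_algebra_def ring.extend_def module.fields_def FactRing_def proj_def A_RCOSETS_defs
      a_r_coset_def)

lemma Q_ops:
  assumes a: "a \<in> carrier A" and b: "b \<in> carrier A"
  shows "proj a \<oplus>\<^bsub>Q\<^esub> proj b = proj (a \<oplus>\<^bsub>A\<^esub> b)" "proj a \<otimes>\<^bsub>Q\<^esub> proj b = proj (a \<otimes>\<^bsub>A\<^esub> b)"
  using assms by (simp_all add: quot_algebra_simps proj_def a_rcos_sum rcoset_mult_add)

lemma Q_smult:
  assumes a: "a \<in> carrier A" and r: "r \<in> carrier K"
  shows "r \<odot>\<^bsub>Q\<^esub> proj a = proj (r \<odot>\<^bsub>A\<^esub> a)"
proof -
  have "proj (r \<odot>\<^bsub>A\<^esub> x) = proj (r \<odot>\<^bsub>A\<^esub> a)" if x: "x \<in> proj a" for x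
  proof -
    obtain i where i: "i \<in> I" "x = i \<oplus>\<^bsub>A\<^esub> a" using x by (rule mem_projE)
    have ic: "i \<in> carrier A" "r \<odot>\<^bsub>A\<^esub> i \<in> carrier A" using i a_Hcarr r by auto
    have "r \<odot>\<^bsub>A\<^esub> x \<ominus>\<^bsub>A\<^esub> r \<odot>\<^bsub>A\<^esub> a = r \<odot>\<^bsub>A\<^esub> i"
      using i(2) ic a r by (simp add: smult_r_distr M.minus_eq M.a_assoc M.r_neg)
    then show ?thesis
      using proj_eq_iff[of "r \<odot>\<^bsub>A\<^esub> x" "r \<odot>\<^bsub>A\<^esub> a"] i ic a r smult_ideal[of r i] by simp
  qed
  then have "(\<Union>x\<in>proj a. proj (r \<odot>\<^bsub>A\<^esub> x)) = (\<Union>x\<in>proj a. proj (r \<odot>\<^bsub>A\<^esub> a))"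
    by (rule SUP_cong[OF refl])
  also have "\<dots> = proj (r \<odot>\<^bsub>A\<^esub> a)"
    using self_in_proj[OF a] by blast
  finally show ?thesis by (simp only: quot_algebra_simps proj_def)
qed

lemma Q_zero: "\<zero>\<^bsub>Q\<^esub> = proj \<zero>\<^bsub>A\<^esub>"
  unfolding quot_algebra_simps proj_def using a_rcos_const[of "\<zero>\<^bsub>A\<^esub>"]
    additive_subgroup.zero_closed[OF is_additive_subgroup] by simp

lemma Q_cases:
  assumes "q \<in> carrier Q" obtains a where "a \<in> carrier A" "q = proj a"
  using assms by (auto simp: quot_algebra_simps)

lemma proj_in_Q: "a \<in> carrier A \<Longrightarrow> proj a \<in> carrier Q"
  by (simp add: quot_algebra_simps)

lemma k_algebra_Q: "k_algebra K Q"
proof -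
  note s = Q_ops Q_smult Q_zero proj_in_Q quot_algebra_simps(3)
  have "field K" ..
  then have "vectorspace K Q"
  proof (rule vectorspaceI)
    show "\<exists>p\<in>carrier Q. p \<oplus>\<^bsub>Q\<^esub> q = \<zero>\<^bsub>Q\<^esub>" if q: "q \<in> carrier Q" for q
    proof -
      obtain a where "a \<in> carrier A" "q = proj a" using q by (rule Q_cases)
      then show ?thesis by (intro bexI[of _ "proj (\<ominus>\<^bsub>A\<^esub> a)"]) (simp_all add: s M.l_neg)
    qed
  qed (auto elim!: Q_cases simp: s M.a_ac smult_l_distr smult_r_distr smult_assoc1)
  then show ?thesis
    by (rule k_algebraI) (auto elim!: Q_cases simp: s A.m_assoc A.l_distr A.r_distr smult_mult_left smult_mult_right)
qed

lemma proj_alg_hom: "proj \<in> alg_hom K A Q"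
  by (intro alg_homI module_homI) (simp_all add: Q_ops Q_smult proj_in_Q quot_algebra_simps(3))

lemma the_elem_image_proj:
  assumes V: "module K V" and f: "f \<in> module_hom K A V" and null: "\<And>i. i \<in> I \<Longrightarrow> f i = \<zero>\<^bsub>V\<^esub>"
    and a: "a \<in> carrier A"
  shows "the_elem (f ` proj a) = f a"
proof -
  interpret V: module K V by fact
  have "f x = f a" if x: "x \<in> proj a" for x
  proof -
    obtain i where i: "i \<in> I" "x = i \<oplus>\<^bsub>A\<^esub> a" using x by (rule mem_projE)
    have "f x = f i \<oplus>\<^bsub>V\<^esub> f a"
      unfolding i(2) by (rule module_hom_add[OF f a_Hcarr[OF i(1)] a])
    then show ?thesis using null[OF i(1)] module_hom_in_carrier[OF f a] by simp
  qed
  then have "f ` proj a = {f a}" using self_in_proj[OF a] by blast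
  then show ?thesis by simp
qed

lemma factor_module_hom:
  assumes V: "module K V" and f: "f \<in> module_hom K A V" and null: "\<And>i. i \<in> I \<Longrightarrow> f i = \<zero>\<^bsub>V\<^esub>"
  shows "(\<lambda>q. the_elem (f ` q)) \<in> module_hom K Q V"
  by (rule module_homI)
    (auto elim!: Q_cases simp: Q_ops Q_smult the_elem_image_proj[OF assms] module_homD[OF f])

lemma factor_alg_hom:
  assumes B: "k_algebra K B" and f: "f \<in> alg_hom K A B" and null: "\<And>i. i \<in> I \<Longrightarrow> f i = \<zero>\<^bsub>B\<^esub>"
  shows "(\<lambda>q. the_elem (f ` q)) \<in> alg_hom K Q B"
proof -
  interpret B: k_algebra K B by fact
  have Bm: "module K B" ..
  note f' = alg_homD[OF f]
  show ?thesis
    by (rule alg_homI[OF factor_module_hom[OF Bm f'(1) null]])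
      (auto elim!: Q_cases simp: Q_ops quot_algebra_simps(3) the_elem_image_proj[OF Bm f'(1) null] f')
qed

end

section \<open>Tensor products of algebras\<close>

definition bilinear ::
  "('k, 'c) ring_scheme \<Rightarrow> ('k, 'a, 'm) module_scheme \<Rightarrow> ('k, 'b, 'n) module_scheme
    \<Rightarrow> ('k, 'v, 'l) module_scheme \<Rightarrow> ('a \<Rightarrow> 'b \<Rightarrow> 'v) \<Rightarrow> bool" where
  "bilinear K A B V \<beta> \<longleftrightarrow>
    (\<forall>b\<in>carrier B. (\<lambda>a. \<beta> a b) \<in> module_hom K A V) \<and>
    (\<forall>a\<in>carrier A. \<beta> a \<in> module_hom K B V)"

lemma bilinearD:
  assumes "bilinear K A B V \<beta>" "a \<in> carrier A" "b \<in> carrier B"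
  shows "\<beta> a b \<in> carrier V"
    "a' \<in> carrier A \<Longrightarrow> \<beta> (a \<oplus>\<^bsub>A\<^esub> a') b = \<beta> a b \<oplus>\<^bsub>V\<^esub> \<beta> a' b"
    "b' \<in> carrier B \<Longrightarrow> \<beta> a (b \<oplus>\<^bsub>B\<^esub> b') = \<beta> a b \<oplus>\<^bsub>V\<^esub> \<beta> a b'"
    "r \<in> carrier K \<Longrightarrow> \<beta> (r \<odot>\<^bsub>A\<^esub> a) b = r \<odot>\<^bsub>V\<^esub> \<beta> a b"
    "r \<in> carrier K \<Longrightarrow> \<beta> a (r \<odot>\<^bsub>B\<^esub> b) = r \<odot>\<^bsub>V\<^esub> \<beta> a b"
  using assms by (auto simp: bilinear_def module_hom_def)

lemma bilinearI:
  assumes "\<And>b. b \<in> carrier B \<Longrightarrow> (\<lambda>a. \<beta> a b) \<in> module_hom K A V"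
    "\<And>a. a \<in> carrier A \<Longrightarrow> \<beta> a \<in> module_hom K B V"
  shows "bilinear K A B V \<beta>"
  using assms by (simp add: bilinear_def)

locale two_algebras = A: k_algebra K A + B: k_algebra K B for K and A and B
begin

interpretation M: monoid_over_field K "A \<times>\<times> B"
proof -
  have "Group.monoid A" "Group.monoid B" "field K" ..
  then show "monoid_over_field K (A \<times>\<times> B)"
    by (intro monoid_over_field.intro DirProd_monoid)
qed

interpretation F: k_algebra K M.F by (rule M.k_algebra_monoid_algebra)

abbreviation "\<F> \<equiv> free_on_prod K A B"
abbreviation "e a b \<equiv> basis_elt K (a, b)"
abbreviation "N \<equiv> tensor_null K A B"
abbreviation "T \<equiv> tensor K A B"
abbreviation "pt \<equiv> pure_tensor K A B"

lemma e_closed: "a \<in> carrier A \<Longrightarrow> b \<in> carrier B \<Longrightarrow> e a b \<in> carrier \<F>"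
  by (rule A.basis_elt_in_carrier) simp

lemma e_mult:
  assumes "a \<in> carrier A" "b \<in> carrier B" "a' \<in> carrier A" "b' \<in> carrier B"
  shows "e a b \<otimes>\<^bsub>\<F>\<^esub> e a' b' = e (a \<otimes>\<^bsub>A\<^esub> a') (b \<otimes>\<^bsub>B\<^esub> b')"
  using assms by (subst M.mult_basis_elt) auto

lemma relatorI:
  assumes "a \<in> carrier A" "b \<in> carrier B"
  shows
    "a' \<in> carrier A \<Longrightarrow> e (a \<oplus>\<^bsub>A\<^esub> a') b \<ominus>\<^bsub>\<F>\<^esub> (e a b \<oplus>\<^bsub>\<F>\<^esub> e a' b) \<in> tensor_relators K A B"
    "b' \<in> carrier B \<Longrightarrow> e a (b \<oplus>\<^bsub>B\<^esub> b') \<ominus>\<^bsub>\<F>\<^esub> (e a b \<oplus>\<^bsub>\<F>\<^esub> e a b') \<in> tensor_relators K A B"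
    "r \<in> carrier K \<Longrightarrow> e (r \<odot>\<^bsub>A\<^esub> a) b \<ominus>\<^bsub>\<F>\<^esub> (r \<odot>\<^bsub>\<F>\<^esub> e a b) \<in> tensor_relators K A B"
    "r \<in> carrier K \<Longrightarrow> e a (r \<odot>\<^bsub>B\<^esub> b) \<ominus>\<^bsub>\<F>\<^esub> (r \<odot>\<^bsub>\<F>\<^esub> e a b) \<in> tensor_relators K A B"
  using assms unfolding tensor_relators_def Let_def by blast+

lemma relator_cases:
  assumes "x \<in> tensor_relators K A B"
  obtains
    (add_left) a a' b where "a \<in> carrier A" "a' \<in> carrier A" "b \<in> carrier B"
      "x = e (a \<oplus>\<^bsub>A\<^esub> a') b \<ominus>\<^bsub>\<F>\<^esub> (e a b \<oplus>\<^bsub>\<F>\<^esub> e a' b)"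
  | (add_right) a b b' where "a \<in> carrier A" "b \<in> carrier B" "b' \<in> carrier B"
      "x = e a (b \<oplus>\<^bsub>B\<^esub> b') \<ominus>\<^bsub>\<F>\<^esub> (e a b \<oplus>\<^bsub>\<F>\<^esub> e a b')"
  | (smult_left) r a b where "r \<in> carrier K" "a \<in> carrier A" "b \<in> carrier B"
      "x = e (r \<odot>\<^bsub>A\<^esub> a) b \<ominus>\<^bsub>\<F>\<^esub> (r \<odot>\<^bsub>\<F>\<^esub> e a b)"
  | (smult_right) r a b where "r \<in> carrier K" "a \<in> carrier A" "b \<in> carrier B"
      "x = e a (r \<odot>\<^bsub>B\<^esub> b) \<ominus>\<^bsub>\<F>\<^esub> (r \<odot>\<^bsub>\<F>\<^esub> e a b)"
  using assms unfolding tensor_relators_def Let_def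
  by (elim UnE CollectE exE conjE)
    (erule add_left[rotated 3] add_right[rotated 3] smult_left[rotated 3] smult_right[rotated 3]; assumption)+

lemma relators_subset: "tensor_relators K A B \<subseteq> carrier \<F>"
proof
  fix x assume "x \<in> tensor_relators K A B"
  then show "x \<in> carrier \<F>" by (cases rule: relator_cases) (simp_all add: e_closed)
qed

text \<open>Multiplying a relator by a basis element gives a relator of the same kind, because the
  products of \<open>A\<close> and of \<open>B\<close> are bilinear. So the subspace spanned by the relators is an ideal.\<close>

lemma e_mult_relator:
  assumes c: "c \<in> carrier A" and d: "d \<in> carrier B" and x: "x \<in> tensor_relators K A B"
  shows "e c d \<otimes>\<^bsub>\<F>\<^esub> x \<in> tensor_relators K A B" "x \<otimes>\<^bsub>\<F>\<^esub> e c d \<in> tensor_relators K A B"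
proof -
  note s = e_closed e_mult F.A.r_distr F.A.l_distr F.A.r_minus F.A.l_minus F.smult_mult_left F.smult_mult_right
    A.A.l_distr A.A.r_distr B.A.l_distr B.A.r_distr A.smult_mult_left A.smult_mult_right
    B.smult_mult_left B.smult_mult_right a_minus_def
  note r = relatorI[unfolded a_minus_def]
  show "e c d \<otimes>\<^bsub>\<F>\<^esub> x \<in> tensor_relators K A B"
    using x c d by (cases rule: relator_cases) (simp_all add: s, (rule r; simp)+)
  show "x \<otimes>\<^bsub>\<F>\<^esub> e c d \<in> tensor_relators K A B"
    using x c d by (cases rule: relator_cases) (simp_all add: s, (rule r; simp)+)
qed

lemma ideal_tensor_null: "ideal N \<F>"
proof -
  have sub: "submodule K N \<F>"
    unfolding tensor_null_def by (rule M.F.span_is_submodule[OF relators_subset])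
  interpret N: submodule K N \<F> by (rule sub)
  have relN: "tensor_relators K A B \<subseteq> N"
    unfolding tensor_null_def by (rule M.F.in_own_span[OF relators_subset])
  have Nc: "n \<in> N \<Longrightarrow> n \<in> carrier \<F>" for n using N.subset by auto
  have N_e: "e c d \<otimes>\<^bsub>\<F>\<^esub> n \<in> N \<and> n \<otimes>\<^bsub>\<F>\<^esub> e c d \<in> N"
    if cd: "c \<in> carrier A" "d \<in> carrier B" and n: "n \<in> N" for c d n
  proof -
    let ?S = "{n \<in> carrier \<F>. e c d \<otimes>\<^bsub>\<F>\<^esub> n \<in> N \<and> n \<otimes>\<^bsub>\<F>\<^esub> e c d \<in> N}"
    note ec = e_closed[OF cd]
    have "submodule K ?S \<F>"
      using ec by unfold_locales
        (auto simp: F.A.l_distr F.A.r_distr F.smult_mult_left F.smult_mult_right)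
    moreover have "tensor_relators K A B \<subseteq> ?S"
      using relators_subset relN e_mult_relator[OF cd] by auto
    ultimately have "N \<subseteq> ?S" unfolding tensor_null_def by (rule M.F.span_is_subset[rotated])
    then show ?thesis using n by auto
  qed
  have N_mult: "x \<otimes>\<^bsub>\<F>\<^esub> n \<in> N \<and> n \<otimes>\<^bsub>\<F>\<^esub> x \<in> N" if x: "x \<in> carrier \<F>" and n: "n \<in> N" for x n
    using x
  proof (rule A.monoid_algebra_induct)
    fix m assume "m \<in> carrier (A \<times>\<times> B)"
    then show "basis_elt K m \<otimes>\<^bsub>\<F>\<^esub> n \<in> N \<and> n \<otimes>\<^bsub>\<F>\<^esub> basis_elt K m \<in> N"
      using N_e[OF _ _ n] by (cases m) auto
  qed (use Nc[OF n] in \<open>auto simp: F.A.l_distr F.A.r_distr F.smult_mult_left F.smult_mult_right\<close>)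
  have minus: "\<ominus>\<^bsub>\<F>\<^esub> n \<in> N" if n: "n \<in> N" for n
  proof -
    have "(\<ominus>\<^bsub>K\<^esub> \<one>\<^bsub>K\<^esub>) \<odot>\<^bsub>\<F>\<^esub> n = \<ominus>\<^bsub>\<F>\<^esub> n"
      using Nc[OF n] by (simp add: M.F.smult_l_minus)
    then show ?thesis using N.smult_closed[OF _ n, of "\<ominus>\<^bsub>K\<^esub> \<one>\<^bsub>K\<^esub>"] by simp
  qed
  have "ring \<F>" ..
  then show ?thesis
  proof (rule idealI)
    show "subgroup N (add_monoid \<F>)"
      by (rule subgroup.intro) (use Nc minus in \<open>auto simp: a_inv_def[symmetric]\<close>)
  qed (use N_mult in auto)
qed

interpretation I: algebra_ideal K \<F> N
  by (intro algebra_ideal.intro F.k_algebra_axioms ideal_tensor_null)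

lemma T_eq: "T = I.Q" by (simp add: tensor_def)

lemma pt_eq: "pt a b = I.proj (e a b)" by (simp add: pure_tensor_def I.proj_def)

lemma relatorD:
  assumes "x \<ominus>\<^bsub>\<F>\<^esub> y \<in> tensor_relators K A B" "x \<in> carrier \<F>" "y \<in> carrier \<F>"
  shows "I.proj x = I.proj y"
  using assms I.proj_eq_iff[of x y] M.F.in_own_span[OF relators_subset] by (auto simp: tensor_null_def)

lemma k_algebra_tensor: "k_algebra K T"
  unfolding T_eq by (rule I.k_algebra_Q)

lemma pt_closed [simp, intro]: "a \<in> carrier A \<Longrightarrow> b \<in> carrier B \<Longrightarrow> pt a b \<in> carrier T"
  unfolding T_eq pt_eq by (intro I.proj_in_Q e_closed)

lemma pt_add_left:
  assumes "a \<in> carrier A" "a' \<in> carrier A" "b \<in> carrier B"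
  shows "pt (a \<oplus>\<^bsub>A\<^esub> a') b = pt a b \<oplus>\<^bsub>T\<^esub> pt a' b"
  unfolding T_eq pt_eq using assms relatorD[OF relatorI(1)] by (simp add: I.Q_ops e_closed)

lemma pt_add_right:
  assumes "a \<in> carrier A" "b \<in> carrier B" "b' \<in> carrier B"
  shows "pt a (b \<oplus>\<^bsub>B\<^esub> b') = pt a b \<oplus>\<^bsub>T\<^esub> pt a b'"
  unfolding T_eq pt_eq using assms relatorD[OF relatorI(2)] by (simp add: I.Q_ops e_closed)

lemma pt_smult_left:
  assumes "a \<in> carrier A" "b \<in> carrier B" "r \<in> carrier K"
  shows "pt (r \<odot>\<^bsub>A\<^esub> a) b = r \<odot>\<^bsub>T\<^esub> pt a b"
  unfolding T_eq pt_eq using assms relatorD[OF relatorI(3)] by (simp add: I.Q_smult e_closed)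

lemma pt_smult_right:
  assumes "a \<in> carrier A" "b \<in> carrier B" "r \<in> carrier K"
  shows "pt a (r \<odot>\<^bsub>B\<^esub> b) = r \<odot>\<^bsub>T\<^esub> pt a b"
  unfolding T_eq pt_eq using assms relatorD[OF relatorI(4)] by (simp add: I.Q_smult e_closed)

lemma pt_mult:
  assumes "a \<in> carrier A" "b \<in> carrier B" "a' \<in> carrier A" "b' \<in> carrier B"
  shows "pt a b \<otimes>\<^bsub>T\<^esub> pt a' b' = pt (a \<otimes>\<^bsub>A\<^esub> a') (b \<otimes>\<^bsub>B\<^esub> b')"
  unfolding T_eq pt_eq using assms by (simp add: I.Q_ops e_closed e_mult)

lemma one_T: "\<one>\<^bsub>T\<^esub> = pt \<one>\<^bsub>A\<^esub> \<one>\<^bsub>B\<^esub>"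
  unfolding T_eq pt_eq by (simp add: I.quot_algebra_simps monoid_algebra_simps)

lemma bilinear_pt: "bilinear K A B T pt"
  by (intro bilinearI module_homI)
    (simp_all add: pt_add_left pt_add_right pt_smult_left pt_smult_right)

lemma pt_zero_left:
  assumes "b \<in> carrier B" shows "pt \<zero>\<^bsub>A\<^esub> b = \<zero>\<^bsub>T\<^esub>"
proof -
  interpret T: k_algebra K T by (rule k_algebra_tensor)
  have "pt (\<zero>\<^bsub>K\<^esub> \<odot>\<^bsub>A\<^esub> \<zero>\<^bsub>A\<^esub>) b = \<zero>\<^bsub>K\<^esub> \<odot>\<^bsub>T\<^esub> pt \<zero>\<^bsub>A\<^esub> b"
    by (rule pt_smult_left) (use assms in auto)
  then show ?thesis using assms by simp
qed

text \<open>The scalars of a linear combination of pure tensors can be moved into the left factors.\<close>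

lemma tensor_induct:
  assumes z: "z \<in> carrier T"
    and pure: "\<And>a b. a \<in> carrier A \<Longrightarrow> b \<in> carrier B \<Longrightarrow> P (pt a b)"
    and add: "\<And>x y. x \<in> carrier T \<Longrightarrow> y \<in> carrier T \<Longrightarrow> P x \<Longrightarrow> P y \<Longrightarrow> P (x \<oplus>\<^bsub>T\<^esub> y)"
  shows "P z"
proof -
  interpret T: k_algebra K T by (rule k_algebra_tensor)
  obtain f where f: "f \<in> carrier \<F>" "z = I.proj f"
    using z unfolding T_eq by (rule I.Q_cases)
  have smult: "I.proj (r \<odot>\<^bsub>\<F>\<^esub> f) = r \<odot>\<^bsub>T\<^esub> I.proj f" if "r \<in> carrier K" "f \<in> carrier \<F>" for r f
    using that unfolding T_eq by (simp add: I.Q_smult)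
  have closed: "I.proj f \<in> carrier T" if "f \<in> carrier \<F>" for f
    using that unfolding T_eq by (rule I.proj_in_Q)
  have "\<forall>r\<in>carrier K. P (r \<odot>\<^bsub>T\<^esub> I.proj f)" using f(1)
  proof (rule A.monoid_algebra_induct)
    have "I.proj \<zero>\<^bsub>\<F>\<^esub> = \<zero>\<^bsub>T\<^esub>" unfolding T_eq by (rule I.Q_zero[symmetric])
    then show "\<forall>r\<in>carrier K. P (r \<odot>\<^bsub>T\<^esub> I.proj \<zero>\<^bsub>\<F>\<^esub>)"
      using pure[of "\<zero>\<^bsub>A\<^esub>" "\<one>\<^bsub>B\<^esub>"] by (auto simp: pt_zero_left)
    show "\<forall>r\<in>carrier K. P (r \<odot>\<^bsub>T\<^esub> I.proj (basis_elt K m))" if "m \<in> carrier (A \<times>\<times> B)" for m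
      using that pure by (cases m) (auto simp: pt_eq[symmetric] pt_smult_left[symmetric])
    fix f h assume fh: "f \<in> carrier \<F>" "h \<in> carrier \<F>" "\<forall>r\<in>carrier K. P (r \<odot>\<^bsub>T\<^esub> I.proj f)"
      "\<forall>r\<in>carrier K. P (r \<odot>\<^bsub>T\<^esub> I.proj h)"
    have "I.proj (f \<oplus>\<^bsub>\<F>\<^esub> h) = I.proj f \<oplus>\<^bsub>T\<^esub> I.proj h"
      unfolding T_eq using fh by (simp add: I.Q_ops)
    then show "\<forall>r\<in>carrier K. P (r \<odot>\<^bsub>T\<^esub> I.proj (f \<oplus>\<^bsub>\<F>\<^esub> h))"
      using fh by (auto simp: T.smult_r_distr closed intro!: add)
  next
    fix r f assume rf: "r \<in> carrier K" "f \<in> carrier \<F>" "\<forall>r\<in>carrier K. P (r \<odot>\<^bsub>T\<^esub> I.proj f)"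
    then show "\<forall>s\<in>carrier K. P (s \<odot>\<^bsub>T\<^esub> I.proj (r \<odot>\<^bsub>\<F>\<^esub> f))"
      by (auto simp: smult closed T.smult_assoc1[symmetric])
  qed
  then show ?thesis using f closed[OF f(1)] T.smult_one A.one_closed by metis
qed

text \<open>The universal property: the linear extension of \<open>\<beta>\<close> to the free vector space kills the relators
  because \<open>\<beta>\<close> is bilinear, hence it kills the subspace that they span.\<close>

lemma tensor_lift_hom_pt:
  assumes V: "module K V" and \<beta>: "bilinear K A B V \<beta>"
  shows tensor_lift_hom: "tensor_lift K V (\<lambda>(a, b). \<beta> a b) \<in> module_hom K T V"
    and tensor_lift_pt: "a \<in> carrier A \<Longrightarrow> b \<in> carrier B \<Longrightarrow>
      tensor_lift K V (\<lambda>(a, b). \<beta> a b) (pt a b) = \<beta> a b"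
proof -
  interpret V: module K V by fact
  let ?b = "\<lambda>(a, b). \<beta> a b" and ?f = "lin_ext K V (\<lambda>(a, b). \<beta> a b)"
  note \<beta>' = bilinearD[OF \<beta>]
  have b: "?b \<in> carrier (A \<times>\<times> B) \<rightarrow> carrier V" using \<beta>' by auto
  have f: "?f \<in> module_hom K \<F> V" by (rule A.lin_ext_hom[OF V b])
  interpret f: mod_hom K \<F> V ?f
    by (intro mod_hom.intro mod_hom_axioms.intro f V M.F.module_axioms)
  have fe: "?f (e a b) = \<beta> a b" if "a \<in> carrier A" "b \<in> carrier B" for a b
    using A.lin_ext_basis[OF V b, of "(a, b)"] that by simp
  have "tensor_relators K A B \<subseteq> f.ker"
  proof
    fix x assume x: "x \<in> tensor_relators K A B"
    then have "?f x = \<zero>\<^bsub>V\<^esub>"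
      by (cases rule: relator_cases) (simp_all add: e_closed fe \<beta>' V.r_neg a_minus_def)
    then show "x \<in> f.ker" using x relators_subset by (auto simp: f.ker_def)
  qed
  then have "N \<subseteq> f.ker"
    unfolding tensor_null_def by (rule M.F.span_is_subset[OF _ f.ker_is_submodule])
  then have null: "n \<in> N \<Longrightarrow> ?f n = \<zero>\<^bsub>V\<^esub>" for n by (auto simp: f.ker_def)
  have lift: "tensor_lift K V ?b = (\<lambda>q. the_elem (?f ` q))" by (rule ext) (simp add: tensor_lift_def)
  show "tensor_lift K V ?b \<in> module_hom K T V"
    unfolding lift T_eq by (rule I.factor_module_hom[OF V f null])
  show "tensor_lift K V ?b (pt a b) = \<beta> a b" if "a \<in> carrier A" "b \<in> carrier B"
    using that I.the_elem_image_proj[OF V f null] fe unfolding lift pt_eq by (simp add: e_closed)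
qed

lemma tensor_hom_eq:
  assumes V: "module K V" and f: "f \<in> module_hom K T V" and g: "g \<in> module_hom K T V"
    and eq: "\<And>a b. a \<in> carrier A \<Longrightarrow> b \<in> carrier B \<Longrightarrow> f (pt a b) = g (pt a b)"
    and z: "z \<in> carrier T"
  shows "f z = g z"
  by (rule tensor_induct[OF z]) (use eq module_homD[OF f] module_homD[OF g] in auto)

end

lemma k_algebra_tensor: "k_algebra K A \<Longrightarrow> k_algebra K B \<Longrightarrow> k_algebra K (tensor K A B)"
  by (rule two_algebras.k_algebra_tensor) (rule two_algebras.intro)

locale tensor_maps = S: two_algebras K A' B' + T: two_algebras K A B for K A' B' A B +
  fixes f h
  assumes f: "f \<in> module_hom K A' A" and h: "h \<in> module_hom K B' B"
begin

lemma bilinear: "bilinear K A' B' T.T (\<lambda>a b. T.pt (f a) (h b))"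
  by (intro bilinearI module_homI)
    (simp_all add: module_homD[OF f] module_homD[OF h] T.pt_add_left T.pt_add_right
      T.pt_smult_left T.pt_smult_right)

lemma T_module: "module K T.T"
proof -
  interpret k_algebra K T.T by (rule T.k_algebra_tensor)
  show ?thesis ..
qed

lemma tensor_map_hom: "tensor_map K A B f h \<in> module_hom K S.T T.T"
  unfolding tensor_map_def by (rule S.tensor_lift_hom[OF T_module bilinear])

lemma tensor_map_pt:
  "a \<in> carrier A' \<Longrightarrow> b \<in> carrier B' \<Longrightarrow> tensor_map K A B f h (S.pt a b) = T.pt (f a) (h b)"
  unfolding tensor_map_def by (rule S.tensor_lift_pt[OF T_module bilinear])

end

context k_algebra begin

lemma k_algebra_self: "k_algebra K A" ..

lemma module_self: "module K A" ..

lemma two_algebras_self: "two_algebras K A A"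
  by (intro two_algebras.intro k_algebra_self)

text \<open>The associativity map is defined by a nested lift. The inner lift must be shown to depend
  linearly on the third factor, which can be tested on pure tensors.\<close>

lemma tensor_assoc_hom_pt:
  shows tensor_assoc_hom:
      "tensor_assoc K A \<in> module_hom K (tensor K (tensor K A A) A) (tensor K A (tensor K A A))"
    and tensor_assoc_pt: "a \<in> carrier A \<Longrightarrow> b \<in> carrier A \<Longrightarrow> c \<in> carrier A \<Longrightarrow>
      tensor_assoc K A (pure_tensor K (tensor K A A) A (pure_tensor K A A a b) c) =
        pure_tensor K A (tensor K A A) a (pure_tensor K A A b c)"
proof -
  let ?AA = "tensor K A A" and ?L = "tensor K (tensor K A A) A" and ?R = "tensor K A (tensor K A A)"
  interpret S: two_algebras K A A by (rule two_algebras_self)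
  interpret AA: k_algebra K ?AA by (rule S.k_algebra_tensor)
  interpret L: two_algebras K ?AA A
    by (intro two_algebras.intro k_algebra_self AA.k_algebra_self)
  interpret R: two_algebras K A ?AA
    by (intro two_algebras.intro k_algebra_self AA.k_algebra_self)
  interpret RA: k_algebra K ?R by (rule R.k_algebra_tensor)
  have R_module: "module K ?R" ..
  let ?\<beta> = "\<lambda>c a b. R.pt a (S.pt b c)"
  let ?\<gamma> = "\<lambda>z c. tensor_lift K ?R (\<lambda>(a, b). ?\<beta> c a b) z"
  have \<beta>: "bilinear K A A ?R (?\<beta> c)" if "c \<in> carrier A" for c
    using that by (intro bilinearI module_homI)
      (simp_all add: S.pt_add_left S.pt_smult_left R.pt_add_left R.pt_add_right R.pt_smult_left R.pt_smult_right)
  note hom = S.tensor_lift_hom[OF R_module \<beta>] and val = S.tensor_lift_pt[OF R_module \<beta>]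
  have \<gamma>: "bilinear K ?AA A ?R ?\<gamma>"
  proof (intro bilinearI module_homI)
    fix z c c' assume z: "z \<in> carrier ?AA" and c: "c \<in> carrier A" "c' \<in> carrier A"
    show "?\<gamma> z (c \<oplus>\<^bsub>A\<^esub> c') = ?\<gamma> z c \<oplus>\<^bsub>?R\<^esub> ?\<gamma> z c'"
    proof (rule S.tensor_hom_eq[OF R_module hom _ _ z])
      show "(\<lambda>z. ?\<gamma> z c \<oplus>\<^bsub>?R\<^esub> ?\<gamma> z c') \<in> module_hom K ?AA ?R"
        by (rule module_homI)
          (use c in \<open>simp_all add: module_homD[OF hom] RA.M.a_ac RA.smult_r_distr\<close>)
    qed (use c in \<open>auto simp: val S.pt_add_right R.pt_add_right\<close>)
  next
    fix z r c assume z: "z \<in> carrier ?AA" and r: "r \<in> carrier K" and c: "c \<in> carrier A"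
    show "?\<gamma> z (r \<odot>\<^bsub>A\<^esub> c) = r \<odot>\<^bsub>?R\<^esub> ?\<gamma> z c"
    proof (rule S.tensor_hom_eq[OF R_module hom _ _ z])
      show "(\<lambda>z. r \<odot>\<^bsub>?R\<^esub> ?\<gamma> z c) \<in> module_hom K ?AA ?R"
        by (rule module_homI)
          (use c r in \<open>simp_all add: module_homD[OF hom] RA.smult_r_distr RA.smult_assoc1[symmetric] m_comm\<close>)
    qed (use c r in \<open>auto simp: val S.pt_smult_right R.pt_smult_right\<close>)
  qed (auto simp: module_homD[OF hom])
  have eq: "tensor_assoc K A = tensor_lift K ?R (\<lambda>(z, c). ?\<gamma> z c)"
    by (simp add: tensor_assoc_def Let_def)
  show "tensor_assoc K A \<in> module_hom K ?L ?R"
    unfolding eq by (rule L.tensor_lift_hom[OF R_module \<gamma>])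
  show "tensor_assoc K A (L.pt (S.pt a b) c) = R.pt a (S.pt b c)"
    if "a \<in> carrier A" "b \<in> carrier A" "c \<in> carrier A"
    using that L.tensor_lift_pt[OF R_module \<gamma>] val unfolding eq by simp
qed

end

text \<open>A Hopf algebra and its underlying algebra are different records. Their tensor squares are
  equal on the nose, as only the algebra operations enter.\<close>

lemma tensor_cong:
  assumes "carrier A' = carrier A" "ring.add A' = ring.add A" "smult A' = smult A"
    "monoid.mult A' = monoid.mult A" "monoid.one A' = monoid.one A"
    "carrier B' = carrier B" "ring.add B' = ring.add B" "smult B' = smult B"
    "monoid.mult B' = monoid.mult B" "monoid.one B' = monoid.one B"
  shows "tensor K A' B' = tensor K A B" "pure_tensor K A' B' = pure_tensor K A B"
proof -
  have 1: "A' \<times>\<times> B' = A \<times>\<times> B" using assms by (simp add: DirProd_def)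
  have 2: "tensor_relators K A' B' = tensor_relators K A B"
    unfolding tensor_relators_def Let_def 1 assms ..
  show "tensor K A' B' = tensor K A B" "pure_tensor K A' B' = pure_tensor K A B"
    unfolding tensor_def pure_tensor_def tensor_null_def 1 2 by auto
qed

section \<open>Hopf algebras spanned by group-like and skew-primitive elements\<close>

definition grouplike ::
  "('k, 'c) ring_scheme \<Rightarrow> ('k, 'a, 'm) hopf_data_scheme \<Rightarrow> 'a \<Rightarrow> bool" where
  "grouplike K A h \<longleftrightarrow>
    h \<in> carrier A \<and> comult A h = pure_tensor K A A h h \<and> counit A h = \<one>\<^bsub>K\<^esub>"

text \<open>The convention for \<open>x\<close> in Sweedler's algebra: \<open>\<Delta>(y) = y \<otimes> h + k \<otimes> y\<close>.\<close>

definition skew_primitive ::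
  "('k, 'c) ring_scheme \<Rightarrow> ('k, 'a, 'm) hopf_data_scheme \<Rightarrow> 'a \<Rightarrow> 'a \<Rightarrow> 'a \<Rightarrow> bool" where
  "skew_primitive K A h k y \<longleftrightarrow> grouplike K A h \<and> grouplike K A k \<and> y \<in> carrier A \<and>
    comult A y = pure_tensor K A A y h \<oplus>\<^bsub>tensor K A A\<^esub> pure_tensor K A A k y \<and> counit A y = \<zero>\<^bsub>K\<^esub>"

lemma grouplikeD:
  assumes "grouplike K A h"
  shows "h \<in> carrier A" "comult A h = pure_tensor K A A h h" "counit A h = \<one>\<^bsub>K\<^esub>"
  using assms by (auto simp: grouplike_def)

lemma skew_primitiveD:
  assumes "skew_primitive K A h k y"
  shows "grouplike K A h" "grouplike K A k" "y \<in> carrier A" "counit A y = \<zero>\<^bsub>K\<^esub>"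
    "comult A y = pure_tensor K A A y h \<oplus>\<^bsub>tensor K A A\<^esub> pure_tensor K A A k y"
  using assms by (auto simp: skew_primitive_def)

text \<open>What is left of a Hopf algebra when only the multiplicativity of \<open>\<Delta>\<close> and \<open>\<epsilon>\<close> is known. The
  products of group-like and skew-primitive elements can already be controlled here.\<close>

locale comult_algebra = k_algebra K A
  for K :: "('k, 'c) ring_scheme" (structure) and A :: "('k, 'a, 'm) hopf_data_scheme" (structure) +
  assumes comult_alg_hom: "comult A \<in> alg_hom K A (tensor K A A)"
    and counit_alg_hom: "counit A \<in> alg_hom K A (self_algebra K)"
begin

sublocale AA: two_algebras K A A by (rule two_algebras_self)

lemmas \<Delta> = alg_homD[OF comult_alg_hom]
lemmas \<epsilon> = alg_homD[OF counit_alg_hom, simplified]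

lemma grouplike_one: "grouplike K A \<one>\<^bsub>A\<^esub>"
  using \<Delta>(7) \<epsilon>(7) by (simp add: grouplike_def AA.one_T)

lemma grouplike_mult:
  assumes "grouplike K A h" "grouplike K A k" shows "grouplike K A (h \<otimes>\<^bsub>A\<^esub> k)"
  using grouplikeD[OF assms(1)] grouplikeD[OF assms(2)] \<Delta>(4) \<epsilon>(4)
  by (simp add: grouplike_def AA.pt_mult)

lemma grouplike_pow:
  assumes "grouplike K A h" shows "grouplike K A (h [^]\<^bsub>A\<^esub> (m::nat))"
  by (induction m) (simp_all add: grouplike_one grouplike_mult assms)

lemma skew_primitive_mult:
  assumes y: "skew_primitive K A h k y" and g: "grouplike K A g"
  shows "skew_primitive K A (g \<otimes>\<^bsub>A\<^esub> h) (g \<otimes>\<^bsub>A\<^esub> k) (g \<otimes>\<^bsub>A\<^esub> y)"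
    and "skew_primitive K A (h \<otimes>\<^bsub>A\<^esub> g) (k \<otimes>\<^bsub>A\<^esub> g) (y \<otimes>\<^bsub>A\<^esub> g)"
proof -
  interpret T: k_algebra K "tensor K A A" by (rule AA.k_algebra_tensor)
  note yD = skew_primitiveD[OF y]
  note s = yD grouplikeD[OF g] grouplikeD[OF yD(1)] grouplikeD[OF yD(2)]
  show "skew_primitive K A (g \<otimes>\<^bsub>A\<^esub> h) (g \<otimes>\<^bsub>A\<^esub> k) (g \<otimes>\<^bsub>A\<^esub> y)"
    "skew_primitive K A (h \<otimes>\<^bsub>A\<^esub> g) (k \<otimes>\<^bsub>A\<^esub> g) (y \<otimes>\<^bsub>A\<^esub> g)"
    unfolding skew_primitive_def
    using s(1-4,6-) by (simp_all add: grouplike_mult g s(5) \<Delta>(4) \<epsilon>(4) T.A.r_distr T.A.l_distr AA.pt_mult)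
qed

end

sublocale hopf_algebra \<subseteq> comult_algebra K A
  by unfold_locales (rule comult_hom counit_hom)+

context hopf_algebra begin

lemmas S = module_homD[OF antipode_linear]

lemma bilinear_antipode:
  "bilinear K A A A (\<lambda>a b. antipode A a \<otimes>\<^bsub>A\<^esub> b)" "bilinear K A A A (\<lambda>a b. a \<otimes>\<^bsub>A\<^esub> antipode A b)"
  by (auto intro!: bilinearI module_homI
      simp: S A.l_distr A.r_distr smult_mult_left smult_mult_right)

lemma antipode_grouplike:
  assumes "grouplike K A h"
  shows "antipode A h \<otimes>\<^bsub>A\<^esub> h = \<one>\<^bsub>A\<^esub>" "h \<otimes>\<^bsub>A\<^esub> antipode A h = \<one>\<^bsub>A\<^esub>"
  using antipode_left[of h] antipode_right[of h] grouplikeD[OF assms]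
    AA.tensor_lift_pt[OF module_self bilinear_antipode(1), of h h]
    AA.tensor_lift_pt[OF module_self bilinear_antipode(2), of h h] by simp_all

lemma antipode_skew_primitive:
  assumes y: "skew_primitive K A h k y"
  shows "antipode A y \<otimes>\<^bsub>A\<^esub> h \<oplus>\<^bsub>A\<^esub> antipode A k \<otimes>\<^bsub>A\<^esub> y = \<zero>\<^bsub>A\<^esub>"
    and "y \<otimes>\<^bsub>A\<^esub> antipode A h \<oplus>\<^bsub>A\<^esub> k \<otimes>\<^bsub>A\<^esub> antipode A y = \<zero>\<^bsub>A\<^esub>"
proof -
  note yD = skew_primitiveD[OF y]
  note s = yD grouplikeD[OF yD(1)] grouplikeD[OF yD(2)]
  show "antipode A y \<otimes>\<^bsub>A\<^esub> h \<oplus>\<^bsub>A\<^esub> antipode A k \<otimes>\<^bsub>A\<^esub> y = \<zero>\<^bsub>A\<^esub>"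
    using antipode_left[of y] s AA.tensor_lift_pt[OF module_self bilinear_antipode(1)]
      module_homD[OF AA.tensor_lift_hom[OF module_self bilinear_antipode(1)]] by simp
  show "y \<otimes>\<^bsub>A\<^esub> antipode A h \<oplus>\<^bsub>A\<^esub> k \<otimes>\<^bsub>A\<^esub> antipode A y = \<zero>\<^bsub>A\<^esub>"
    using antipode_right[of y] s AA.tensor_lift_pt[OF module_self bilinear_antipode(2)]
      module_homD[OF AA.tensor_lift_hom[OF module_self bilinear_antipode(2)]] by simp
qed

end

text \<open>All Hopf algebra axioms are equations between linear maps, so they may be checked on a spanning
  set. For \<open>\<Delta>(y) = y \<otimes> h + k \<otimes> y\<close>, both sides of coassociativity are
  \<open>y \<otimes> h \<otimes> h + k \<otimes> y \<otimes> h + k \<otimes> k \<otimes> y\<close>; no algebra structure on the triple tensor product is needed.\<close>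

lemma (in comult_algebra) hopf_algebraI:
  assumes S: "antipode A \<in> module_hom K A A"
    and span: "span B = carrier A"
    and B: "\<And>b. b \<in> B \<Longrightarrow>
      (grouplike K A b \<and> antipode A b \<otimes>\<^bsub>A\<^esub> b = \<one>\<^bsub>A\<^esub> \<and> b \<otimes>\<^bsub>A\<^esub> antipode A b = \<one>\<^bsub>A\<^esub>) \<or>
      (\<exists>h k. skew_primitive K A h k b \<and>
        antipode A b \<otimes>\<^bsub>A\<^esub> h \<oplus>\<^bsub>A\<^esub> antipode A k \<otimes>\<^bsub>A\<^esub> b = \<zero>\<^bsub>A\<^esub> \<and>
        b \<otimes>\<^bsub>A\<^esub> antipode A h \<oplus>\<^bsub>A\<^esub> k \<otimes>\<^bsub>A\<^esub> antipode A b = \<zero>\<^bsub>A\<^esub>)"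
  shows "hopf_algebra K A"
proof -
  let ?AA = "tensor K A A" and ?L = "tensor K (tensor K A A) A" and ?R = "tensor K A (tensor K A A)"
  interpret T: k_algebra K ?AA by (rule AA.k_algebra_tensor)
  interpret L: two_algebras K ?AA A by (intro two_algebras.intro k_algebra_self T.k_algebra_self)
  interpret R: two_algebras K A ?AA by (intro two_algebras.intro k_algebra_self T.k_algebra_self)
  interpret RA: k_algebra K ?R by (rule R.k_algebra_tensor)
  interpret LA: k_algebra K ?L by (rule L.k_algebra_tensor)
  interpret l: tensor_maps K A A ?AA A "comult A" id
    by unfold_locales (rule \<Delta>(1) module_hom_id)+
  interpret r: tensor_maps K A A A ?AA id "comult A"
    by unfold_locales (rule \<Delta>(1) module_hom_id)+
  note S' = module_homD[OF S]
  have B_closed: "B \<subseteq> carrier A"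
    using B by (auto dest!: grouplikeD(1) skew_primitiveD(3))
  note on_span = module_hom_eq_on_span[OF module_self _ _ _ span B_closed]
  have coassoc: "tensor_assoc K A (tensor_map K ?AA A (comult A) id (comult A a)) =
      tensor_map K A ?AA id (comult A) (comult A a)" if a: "a \<in> carrier A" for a
  proof (rule on_span[OF RA.module_self _ _ _ a])
    show "(\<lambda>a. tensor_assoc K A (tensor_map K ?AA A (comult A) id (comult A a))) \<in> module_hom K A ?R"
      by (intro module_hom_comp[OF _ tensor_assoc_hom] module_hom_comp[OF _ l.tensor_map_hom] \<Delta>)
    show "(\<lambda>a. tensor_map K A ?AA id (comult A) (comult A a)) \<in> module_hom K A ?R"
      by (intro module_hom_comp[OF _ r.tensor_map_hom] \<Delta>)
    fix b assume "b \<in> B"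
    note lin = module_homD[OF l.tensor_map_hom] module_homD[OF r.tensor_map_hom]
      module_homD[OF tensor_assoc_hom]
    note val = l.tensor_map_pt r.tensor_map_pt tensor_assoc_pt
    from B[OF \<open>b \<in> B\<close>] show "tensor_assoc K A (tensor_map K ?AA A (comult A) id (comult A b)) =
      tensor_map K A ?AA id (comult A) (comult A b)"
    proof (elim disjE conjE exE)
      assume "grouplike K A b"
      from grouplikeD[OF this] show ?thesis by (simp add: val)
    next
      fix h k assume y: "skew_primitive K A h k b"
      note s = grouplikeD[OF skew_primitiveD(1)[OF y]] grouplikeD[OF skew_primitiveD(2)[OF y]]
      show ?thesis
        using s skew_primitiveD(3,5)[OF y]
        by (simp add: val lin L.pt_add_left R.pt_add_right RA.M.a_assoc)
    qed
  qed
  have counit_lin: "(\<lambda>a. counit A a \<odot>\<^bsub>A\<^esub> \<one>\<^bsub>A\<^esub>) \<in> module_hom K A A"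
    by (rule module_homI) (auto simp: \<epsilon> smult_l_distr smult_assoc1)
  have bil: "bilinear K A A A (\<lambda>a b. counit A a \<odot>\<^bsub>A\<^esub> b)" "bilinear K A A A (\<lambda>a b. counit A b \<odot>\<^bsub>A\<^esub> a)"
    "bilinear K A A A (\<lambda>a b. antipode A a \<otimes>\<^bsub>A\<^esub> b)" "bilinear K A A A (\<lambda>a b. a \<otimes>\<^bsub>A\<^esub> antipode A b)"
    by (auto intro!: bilinearI module_homI
        simp: \<epsilon> smult_l_distr smult_r_distr smult_assoc1[symmetric] m_comm
          S' A.l_distr A.r_distr smult_mult_left smult_mult_right)
  have conv: "tensor_lift K A (\<lambda>(a, b). \<beta> a b) (comult A a) = \<phi> a"
    if \<beta>: "bilinear K A A A \<beta>" and \<phi>: "\<phi> \<in> module_hom K A A" and a: "a \<in> carrier A"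
      and gl: "\<And>h. h \<in> B \<Longrightarrow> grouplike K A h \<Longrightarrow> antipode A h \<otimes>\<^bsub>A\<^esub> h = \<one>\<^bsub>A\<^esub> \<Longrightarrow>
        h \<otimes>\<^bsub>A\<^esub> antipode A h = \<one>\<^bsub>A\<^esub> \<Longrightarrow> \<beta> h h = \<phi> h"
      and sk: "\<And>h k y. skew_primitive K A h k y \<Longrightarrow>
        antipode A y \<otimes>\<^bsub>A\<^esub> h \<oplus>\<^bsub>A\<^esub> antipode A k \<otimes>\<^bsub>A\<^esub> y = \<zero>\<^bsub>A\<^esub> \<Longrightarrow>
        y \<otimes>\<^bsub>A\<^esub> antipode A h \<oplus>\<^bsub>A\<^esub> k \<otimes>\<^bsub>A\<^esub> antipode A y = \<zero>\<^bsub>A\<^esub> \<Longrightarrow> \<beta> y h \<oplus>\<^bsub>A\<^esub> \<beta> k y = \<phi> y" for \<beta> \<phi> a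
  proof (rule on_span[OF module_self _ \<phi> _ a])
    note hom = AA.tensor_lift_hom[OF module_self \<beta>] and val = AA.tensor_lift_pt[OF module_self \<beta>]
    show "(\<lambda>a. tensor_lift K A (\<lambda>(a, b). \<beta> a b) (comult A a)) \<in> module_hom K A A"
      by (intro module_hom_comp[OF _ hom] \<Delta>)
    fix b assume b: "b \<in> B"
    from B[OF b] show "tensor_lift K A (\<lambda>(a, b). \<beta> a b) (comult A b) = \<phi> b"
    proof (elim disjE conjE exE)
      assume "grouplike K A b" "antipode A b \<otimes>\<^bsub>A\<^esub> b = \<one>\<^bsub>A\<^esub>" "b \<otimes>\<^bsub>A\<^esub> antipode A b = \<one>\<^bsub>A\<^esub>"
      with gl[OF b this] grouplikeD[OF this(1)] show ?thesis by (simp add: val)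
    next
      fix h k assume y: "skew_primitive K A h k b" and
        "antipode A b \<otimes>\<^bsub>A\<^esub> h \<oplus>\<^bsub>A\<^esub> antipode A k \<otimes>\<^bsub>A\<^esub> b = \<zero>\<^bsub>A\<^esub>"
        "b \<otimes>\<^bsub>A\<^esub> antipode A h \<oplus>\<^bsub>A\<^esub> k \<otimes>\<^bsub>A\<^esub> antipode A b = \<zero>\<^bsub>A\<^esub>"
      from sk[OF this] skew_primitiveD(3,5)[OF y] grouplikeD(1)[OF skew_primitiveD(1)[OF y]]
        grouplikeD(1)[OF skew_primitiveD(2)[OF y]]
      show ?thesis by (simp add: module_homD[OF hom] val)
    qed
  qed
  have sk0: "counit A y = \<zero>\<^bsub>K\<^esub> \<and> counit A h = \<one>\<^bsub>K\<^esub> \<and> counit A k = \<one>\<^bsub>K\<^esub> \<and> y \<in> carrier A \<and> h \<in> carrier A \<and> k \<in> carrier A"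
    if "skew_primitive K A h k y" for h k y
    using that by (simp add: skew_primitive_def grouplike_def)
  have gl0: "counit A h = \<one>\<^bsub>K\<^esub> \<and> h \<in> carrier A" if "grouplike K A h" for h
    using that by (simp add: grouplike_def)
  have id_lin: "(\<lambda>a. a) \<in> module_hom K A A" by (rule module_hom_id)
  show ?thesis
  proof (unfold_locales, rule comult_alg_hom, rule counit_alg_hom)
    fix a assume a: "a \<in> carrier A"
    show "tensor_lift K A (\<lambda>(a, b). counit A a \<odot>\<^bsub>A\<^esub> b) (comult A a) = a"
      by (rule conv[OF bil(1) id_lin a]; (drule gl0 | drule sk0); simp)
    show "tensor_lift K A (\<lambda>(a, b). counit A b \<odot>\<^bsub>A\<^esub> a) (comult A a) = a"
      by (rule conv[OF bil(2) id_lin a]; (drule gl0 | drule sk0); simp)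
    show "tensor_lift K A (\<lambda>(a, b). antipode A a \<otimes>\<^bsub>A\<^esub> b) (comult A a) = counit A a \<odot>\<^bsub>A\<^esub> \<one>\<^bsub>A\<^esub>"
      by (rule conv[OF bil(3) counit_lin a]; (drule gl0 | drule sk0); simp)
    show "tensor_lift K A (\<lambda>(a, b). a \<otimes>\<^bsub>A\<^esub> antipode A b) (comult A a) = counit A a \<odot>\<^bsub>A\<^esub> \<one>\<^bsub>A\<^esub>"
      by (rule conv[OF bil(4) counit_lin a]; (drule gl0 | drule sk0); simp)
  qed (use coassoc S in auto)
qed

text \<open>On a group-like \<open>h\<close> the antipode is the inverse, and on a skew-primitive \<open>y\<close> it is
  \<open>- S(k) y S(h)\<close>. So it is forced by the algebra structure, and an algebra map that respects these
  elements commutes with it.\<close>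

lemma hopf_homI:
  fixes A :: "('k, 'a, 'm) hopf_data_scheme" and B :: "('k, 'b, 'n) hopf_data_scheme"
  assumes A: "hopf_algebra K A" and B: "hopf_algebra K B" and f: "f \<in> alg_hom K A B"
    and span: "module.span K A G = carrier A"
    and G: "\<And>a. a \<in> G \<Longrightarrow>
      (grouplike K A a \<and> grouplike K B (f a)) \<or>
      (\<exists>h k. skew_primitive K A h k a \<and> skew_primitive K B (f h) (f k) (f a))"
  shows "f \<in> hopf_hom K A B"
proof -
  interpret A: hopf_algebra K A by fact
  interpret B: hopf_algebra K B by fact
  interpret BB: k_algebra K "tensor K B B" by (rule B.AA.k_algebra_tensor)
  note f' = alg_homD[OF f]
  interpret ff: tensor_maps K A A B B f f by unfold_locales (rule f'(1))+
  have G_closed: "G \<subseteq> carrier A"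
    using G by (auto dest!: grouplikeD(1) skew_primitiveD(3))
  note on_span = module_hom_eq_on_span[OF A.module_self _ _ _ span G_closed]
  have anti_gl: "antipode B (f h) = f (antipode A h)" if h: "grouplike K A h" "grouplike K B (f h)" for h
  proof -
    note s = grouplikeD(1)[OF h(1)] grouplikeD(1)[OF h(2)]
    have "f (antipode A h) \<otimes>\<^bsub>B\<^esub> f h = \<one>\<^bsub>B\<^esub>"
      using A.antipode_grouplike(1)[OF h(1)] f' s A.S(1) by metis
    then show ?thesis
      using B.A.inv_unique[of "f (antipode A h)" "f h" "antipode B (f h)"] B.antipode_grouplike(2)[OF h(2)]
        s f' A.S B.S by simp
  qed
  have anti_sk: "antipode B (f y) = f (antipode A y)"
    if y: "skew_primitive K A h k y" "skew_primitive K B (f h) (f k) (f y)" for h k y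
  proof -
    note yA = skew_primitiveD[OF y(1)] and yB = skew_primitiveD[OF y(2)]
    note s = grouplikeD(1)[OF yA(1)] grouplikeD(1)[OF yA(2)] yA(3)
    have c: "f h \<in> carrier B" "f k \<in> carrier B" "f y \<in> carrier B" "antipode B (f h) \<in> carrier B"
      "antipode B (f k) \<in> carrier B" "antipode B (f y) \<in> carrier B" "f (antipode A y) \<in> carrier B"
      "antipode A y \<in> carrier A" "antipode A k \<in> carrier A"
      using s f'(3) A.S(1) B.S(1) by auto
    have "f (antipode A y) \<otimes>\<^bsub>B\<^esub> f h \<oplus>\<^bsub>B\<^esub> antipode B (f k) \<otimes>\<^bsub>B\<^esub> f y = \<zero>\<^bsub>B\<^esub>"
      unfolding anti_gl[OF yA(2) yB(2)]
      using arg_cong[OF A.antipode_skew_primitive(1)[OF y(1)], of f] s c f'(4,5)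
        module_hom_zero[OF A.module_self B.module_self f'(1)] by simp
    then have "f (antipode A y) \<otimes>\<^bsub>B\<^esub> f h = antipode B (f y) \<otimes>\<^bsub>B\<^esub> f h"
      using B.antipode_skew_primitive(1)[OF y(2)] c B.M.add.m_closed
      by (metis B.A.m_closed B.M.add.r_cancel)
    then have "f (antipode A y) \<otimes>\<^bsub>B\<^esub> (f h \<otimes>\<^bsub>B\<^esub> antipode B (f h)) =
        antipode B (f y) \<otimes>\<^bsub>B\<^esub> (f h \<otimes>\<^bsub>B\<^esub> antipode B (f h))"
      using c B.A.m_assoc by metis
    then show ?thesis using c B.antipode_grouplike(2)[OF yB(1)] by simp
  qed
  have "comult B (f a) = tensor_map K B B f f (comult A a)" if a: "a \<in> carrier A" for a
  proof (rule on_span[OF BB.module_self _ _ _ a])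
    show "(\<lambda>a. comult B (f a)) \<in> module_hom K A (tensor K B B)"
      by (rule module_hom_comp[OF f'(1) B.\<Delta>(1)])
    show "(\<lambda>a. tensor_map K B B f f (comult A a)) \<in> module_hom K A (tensor K B B)"
      by (rule module_hom_comp[OF A.\<Delta>(1) ff.tensor_map_hom])
    fix g assume "g \<in> G"
    from G[OF this] show "comult B (f g) = tensor_map K B B f f (comult A g)"
    proof (elim disjE conjE exE)
      assume "grouplike K A g" "grouplike K B (f g)"
      then show ?thesis by (simp add: grouplike_def ff.tensor_map_pt)
    next
      fix h k assume "skew_primitive K A h k g" "skew_primitive K B (f h) (f k) (f g)"
      then show ?thesis
        by (simp add: skew_primitive_def grouplike_def ff.tensor_map_pt module_homD[OF ff.tensor_map_hom])
    qed
  qed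
  moreover have "counit B (f a) = counit A a" if a: "a \<in> carrier A" for a
  proof (rule on_span[OF _ _ A.\<epsilon>(1) _ a])
    show "module K (self_algebra K)"
      using k_algebra.module_self[OF k_algebra_self_algebra] A.field_axioms by blast
    show "(\<lambda>a. counit B (f a)) \<in> module_hom K A (self_algebra K)"
      by (rule module_hom_comp[OF f'(1) B.\<epsilon>(1)])
    show "counit B (f g) = counit A g" if "g \<in> G" for g
      using G[OF that] by (auto simp: grouplike_def skew_primitive_def)
  qed
  moreover have "antipode B (f a) = f (antipode A a)" if a: "a \<in> carrier A" for a
  proof (rule on_span[OF B.module_self _ _ _ a])
    show "(\<lambda>a. antipode B (f a)) \<in> module_hom K A B"
      by (rule module_hom_comp[OF f'(1) B.antipode_linear])
    show "(\<lambda>a. f (antipode A a)) \<in> module_hom K A B"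
      by (rule module_hom_comp[OF A.antipode_linear f'(1)])
    show "antipode B (f g) = f (antipode A g)" if "g \<in> G" for g
      using G[OF that] anti_gl anti_sk by blast
  qed
  ultimately show ?thesis using f by (auto simp: hopf_hom_def)
qed

lemma hopf_homD:
  assumes "f \<in> hopf_hom K A B"
  shows "f \<in> alg_hom K A B" "\<And>a. a \<in> carrier A \<Longrightarrow> comult B (f a) = tensor_map K B B f f (comult A a)"
    "\<And>a. a \<in> carrier A \<Longrightarrow> counit B (f a) = counit A a"
    "\<And>a. a \<in> carrier A \<Longrightarrow> antipode B (f a) = f (antipode A a)"
  using assms by (auto simp: hopf_hom_def)

lemma hopf_hom_grouplike:
  assumes A: "k_algebra K A" and B: "k_algebra K B" and f: "f \<in> hopf_hom K A B"
    and h: "grouplike K A h"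
  shows "grouplike K B (f h)"
proof -
  note f' = alg_homD[OF hopf_homD(1)[OF f]]
  interpret ff: tensor_maps K A A B B f f
    by (intro tensor_maps.intro two_algebras.intro tensor_maps_axioms.intro A B f')
  show ?thesis
    using grouplikeD[OF h] hopf_homD[OF f] f' by (simp add: grouplike_def ff.tensor_map_pt)
qed

lemma hopf_hom_skew_primitive:
  assumes A: "k_algebra K A" and B: "k_algebra K B" and f: "f \<in> hopf_hom K A B"
    and y: "skew_primitive K A h k y"
  shows "skew_primitive K B (f h) (f k) (f y)"
proof -
  note f' = alg_homD[OF hopf_homD(1)[OF f]]
  interpret ff: tensor_maps K A A B B f f
    by (intro tensor_maps.intro two_algebras.intro tensor_maps_axioms.intro A B f')
  note yD = skew_primitiveD[OF y]
  show ?thesis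
    using yD grouplikeD(1)[OF yD(1)] grouplikeD(1)[OF yD(2)] hopf_homD[OF f] f'
      hopf_hom_grouplike[OF A B f yD(1)] hopf_hom_grouplike[OF A B f yD(2)]
    by (simp add: skew_primitive_def ff.tensor_map_pt module_homD[OF ff.tensor_map_hom])
qed

lemma hopf_hom_inverse:
  assumes A: "k_algebra K A" and B: "k_algebra K B"
    and \<Delta>A: "comult A \<in> alg_hom K A (tensor K A A)" and SA: "antipode A \<in> module_hom K A A"
    and f: "f \<in> hopf_hom K A B" and bij: "bij_betw f (carrier A) (carrier B)"
  shows "inv_into (carrier A) f \<in> hopf_hom K B A"
proof -
  interpret A: k_algebra K A by fact
  interpret S: two_algebras K A A by (rule A.two_algebras_self)
  interpret AA: k_algebra K "tensor K A A" by (rule S.k_algebra_tensor)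
  let ?h = "inv_into (carrier A) f"
  note f' = alg_homD[OF hopf_homD(1)[OF f]]
  have h_alg: "?h \<in> alg_hom K B A" by (rule alg_hom_inverse[OF A hopf_homD(1)[OF f] bij])
  have h: "?h b \<in> carrier A" "f (?h b) = b" if "b \<in> carrier B" for b
    using bij that by (auto simp: bij_betw_def inv_into_into f_inv_into_f)
  have hf: "?h (f a) = a" if "a \<in> carrier A" for a
    using bij that by (auto simp: bij_betw_def)
  interpret ff: tensor_maps K A A B B f f
    by (intro tensor_maps.intro two_algebras.intro tensor_maps_axioms.intro A B f')
  interpret hh: tensor_maps K B B A A ?h ?h
    by (intro tensor_maps.intro two_algebras.intro tensor_maps_axioms.intro A B alg_homD[OF h_alg])
  have inv: "tensor_map K A A ?h ?h (tensor_map K B B f f z) = z" if z: "z \<in> carrier (tensor K A A)" for z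
    by (rule S.tensor_hom_eq[OF AA.module_self module_hom_comp[OF ff.tensor_map_hom hh.tensor_map_hom] module_hom_id(1) _ z])
      (simp add: ff.tensor_map_pt hh.tensor_map_pt f' hf)
  have "comult A (?h b) = tensor_map K A A ?h ?h (comult B b)" if b: "b \<in> carrier B" for b
    using inv[of "comult A (?h b)"] hopf_homD(2)[OF f h(1)[OF b]] h[OF b] alg_homD(3)[OF \<Delta>A] by simp
  moreover have "counit A (?h b) = counit B b" if "b \<in> carrier B" for b
    using hopf_homD(3)[OF f h(1)] h that by metis
  moreover have "antipode A (?h b) = ?h (antipode B b)" if "b \<in> carrier B" for b
    using hopf_homD(4)[OF f h(1)] h hf that module_homD(1)[OF SA] by metis
  ultimately show ?thesis using h_alg by (auto simp: hopf_hom_def)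
qed

subsection \<open>Group Hopf algebras\<close>

lemma group_hopf_algebra_simps [simp]:
  "carrier (group_hopf_algebra K G) = carrier (monoid_algebra K G)"
  "monoid.mult (group_hopf_algebra K G) = monoid.mult (monoid_algebra K G)"
  "monoid.one (group_hopf_algebra K G) = monoid.one (monoid_algebra K G)"
  "ring.zero (group_hopf_algebra K G) = ring.zero (monoid_algebra K G)"
  "ring.add (group_hopf_algebra K G) = ring.add (monoid_algebra K G)"
  "smult (group_hopf_algebra K G) = smult (monoid_algebra K G)"
  by (simp_all add: group_hopf_algebra_def Let_def module.extend_def hopf_data.fields_def)

lemma group_hopf_algebra_props:
  fixes K :: "('k, 'c) ring_scheme" and G :: "('g, 'd) monoid_scheme"
  assumes K: "field K" and G: "Group.group G"
  shows hopf_algebra_group: "hopf_algebra K (group_hopf_algebra K G)"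
    and grouplike_basis_elt: "g \<in> carrier G \<Longrightarrow> grouplike K (group_hopf_algebra K G) (basis_elt K g)"
    and span_group_hopf_algebra:
      "module.span K (group_hopf_algebra K G) (basis_elt K ` carrier G) = carrier (group_hopf_algebra K G)"
proof -
  interpret K: field K by fact
  interpret G: Group.group G by fact
  interpret M: monoid_over_field K G by unfold_locales
  let ?F = "monoid_algebra K G" and ?H = "group_hopf_algebra K G"
  have F: "k_algebra K ?F" by (rule M.k_algebra_monoid_algebra)
  then have H: "k_algebra K ?H" by (rule k_algebra_cong) simp_all
  interpret F: k_algebra K ?F by fact
  interpret H: k_algebra K ?H by fact
  interpret T: two_algebras K ?F ?F by (rule F.two_algebras_self)
  interpret TA: k_algebra K "tensor K ?F ?F" by (rule T.k_algebra_tensor)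
  interpret KK: k_algebra K "self_algebra K" by (rule k_algebra_self_algebra[OF K])
  have T_eq: "tensor K ?H ?H = tensor K ?F ?F" "pure_tensor K ?H ?H = pure_tensor K ?F ?F"
    by (rule tensor_cong; simp)+
  have homs: "alg_hom K ?H B = alg_hom K ?F B" "module_hom K ?H B = module_hom K ?F B"
    "module_hom K ?F ?H = module_hom K ?F ?F" for B :: "('k, 'b, 'n) module_scheme"
    by (simp_all add: alg_hom_def module_hom_def ring_hom_def)
  have ec: "basis_elt K g \<in> carrier ?F" if "g \<in> carrier G" for g
    using that by (rule K.basis_elt_in_carrier)
  have ops: "comult ?H = lin_ext K (tensor K ?F ?F) (\<lambda>g. pure_tensor K ?F ?F (basis_elt K g) (basis_elt K g))"
    "counit ?H = lin_ext K (self_algebra K) (\<lambda>g. \<one>\<^bsub>K\<^esub>)"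
    "antipode ?H = lin_ext K ?F (\<lambda>g. basis_elt K (inv\<^bsub>G\<^esub> g))"
    by (simp_all add: group_hopf_algebra_def Let_def module.extend_def hopf_data.fields_def)
  have \<Delta>: "comult ?H \<in> alg_hom K ?H (tensor K ?H ?H)"
    unfolding T_eq homs ops
    by (rule M.lin_ext_alg_hom[OF TA.k_algebra_self])
      (auto simp: ec T.one_T monoid_algebra_simps(2) T.pt_mult M.mult_basis_elt)
  have \<epsilon>: "counit ?H \<in> alg_hom K ?H (self_algebra K)"
    unfolding homs ops by (rule M.lin_ext_alg_hom[OF KK.k_algebra_self]) auto
  have S: "antipode ?H \<in> module_hom K ?H ?H"
    unfolding homs ops by (rule K.lin_ext_hom[OF F.module_self]) (auto simp: ec)
  interpret H: comult_algebra K ?H by unfold_locales (rule \<Delta> \<epsilon>)+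
  show gl: "grouplike K ?H (basis_elt K g)" if g: "g \<in> carrier G" for g
    using g ec K.lin_ext_basis[OF TA.module_self _ g, of "\<lambda>g. T.pt (basis_elt K g) (basis_elt K g)"]
      K.lin_ext_basis[OF KK.module_self _ g, of "\<lambda>g. \<one>\<^bsub>K\<^esub>"]
    unfolding grouplike_def T_eq ops by (simp add: Pi_iff)
  have anti: "antipode ?H (basis_elt K g) = basis_elt K (inv\<^bsub>G\<^esub> g)" if g: "g \<in> carrier G" for g
    unfolding ops using ec g by (subst K.lin_ext_basis[OF F.module_self _ g]) auto
  show span: "module.span K ?H (basis_elt K ` carrier G) = carrier ?H"
    using M.span_basis_elts by (simp add: span_cong[OF F.module_self H.module_self])
  show "hopf_algebra K ?H"
  proof (rule H.hopf_algebraI[OF S span])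
    fix b assume "b \<in> basis_elt K ` carrier G"
    then obtain g where g: "g \<in> carrier G" "b = basis_elt K g" by auto
    have "antipode ?H b \<otimes>\<^bsub>?H\<^esub> b = \<one>\<^bsub>?H\<^esub>" "b \<otimes>\<^bsub>?H\<^esub> antipode ?H b = \<one>\<^bsub>?H\<^esub>"
      using g anti by (auto simp: M.mult_basis_elt monoid_algebra_simps(2))
    then show "(grouplike K ?H b \<and> antipode ?H b \<otimes>\<^bsub>?H\<^esub> b = \<one>\<^bsub>?H\<^esub> \<and> b \<otimes>\<^bsub>?H\<^esub> antipode ?H b = \<one>\<^bsub>?H\<^esub>) \<or>
      (\<exists>h k. skew_primitive K ?H h k b \<and>
        antipode ?H b \<otimes>\<^bsub>?H\<^esub> h \<oplus>\<^bsub>?H\<^esub> antipode ?H k \<otimes>\<^bsub>?H\<^esub> b = \<zero>\<^bsub>?H\<^esub> \<and>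
        b \<otimes>\<^bsub>?H\<^esub> antipode ?H h \<oplus>\<^bsub>?H\<^esub> k \<otimes>\<^bsub>?H\<^esub> antipode ?H b = \<zero>\<^bsub>?H\<^esub>)"
      using gl g by auto
  qed
qed

section \<open>Algebras given by generators and relations\<close>

locale presentation = K: field K for K :: "('k, 'c) ring_scheme" (structure) +
  fixes gens :: "'g set" and R :: "(('g list \<Rightarrow> 'k) \<times> ('g list \<Rightarrow> 'k)) set"
  assumes R_closed: "R \<subseteq> carrier (free_algebra K gens) \<times> carrier (free_algebra K gens)"
begin

abbreviation "W \<equiv> \<lparr>carrier = lists gens, monoid.mult = (@), monoid.one = []\<rparr>"

sublocale W: monoid_over_field K W
  by (unfold_locales) auto

abbreviation "FA \<equiv> free_algebra K gens"
abbreviation "Q \<equiv> presented_algebra K gens R"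
abbreviation "gen \<equiv> presented_gen K gens R"

lemma FA_eq: "FA = W.F" by (simp add: free_algebra_def)

interpretation F: k_algebra K FA unfolding FA_eq by (rule W.k_algebra_monoid_algebra)

lemma letter_closed: "s \<in> gens \<Longrightarrow> basis_elt K [s] \<in> carrier FA"
  unfolding FA_eq by (rule K.basis_elt_in_carrier) simp

lemma free_ext_props:
  assumes B: "k_algebra K B" and v: "v \<in> gens \<rightarrow> carrier B"
  shows free_ext_alg_hom: "free_ext K B v \<in> alg_hom K FA B"
    and free_ext_letter: "s \<in> gens \<Longrightarrow> free_ext K B v (basis_elt K [s]) = v s"
proof -
  interpret B: k_algebra K B by fact
  let ?b = "\<lambda>w. foldr (monoid.mult B) (map v w) \<one>\<^bsub>B\<^esub>"
  have closed: "?b w \<in> carrier B" if "w \<in> lists gens" for w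
    using that v by (induction w) auto
  have app: "?b (u @ w) = ?b u \<otimes>\<^bsub>B\<^esub> ?b w" if "u \<in> lists gens" "w \<in> lists gens" for u w
    using that
  proof (induction u)
    case (Cons s u)
    then have "v s \<in> carrier B" using v by auto
    with Cons closed[of u] closed[of w] show ?case by (simp add: B.A.m_assoc)
  qed (use closed in auto)
  have b: "?b \<in> carrier W \<rightarrow> carrier B" using closed by auto
  show "free_ext K B v \<in> alg_hom K FA B"
    unfolding free_ext_def FA_eq by (rule W.lin_ext_alg_hom[OF B b]) (simp_all add: app[simplified])
  show "free_ext K B v (basis_elt K [s]) = v s" if s: "s \<in> gens"
  proof -
    have "v s \<in> carrier B" using s v by auto
    then show ?thesis
      using K.lin_ext_basis[OF B.module_self b, of "[s]"] s by (simp add: free_ext_def)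
  qed
qed

abbreviation "relators \<equiv> {l \<ominus>\<^bsub>FA\<^esub> r | l r. (l, r) \<in> R}"

lemma relators_closed: "relators \<subseteq> carrier FA"
proof
  fix z assume "z \<in> relators"
  then obtain l r where "(l, r) \<in> R" "z = l \<ominus>\<^bsub>FA\<^esub> r" by auto
  then show "z \<in> carrier FA" using R_closed by auto
qed

interpretation I: algebra_ideal K FA "rel_ideal K gens R"
  unfolding rel_ideal_def
  by (intro algebra_ideal.intro F.k_algebra_self F.A.genideal_ideal relators_closed)

lemma Q_eq: "Q = I.Q" by (simp add: presented_algebra_def)

lemma gen_eq: "gen s = I.proj (basis_elt K [s])" by (simp add: presented_gen_def I.proj_def)

lemma k_algebra_Q: "k_algebra K Q" unfolding Q_eq by (rule I.k_algebra_Q)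

lemma gen_closed: "s \<in> gens \<Longrightarrow> gen s \<in> carrier Q"
  unfolding Q_eq gen_eq by (intro I.proj_in_Q letter_closed)

text \<open>The projection from the free algebra, with the properties from which relations between the
  generators of the quotient are read off.\<close>

lemma proj_relation:
  obtains p where "p \<in> alg_hom K FA Q" "\<And>s. p (basis_elt K [s]) = gen s"
    "\<And>l r. (l, r) \<in> R \<Longrightarrow> p l = p r"
proof
  show "I.proj \<in> alg_hom K FA Q" unfolding Q_eq by (rule I.proj_alg_hom)
  show "I.proj (basis_elt K [s]) = gen s" for s by (simp add: gen_eq)
  fix l r assume lr: "(l, r) \<in> R"
  then have "l \<ominus>\<^bsub>FA\<^esub> r \<in> relators" by auto
  then have "l \<ominus>\<^bsub>FA\<^esub> r \<in> rel_ideal K gens R"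
    unfolding rel_ideal_def using F.A.genideal_self[OF relators_closed] by blast
  then show "I.proj l = I.proj r" using lr R_closed I.proj_eq_iff[of l r] by auto
qed

text \<open>The kernel of the map on the free algebra is an ideal that contains the relators, hence the
  ideal that they generate.\<close>

lemma presented_lift:
  assumes B: "k_algebra K B" and v: "v \<in> gens \<rightarrow> carrier B"
    and rel: "\<And>l r. (l, r) \<in> R \<Longrightarrow> free_ext K B v l = free_ext K B v r"
  shows presented_lift_alg_hom: "(\<lambda>q. the_elem (free_ext K B v ` q)) \<in> alg_hom K Q B"
    and presented_lift_gen: "s \<in> gens \<Longrightarrow> the_elem (free_ext K B v ` gen s) = v s"
proof -
  interpret B: k_algebra K B by fact
  let ?f = "free_ext K B v"
  have f: "?f \<in> alg_hom K FA B" by (rule free_ext_alg_hom[OF B v])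
  note f' = alg_homD[OF f]
  have "ring FA" "ring B" ..
  then interpret f: ring_hom_ring FA B ?f
    using f'(2) by (simp add: ring_hom_ringI2)
  have "relators \<subseteq> a_kernel FA B ?f"
  proof
    fix z assume "z \<in> relators"
    then obtain l r where lr: "(l, r) \<in> R" "z = l \<ominus>\<^bsub>FA\<^esub> r" by auto
    then have c: "l \<in> carrier FA" "r \<in> carrier FA" using R_closed lr(1) by blast+
    have "?f z = ?f r \<oplus>\<^bsub>B\<^esub> \<ominus>\<^bsub>B\<^esub> ?f r"
      unfolding lr(2) a_minus_def using rel[OF lr(1)] f'(5)[OF c(1) F.M.a_inv_closed[OF c(2)]] f.hom_a_inv[OF c(2)] by simp
    also have "\<dots> = \<zero>\<^bsub>B\<^esub>" using f'(3)[OF c(2)] by (simp add: B.M.r_neg)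
    finally have "?f z = \<zero>\<^bsub>B\<^esub>" .
    moreover have "z \<in> carrier FA" unfolding lr(2) using c by (rule F.M.minus_closed)
    ultimately show "z \<in> a_kernel FA B ?f" unfolding a_kernel_def' by (intro CollectI conjI)
  qed
  then have "rel_ideal K gens R \<subseteq> a_kernel FA B ?f"
    unfolding rel_ideal_def by (rule F.A.genideal_minimal[OF f.kernel_is_ideal])
  then have null: "i \<in> rel_ideal K gens R \<Longrightarrow> ?f i = \<zero>\<^bsub>B\<^esub>" for i unfolding a_kernel_def' by fast
  show "(\<lambda>q. the_elem (?f ` q)) \<in> alg_hom K Q B"
    unfolding Q_eq by (rule I.factor_alg_hom[OF B f null])
  show "the_elem (?f ` gen s) = v s" if "s \<in> gens"
    using I.the_elem_image_proj[OF B.module_self f'(1) null letter_closed[OF that]]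
      free_ext_letter[OF B v that] by (simp add: gen_eq)
qed

text \<open>A word is its first letter times a shorter word, so a subspace that contains \<open>1\<close> and is stable
  under left multiplication by generators is everything.\<close>

lemma presented_induct:
  assumes N: "submodule K N Q" and one: "\<one>\<^bsub>Q\<^esub> \<in> N"
    and gen: "\<And>s z. s \<in> gens \<Longrightarrow> z \<in> N \<Longrightarrow> gen s \<otimes>\<^bsub>Q\<^esub> z \<in> N"
  shows "N = carrier Q"
proof
  interpret N: submodule K N Q by fact
  note p = I.proj_alg_hom[folded Q_eq]
  note p' = alg_homD[OF p]
  show "N \<subseteq> carrier Q" by (rule N.subset)
  show "carrier Q \<subseteq> N"
  proof
    fix q assume "q \<in> carrier Q"
    then obtain f where f: "f \<in> carrier FA" "q = I.proj f" unfolding Q_eq by (rule I.Q_cases)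
    have "I.proj f \<in> N" using f(1) unfolding FA_eq
    proof (rule K.monoid_algebra_induct, unfold FA_eq[symmetric])
      have "I.proj \<zero>\<^bsub>FA\<^esub> = \<zero>\<^bsub>Q\<^esub>" unfolding Q_eq by (rule I.Q_zero[symmetric])
      then show "I.proj \<zero>\<^bsub>FA\<^esub> \<in> N" using N.zero_closed by simp
      fix w assume "w \<in> carrier W"
      then have "w \<in> lists gens" by simp
      then show "I.proj (basis_elt K w) \<in> N"
      proof (induction w)
        case Nil
        have "basis_elt K [] = \<one>\<^bsub>FA\<^esub>" by (simp add: FA_eq monoid_algebra_simps)
        then show ?case using one p'(7) by simp
      next
        case (Cons s w)
        have "basis_elt K (s # w) = basis_elt K [s] \<otimes>\<^bsub>FA\<^esub> basis_elt K w"
          unfolding FA_eq using Cons by (subst W.mult_basis_elt) auto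
        moreover have "basis_elt K w \<in> carrier FA"
          unfolding FA_eq using Cons by (intro K.basis_elt_in_carrier) auto
        ultimately show ?case
          using Cons gen p'(4)[OF letter_closed] by (simp add: gen_eq)
      qed
    qed (use p' N.m_closed N.smult_closed in auto)
    then show "q \<in> N" using f by simp
  qed
qed

end

lemma presented_hopf_simps:
  "carrier (presented_hopf K S R cm cu an) = carrier (presented_algebra K S R)"
  "monoid.mult (presented_hopf K S R cm cu an) = monoid.mult (presented_algebra K S R)"
  "monoid.one (presented_hopf K S R cm cu an) = monoid.one (presented_algebra K S R)"
  "ring.zero (presented_hopf K S R cm cu an) = ring.zero (presented_algebra K S R)"
  "ring.add (presented_hopf K S R cm cu an) = ring.add (presented_algebra K S R)"
  "smult (presented_hopf K S R cm cu an) = smult (presented_algebra K S R)"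
  "comult (presented_hopf K S R cm cu an) =
    (\<lambda>q. the_elem (free_ext K (tensor K (presented_algebra K S R) (presented_algebra K S R)) cm ` q))"
  "counit (presented_hopf K S R cm cu an) = (\<lambda>q. the_elem (free_ext K (self_algebra K) cu ` q))"
  "antipode (presented_hopf K S R cm cu an) =
    (\<lambda>q. the_elem (free_ext K (opposite (presented_algebra K S R)) an ` q))"
  by (simp_all add: presented_hopf_def Let_def module.extend_def hopf_data.fields_def)

section \<open>The relations of \<open>H\<^bsub>4n,\<omega>\<^esub>\<close>\<close>

text \<open>Sweedler's relations are the case \<open>c = 1\<close>, \<open>n = 1\<close>, \<open>\<omega> = 1\<close>.\<close>

locale sweedler_relations = k_algebra K A
  for K :: "('k, 'c) ring_scheme" (structure) and A :: "('k, 'a, 'm) module_scheme" (structure) +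
  fixes g x c :: 'a and n :: nat and \<omega> :: 'k
  assumes closed [simp]: "g \<in> carrier A" "x \<in> carrier A" "c \<in> carrier A" "\<omega> \<in> carrier K"
    and n_pos: "n > 0"
    and gg: "g \<otimes>\<^bsub>A\<^esub> g = \<one>\<^bsub>A\<^esub>" and xx: "x \<otimes>\<^bsub>A\<^esub> x = \<zero>\<^bsub>A\<^esub>" and xg: "x \<otimes>\<^bsub>A\<^esub> g = \<ominus>\<^bsub>A\<^esub> (g \<otimes>\<^bsub>A\<^esub> x)"
    and cn: "c [^]\<^bsub>A\<^esub> n = \<one>\<^bsub>A\<^esub>" and cg: "c \<otimes>\<^bsub>A\<^esub> g = g \<otimes>\<^bsub>A\<^esub> c"
    and cx: "c \<otimes>\<^bsub>A\<^esub> x = \<omega> \<odot>\<^bsub>A\<^esub> (x \<otimes>\<^bsub>A\<^esub> c)"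

text \<open>The monomial \<open>g\<^sup>a x\<^sup>s c\<^sup>d\<close> has index \<open>(s, a, d)\<close>, with the exponents of \<open>x\<close> and \<open>g\<close> as truth values.
  The exponent of \<open>x\<close> comes first because it decides between group-like and skew-primitive.\<close>

definition monomial ::
  "('k, 'a, 'm) module_scheme \<Rightarrow> 'a \<Rightarrow> 'a \<Rightarrow> 'a \<Rightarrow> bool \<times> bool \<times> nat \<Rightarrow> 'a" where
  "monomial A g x c = (\<lambda>(s, a, d).
    (if a then g else \<one>\<^bsub>A\<^esub>) \<otimes>\<^bsub>A\<^esub> ((if s then x else \<one>\<^bsub>A\<^esub>) \<otimes>\<^bsub>A\<^esub> c [^]\<^bsub>A\<^esub> d))"

abbreviation indices :: "nat \<Rightarrow> (bool \<times> bool \<times> nat) set" where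
  "indices n \<equiv> UNIV \<times> UNIV \<times> {..<n}"

lemma (in k_algebra) monomial_closed:
  assumes "g \<in> carrier A" "x \<in> carrier A" "c \<in> carrier A"
  shows "monomial A g x c u \<in> carrier A"
  using assms by (cases u) (simp add: monomial_def)

context sweedler_relations begin

abbreviation "\<mu> \<equiv> monomial A g x c"

lemma mon_closed [simp]: "\<mu> u \<in> carrier A" by (rule monomial_closed) simp_all

lemma gg_assoc: "z \<in> carrier A \<Longrightarrow> g \<otimes>\<^bsub>A\<^esub> (g \<otimes>\<^bsub>A\<^esub> z) = z"
  by (simp add: A.m_assoc[symmetric] gg)

lemma xx_assoc: "z \<in> carrier A \<Longrightarrow> x \<otimes>\<^bsub>A\<^esub> (x \<otimes>\<^bsub>A\<^esub> z) = \<zero>\<^bsub>A\<^esub>"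
  by (simp add: A.m_assoc[symmetric] xx)

lemma xg_assoc: "z \<in> carrier A \<Longrightarrow> x \<otimes>\<^bsub>A\<^esub> (g \<otimes>\<^bsub>A\<^esub> z) = \<ominus>\<^bsub>A\<^esub> (g \<otimes>\<^bsub>A\<^esub> (x \<otimes>\<^bsub>A\<^esub> z))"
  by (simp add: A.m_assoc[symmetric] xg A.l_minus)

lemma cg_assoc: "z \<in> carrier A \<Longrightarrow> c \<otimes>\<^bsub>A\<^esub> (g \<otimes>\<^bsub>A\<^esub> z) = g \<otimes>\<^bsub>A\<^esub> (c \<otimes>\<^bsub>A\<^esub> z)"
  by (simp add: A.m_assoc[symmetric] cg)

lemma cx_assoc: "z \<in> carrier A \<Longrightarrow> c \<otimes>\<^bsub>A\<^esub> (x \<otimes>\<^bsub>A\<^esub> z) = \<omega> \<odot>\<^bsub>A\<^esub> (x \<otimes>\<^bsub>A\<^esub> (c \<otimes>\<^bsub>A\<^esub> z))"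
  by (simp add: A.m_assoc[symmetric] cx smult_mult_left)

lemma c_pow_Suc: "c \<otimes>\<^bsub>A\<^esub> c [^]\<^bsub>A\<^esub> d = c [^]\<^bsub>A\<^esub> Suc d"
  using A.nat_pow_Suc2[of c d] by simp

lemma g_mon: "g \<otimes>\<^bsub>A\<^esub> \<mu> (s, a, d) = \<mu> (s, \<not> a, d)"
  by (simp add: monomial_def gg_assoc)

lemma x_mon: "x \<otimes>\<^bsub>A\<^esub> \<mu> (s, a, d) =
    (if s then \<zero>\<^bsub>A\<^esub> else if a then \<ominus>\<^bsub>A\<^esub> \<mu> (True, a, d) else \<mu> (True, a, d))"
  by (simp add: monomial_def xg_assoc xx_assoc)

lemma c_mon: "c \<otimes>\<^bsub>A\<^esub> \<mu> (s, a, d) = (if s then \<omega> \<odot>\<^bsub>A\<^esub> \<mu> (s, a, Suc d) else \<mu> (s, a, Suc d))"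
  by (simp add: monomial_def cg_assoc cx_assoc c_pow_Suc smult_mult_right del: A.nat_pow_Suc)

lemma mon_n: "\<mu> (s, a, n) = \<mu> (s, a, 0)"
  by (simp add: monomial_def cn)

text \<open>Left multiplication by a generator permutes the monomials up to scalars, so the monomials
  span every algebra that \<open>g\<close>, \<open>x\<close>, \<open>c\<close> generate.\<close>

lemma span_mon_left_closed:
  assumes z: "z \<in> span (\<mu> ` indices n)" and y: "y \<in> {g, x, c}"
  shows "y \<otimes>\<^bsub>A\<^esub> z \<in> span (\<mu> ` indices n)"
proof -
  let ?N = "span (\<mu> ` indices n)"
  have sub: "\<mu> ` indices n \<subseteq> carrier A" by auto
  interpret N: submodule K ?N A by (rule span_is_submodule[OF sub])
  have N_mon: "\<mu> (s, a, d) \<in> ?N" if "d \<le> n" for s a d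
  proof (cases "d = n")
    case True
    then show ?thesis using in_own_span[OF sub] n_pos mon_n by auto
  next
    case False
    with that have "(s, a, d) \<in> indices n" by auto
    then show ?thesis using in_own_span[OF sub] by blast
  qed
  have N_minus: "\<ominus>\<^bsub>A\<^esub> \<mu> (s, a, d) \<in> ?N" if "d \<le> n" for s a d
    using N.smult_closed[OF _ N_mon[OF that], of "\<ominus>\<^bsub>K\<^esub> \<one>\<^bsub>K\<^esub>"] by (simp add: smult_l_minus)
  have yc: "y \<in> carrier A" using y by auto
  have "submodule K {z \<in> carrier A. y \<otimes>\<^bsub>A\<^esub> z \<in> ?N} A"
    using yc by unfold_locales (auto simp: A.r_distr smult_mult_right)
  moreover have "\<mu> ` indices n \<subseteq> {z \<in> carrier A. y \<otimes>\<^bsub>A\<^esub> z \<in> ?N}"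
  proof
    fix z assume "z \<in> \<mu> ` indices n"
    then obtain s a d where "z = \<mu> (s, a, d)" "d < n" by auto
    then show "z \<in> {z \<in> carrier A. y \<otimes>\<^bsub>A\<^esub> z \<in> ?N}"
      using y by (auto simp: g_mon x_mon c_mon N_mon N_minus)
  qed
  ultimately have "?N \<subseteq> {z \<in> carrier A. y \<otimes>\<^bsub>A\<^esub> z \<in> ?N}" by (rule span_is_subset[rotated])
  then show ?thesis using z by auto
qed

lemma one_in_span_mon: "\<one>\<^bsub>A\<^esub> \<in> span (\<mu> ` indices n)"
proof -
  have sub: "\<mu> ` indices n \<subseteq> carrier A" by auto
  have "\<one>\<^bsub>A\<^esub> = \<mu> (False, False, 0)" by (simp add: monomial_def)
  also have "\<dots> \<in> \<mu> ` indices n" using n_pos by auto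
  finally show ?thesis using in_own_span[OF sub] by blast
qed

lemma c_pow_x: "c [^]\<^bsub>A\<^esub> (d::nat) \<otimes>\<^bsub>A\<^esub> x = (\<omega> [^]\<^bsub>K\<^esub> d) \<odot>\<^bsub>A\<^esub> (x \<otimes>\<^bsub>A\<^esub> c [^]\<^bsub>A\<^esub> d)"
proof (induction d)
  case (Suc d)
  have "c [^]\<^bsub>A\<^esub> Suc d \<otimes>\<^bsub>A\<^esub> x = c [^]\<^bsub>A\<^esub> d \<otimes>\<^bsub>A\<^esub> (c \<otimes>\<^bsub>A\<^esub> x)" by (simp add: A.m_assoc)
  also have "\<dots> = \<omega> \<odot>\<^bsub>A\<^esub> ((c [^]\<^bsub>A\<^esub> d \<otimes>\<^bsub>A\<^esub> x) \<otimes>\<^bsub>A\<^esub> c)" by (simp add: cx smult_mult_right A.m_assoc)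
  also have "\<dots> = (\<omega> \<otimes>\<^bsub>K\<^esub> \<omega> [^]\<^bsub>K\<^esub> d) \<odot>\<^bsub>A\<^esub> (x \<otimes>\<^bsub>A\<^esub> (c [^]\<^bsub>A\<^esub> d \<otimes>\<^bsub>A\<^esub> c))"
    by (simp add: Suc smult_mult_left smult_assoc1 A.m_assoc)
  also have "\<omega> \<otimes>\<^bsub>K\<^esub> \<omega> [^]\<^bsub>K\<^esub> d = \<omega> [^]\<^bsub>K\<^esub> Suc d" by (simp add: m_comm)
  finally show ?case by simp
qed simp

text \<open>So the left ideal generated by \<open>x\<close> has square zero: in \<open>x m x\<close> with a monomial \<open>m\<close>, the two
  factors \<open>x\<close> can be moved together, up to a scalar.\<close>

lemma x_mult_x:
  assumes span: "span (\<mu> ` indices n) = carrier A" and z: "z \<in> carrier A"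
  shows "x \<otimes>\<^bsub>A\<^esub> (z \<otimes>\<^bsub>A\<^esub> x) = \<zero>\<^bsub>A\<^esub>"
proof (rule span_induct[OF span z])
  fix b assume "b \<in> \<mu> ` indices n"
  then obtain s a d where b: "b = \<mu> (s, a, d)" by auto
  show "x \<otimes>\<^bsub>A\<^esub> (b \<otimes>\<^bsub>A\<^esub> x) = \<zero>\<^bsub>A\<^esub>"
    unfolding b by (simp add: monomial_def A.m_assoc c_pow_x smult_mult_right xg_assoc xx_assoc)
qed (auto simp: A.l_distr A.r_distr smult_mult_left smult_mult_right)

end

lemma relations_image:
  assumes A: "sweedler_relations K A g x c n \<omega>" and B: "k_algebra K B" and f: "f \<in> alg_hom K A B"
  shows "sweedler_relations K B (f g) (f x) (f c) n \<omega>"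
proof -
  interpret A: sweedler_relations K A g x c n \<omega> by fact
  interpret B: k_algebra K B by fact
  note f' = alg_homD[OF f]
  note s = f'(4)[symmetric] f'(6)[symmetric] f'(7)[symmetric] alg_hom_minus[OF A.k_algebra_self B f, symmetric]
    alg_hom_pow[OF A.k_algebra_self B f, symmetric]
    module_hom_zero[OF A.module_self B.module_self f'(1), symmetric]
  show ?thesis
    by unfold_locales (simp_all add: f'(3) A.n_pos s A.gg A.xx A.xg A.cn A.cg A.cx)
qed

text \<open>The next three lemmas are the reason why \<open>\<Delta>\<close>, \<open>\<epsilon>\<close> and \<open>S\<close> exist on \<open>H\<^bsub>4n,\<omega>\<^esub>\<close>: the values
  prescribed on the generators satisfy the relations. Here, the cross terms in the square of
  \<open>x \<otimes> 1 + g \<otimes> x\<close> are \<open>xg \<otimes> x\<close> and \<open>gx \<otimes> x\<close>, and they cancel.\<close>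

lemma (in sweedler_relations) sweedler_relations_tensor:
  "sweedler_relations K (tensor K A A) (pure_tensor K A A g g)
    (pure_tensor K A A x \<one>\<^bsub>A\<^esub> \<oplus>\<^bsub>tensor K A A\<^esub> pure_tensor K A A g x) (pure_tensor K A A c c) n \<omega>"
proof -
  interpret T: two_algebras K A A by (rule two_algebras_self)
  interpret TA: k_algebra K T.T by (rule T.k_algebra_tensor)
  have zero: "T.pt z \<zero>\<^bsub>A\<^esub> = \<zero>\<^bsub>T.T\<^esub>" if "z \<in> carrier A" for z
    by (rule module_hom_zero[OF module_self TA.module_self])
      (use T.bilinear_pt that in \<open>simp add: bilinear_def\<close>)
  have minus: "T.pt (\<ominus>\<^bsub>A\<^esub> y) z = \<ominus>\<^bsub>T.T\<^esub> T.pt y z" "T.pt y (\<ominus>\<^bsub>A\<^esub> z) = \<ominus>\<^bsub>T.T\<^esub> T.pt y z"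
    if "y \<in> carrier A" "z \<in> carrier A" for y z
    using T.pt_smult_left[OF that, of "\<ominus>\<^bsub>K\<^esub> \<one>\<^bsub>K\<^esub>"] T.pt_smult_right[OF that, of "\<ominus>\<^bsub>K\<^esub> \<one>\<^bsub>K\<^esub>"] that
    by (simp_all add: smult_l_minus TA.smult_l_minus)
  have pow: "T.pt c c [^]\<^bsub>T.T\<^esub> (d::nat) = T.pt (c [^]\<^bsub>A\<^esub> d) (c [^]\<^bsub>A\<^esub> d)" for d
    by (induction d) (simp_all add: T.one_T T.pt_mult)
  note s = T.pt_mult TA.A.l_distr TA.A.r_distr gg xx xg cg cx minus zero T.pt_zero_left
    T.pt_smult_left T.pt_smult_right TA.smult_r_distr
  show ?thesis
  proof
    show "T.pt c c [^]\<^bsub>T.T\<^esub> n = \<one>\<^bsub>T.T\<^esub>" by (simp add: pow cn T.one_T)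
    have "(T.pt x \<one>\<^bsub>A\<^esub> \<oplus>\<^bsub>T.T\<^esub> T.pt g x) \<otimes>\<^bsub>T.T\<^esub> (T.pt x \<one>\<^bsub>A\<^esub> \<oplus>\<^bsub>T.T\<^esub> T.pt g x)
        = T.pt (g \<otimes>\<^bsub>A\<^esub> x) x \<oplus>\<^bsub>T.T\<^esub> \<ominus>\<^bsub>T.T\<^esub> T.pt (g \<otimes>\<^bsub>A\<^esub> x) x"
      by (simp add: s)
    then show "(T.pt x \<one>\<^bsub>A\<^esub> \<oplus>\<^bsub>T.T\<^esub> T.pt g x) \<otimes>\<^bsub>T.T\<^esub> (T.pt x \<one>\<^bsub>A\<^esub> \<oplus>\<^bsub>T.T\<^esub> T.pt g x) = \<zero>\<^bsub>T.T\<^esub>"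
      by (simp add: TA.M.r_neg)
    show "(T.pt x \<one>\<^bsub>A\<^esub> \<oplus>\<^bsub>T.T\<^esub> T.pt g x) \<otimes>\<^bsub>T.T\<^esub> T.pt g g =
        \<ominus>\<^bsub>T.T\<^esub> (T.pt g g \<otimes>\<^bsub>T.T\<^esub> (T.pt x \<one>\<^bsub>A\<^esub> \<oplus>\<^bsub>T.T\<^esub> T.pt g x))"
      by (simp add: s TA.M.minus_add)
  qed (simp_all add: n_pos s T.one_T)
qed

lemma sweedler_relations_self:
  assumes K: "field K" and n: "n > 0" and \<omega>: "\<omega> \<in> carrier K"
  shows "sweedler_relations K (self_algebra K) \<one>\<^bsub>K\<^esub> \<zero>\<^bsub>K\<^esub> \<one>\<^bsub>K\<^esub> n \<omega>"
proof -
  interpret S: k_algebra K "self_algebra K" by (rule k_algebra_self_algebra[OF K])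
  have one: "\<one>\<^bsub>self_algebra K\<^esub> [^]\<^bsub>self_algebra K\<^esub> n = \<one>\<^bsub>self_algebra K\<^esub>"
    by (rule S.A.nat_pow_one)
  have zero: "\<zero>\<^bsub>K\<^esub> = \<ominus>\<^bsub>self_algebra K\<^esub> \<zero>\<^bsub>K\<^esub>" using S.M.add.inv_one by (simp add: a_inv_def)
  show ?thesis
    by unfold_locales (use n \<omega> one zero in auto)
qed

text \<open>The relation \<open>c x = \<omega> x c\<close> gives \<open>x c\<^sup>-\<^sup>1 = \<omega> c\<^sup>-\<^sup>1 x\<close>, which is the relation for \<open>c\<^sup>-\<^sup>1\<close> in the opposite
  algebra, with the same \<open>\<omega>\<close>.\<close>

lemma (in sweedler_relations) sweedler_relations_opposite:
  "sweedler_relations K (opposite A) g (\<ominus>\<^bsub>A\<^esub> (g \<otimes>\<^bsub>A\<^esub> x)) (c [^]\<^bsub>A\<^esub> (n - 1)) n \<omega>"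
proof -
  interpret O: k_algebra K "opposite A" by (rule k_algebra_opposite[OF k_algebra_self])
  have neg: "\<ominus>\<^bsub>opposite A\<^esub> z = \<ominus>\<^bsub>A\<^esub> z" for z by (simp add: a_inv_def)
  define m where "m = n - 1"
  have n_eq: "n = Suc m" using n_pos by (simp add: m_def)
  let ?c = "c [^]\<^bsub>A\<^esub> m"
  have c1: "c \<otimes>\<^bsub>A\<^esub> ?c = \<one>\<^bsub>A\<^esub>" "?c \<otimes>\<^bsub>A\<^esub> c = \<one>\<^bsub>A\<^esub>"
    using cn c_pow_Suc[of m] unfolding n_eq by simp_all
  have c1': "?c \<otimes>\<^bsub>A\<^esub> (c \<otimes>\<^bsub>A\<^esub> z) = z" if "z \<in> carrier A" for z
    using that c1 by (simp add: A.m_assoc[symmetric])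
  have pow: "?c [^]\<^bsub>opposite A\<^esub> (d::nat) = ?c [^]\<^bsub>A\<^esub> d" for d
    by (induction d) (simp_all add: A.nat_pow_Suc2[symmetric])
  have "?c [^]\<^bsub>A\<^esub> n = (c [^]\<^bsub>A\<^esub> n) [^]\<^bsub>A\<^esub> m" by (simp add: A.nat_pow_pow mult.commute)
  then have cn': "?c [^]\<^bsub>A\<^esub> n = \<one>\<^bsub>A\<^esub>" by (simp add: cn)
  have "c [^]\<^bsub>A\<^esub> (d::nat) \<otimes>\<^bsub>A\<^esub> g = g \<otimes>\<^bsub>A\<^esub> c [^]\<^bsub>A\<^esub> d" for d
    by (induction d) (simp_all add: A.m_assoc cg, simp add: A.m_assoc[symmetric])
  then have cg': "?c \<otimes>\<^bsub>A\<^esub> g = g \<otimes>\<^bsub>A\<^esub> ?c" by simp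
  have cg'': "?c \<otimes>\<^bsub>A\<^esub> (g \<otimes>\<^bsub>A\<^esub> z) = g \<otimes>\<^bsub>A\<^esub> (?c \<otimes>\<^bsub>A\<^esub> z)" if "z \<in> carrier A" for z
    using that cg' by (simp add: A.m_assoc[symmetric])
  have "x \<otimes>\<^bsub>A\<^esub> ?c = ?c \<otimes>\<^bsub>A\<^esub> (c \<otimes>\<^bsub>A\<^esub> (x \<otimes>\<^bsub>A\<^esub> ?c))" by (simp add: c1')
  also have "\<dots> = \<omega> \<odot>\<^bsub>A\<^esub> (?c \<otimes>\<^bsub>A\<^esub> x)" by (simp add: cx_assoc c1 smult_mult_right)
  finally have xc: "x \<otimes>\<^bsub>A\<^esub> ?c = \<omega> \<odot>\<^bsub>A\<^esub> (?c \<otimes>\<^bsub>A\<^esub> x)" .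
  show ?thesis
    unfolding m_def[symmetric]
  proof
    show "?c [^]\<^bsub>opposite A\<^esub> n = \<one>\<^bsub>opposite A\<^esub>" by (simp add: pow cn')
  qed (simp_all add: n_pos neg gg cg' cg'' xc A.l_minus A.r_minus A.m_assoc xg gg_assoc xg_assoc xx xx_assoc
      smult_r_minus smult_mult_right)
qed

section \<open>Bases with coordinate functionals\<close>

text \<open>Independence of the family \<open>v\<close> is recorded by functionals dual to it. These can be transported
  along linear maps and tensored, and slicing comultiplications with them is the main tool later.\<close>

definition coordinates ::
  "('k, 'c) ring_scheme \<Rightarrow> ('k, 'a, 'm) module_scheme \<Rightarrow> 'i set \<Rightarrow> ('i \<Rightarrow> 'a) \<Rightarrow> ('i \<Rightarrow> 'a \<Rightarrow> 'k) \<Rightarrow> bool"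
  where "coordinates K V J v \<pi> \<longleftrightarrow>
    (\<forall>u\<in>J. \<pi> u \<in> module_hom K V (self_algebra K)) \<and>
    (\<forall>u\<in>J. \<forall>w\<in>J. \<pi> w (v u) = (if u = w then \<one>\<^bsub>K\<^esub> else \<zero>\<^bsub>K\<^esub>))"

lemma coordinatesD:
  assumes "coordinates K V J v \<pi>" "w \<in> J"
  shows "\<pi> w \<in> module_hom K V (self_algebra K)"
    "\<And>u. u \<in> J \<Longrightarrow> \<pi> w (v u) = (if u = w then \<one>\<^bsub>K\<^esub> else \<zero>\<^bsub>K\<^esub>)"
    "\<And>z. z \<in> carrier V \<Longrightarrow> \<pi> w z \<in> carrier K"
    "\<And>y z. y \<in> carrier V \<Longrightarrow> z \<in> carrier V \<Longrightarrow> \<pi> w (y \<oplus>\<^bsub>V\<^esub> z) = \<pi> w y \<oplus>\<^bsub>K\<^esub> \<pi> w z"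
    "\<And>r z. r \<in> carrier K \<Longrightarrow> z \<in> carrier V \<Longrightarrow> \<pi> w (r \<odot>\<^bsub>V\<^esub> z) = r \<otimes>\<^bsub>K\<^esub> \<pi> w z"
proof -
  show h: "\<pi> w \<in> module_hom K V (self_algebra K)" using assms by (simp add: coordinates_def)
  show "\<pi> w (v u) = (if u = w then \<one>\<^bsub>K\<^esub> else \<zero>\<^bsub>K\<^esub>)" if "u \<in> J" for u
    using assms that by (simp add: coordinates_def)
  show "\<pi> w z \<in> carrier K" if "z \<in> carrier V" for z
    using module_homD(1)[OF h that] by simp
  show "\<pi> w (y \<oplus>\<^bsub>V\<^esub> z) = \<pi> w y \<oplus>\<^bsub>K\<^esub> \<pi> w z" if "y \<in> carrier V" "z \<in> carrier V" for y z
    using module_homD(2)[OF h that] by simp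
  show "\<pi> w (r \<odot>\<^bsub>V\<^esub> z) = r \<otimes>\<^bsub>K\<^esub> \<pi> w z" if "r \<in> carrier K" "z \<in> carrier V" for r z
    using module_homD(3)[OF h that] by simp
qed

locale coordinate_basis = vectorspace K V for K (structure) and V (structure) +
  fixes J :: "'i set" and v and \<pi>
  assumes finite_J: "finite J" and v_closed: "u \<in> J \<Longrightarrow> v u \<in> carrier V"
    and spanning: "span (v ` J) = carrier V"
    and coords: "coordinates K V J v \<pi>"
begin

lemmas \<pi> = coordinatesD[OF coords]

lemma v_sub: "v ` J \<subseteq> carrier V" using v_closed by auto

lemma self_module: "module K (self_algebra K)"
  using k_algebra.module_self[OF k_algebra_self_algebra] field_axioms by blast

lemma \<pi>_sum:
  assumes w: "w \<in> J" and \<kappa>: "\<kappa> \<in> J \<rightarrow> carrier K"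
  shows "\<pi> w (\<Oplus>\<^bsub>V\<^esub>u\<in>J. \<kappa> u \<odot>\<^bsub>V\<^esub> v u) = \<kappa> w"
proof -
  have "\<pi> w (\<Oplus>\<^bsub>V\<^esub>u\<in>J. \<kappa> u \<odot>\<^bsub>V\<^esub> v u) = (\<Oplus>\<^bsub>self_algebra K\<^esub>u\<in>J. \<pi> w (\<kappa> u \<odot>\<^bsub>V\<^esub> v u))"
    by (rule module_hom_finsum[OF module_axioms self_module \<pi>(1)[OF w] finite_J])
      (use \<kappa> v_closed in auto)
  also have "\<dots> = (\<Oplus>\<^bsub>K\<^esub>u\<in>J. \<pi> w (\<kappa> u \<odot>\<^bsub>V\<^esub> v u))"
    by (simp add: finsum_def finprod_def)
  also have "\<dots> = (\<Oplus>\<^bsub>K\<^esub>u\<in>J. if w = u then \<kappa> u else \<zero>\<^bsub>K\<^esub>)"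
  proof (rule R.finsum_cong')
    fix u assume u: "u \<in> J"
    then have "\<kappa> u \<in> carrier K" using \<kappa> by auto
    then show "\<pi> w (\<kappa> u \<odot>\<^bsub>V\<^esub> v u) = (if w = u then \<kappa> u else \<zero>\<^bsub>K\<^esub>)"
      using u w by (simp add: \<pi> v_closed)
  qed (use \<kappa> in auto)
  also have "\<dots> = \<kappa> w" by (rule R.finsum_singleton[OF w finite_J]) (use \<kappa> in auto)
  finally show ?thesis .
qed

lemma expansion:
  assumes z: "z \<in> carrier V" shows "z = (\<Oplus>\<^bsub>V\<^esub>u\<in>J. \<pi> u z \<odot>\<^bsub>V\<^esub> v u)"
proof -
  have *: "\<exists>\<kappa>\<in>J \<rightarrow> carrier K. z = (\<Oplus>\<^bsub>V\<^esub>u\<in>J. \<kappa> u \<odot>\<^bsub>V\<^esub> v u)"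
  proof (rule span_induct[OF spanning z _ _ _ _ v_sub])
    fix b assume "b \<in> v ` J"
    then obtain w where w: "w \<in> J" "b = v w" by auto
    have "(\<Oplus>\<^bsub>V\<^esub>u\<in>J. (if w = u then \<one>\<^bsub>K\<^esub> else \<zero>\<^bsub>K\<^esub>) \<odot>\<^bsub>V\<^esub> v u) = (\<Oplus>\<^bsub>V\<^esub>u\<in>J. if w = u then v u else \<zero>\<^bsub>V\<^esub>)"
      by (rule M.finsum_cong') (use v_closed in auto)
    also have "\<dots> = b" unfolding w(2) by (rule M.finsum_singleton[OF w(1) finite_J]) (use v_closed in auto)
    finally show "\<exists>\<kappa>\<in>J \<rightarrow> carrier K. b = (\<Oplus>\<^bsub>V\<^esub>u\<in>J. \<kappa> u \<odot>\<^bsub>V\<^esub> v u)"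
      by (intro bexI[of _ "\<lambda>u. if w = u then \<one>\<^bsub>K\<^esub> else \<zero>\<^bsub>K\<^esub>"]) auto
  next
    have "(\<Oplus>\<^bsub>V\<^esub>u\<in>J. \<zero>\<^bsub>K\<^esub> \<odot>\<^bsub>V\<^esub> v u) = (\<Oplus>\<^bsub>V\<^esub>u\<in>J. \<zero>\<^bsub>V\<^esub>)"
      by (rule M.finsum_cong') (use v_closed in auto)
    then show "\<exists>\<kappa>\<in>J \<rightarrow> carrier K. \<zero>\<^bsub>V\<^esub> = (\<Oplus>\<^bsub>V\<^esub>u\<in>J. \<kappa> u \<odot>\<^bsub>V\<^esub> v u)"
      by (intro bexI[of _ "\<lambda>u. \<zero>\<^bsub>K\<^esub>"]) (auto simp: M.finsum_zero)
  next
    fix x y assume "\<exists>\<kappa>\<in>J \<rightarrow> carrier K. x = (\<Oplus>\<^bsub>V\<^esub>u\<in>J. \<kappa> u \<odot>\<^bsub>V\<^esub> v u)"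
      "\<exists>\<kappa>\<in>J \<rightarrow> carrier K. y = (\<Oplus>\<^bsub>V\<^esub>u\<in>J. \<kappa> u \<odot>\<^bsub>V\<^esub> v u)"
    then obtain \<kappa> \<mu> where l: "\<kappa> \<in> J \<rightarrow> carrier K" "x = (\<Oplus>\<^bsub>V\<^esub>u\<in>J. \<kappa> u \<odot>\<^bsub>V\<^esub> v u)"
      and m: "\<mu> \<in> J \<rightarrow> carrier K" "y = (\<Oplus>\<^bsub>V\<^esub>u\<in>J. \<mu> u \<odot>\<^bsub>V\<^esub> v u)" by auto
    have "x \<oplus>\<^bsub>V\<^esub> y = (\<Oplus>\<^bsub>V\<^esub>u\<in>J. \<kappa> u \<odot>\<^bsub>V\<^esub> v u \<oplus>\<^bsub>V\<^esub> \<mu> u \<odot>\<^bsub>V\<^esub> v u)"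
      unfolding l m by (rule M.finsum_addf[symmetric]) (use l m v_closed in auto)
    also have "\<dots> = (\<Oplus>\<^bsub>V\<^esub>u\<in>J. (\<kappa> u \<oplus>\<^bsub>K\<^esub> \<mu> u) \<odot>\<^bsub>V\<^esub> v u)"
      by (rule M.finsum_cong') (use l m v_closed in \<open>auto simp: smult_l_distr Pi_iff\<close>)
    finally show "\<exists>\<kappa>\<in>J \<rightarrow> carrier K. x \<oplus>\<^bsub>V\<^esub> y = (\<Oplus>\<^bsub>V\<^esub>u\<in>J. \<kappa> u \<odot>\<^bsub>V\<^esub> v u)"
      by (intro bexI[of _ "\<lambda>u. \<kappa> u \<oplus>\<^bsub>K\<^esub> \<mu> u"]) (use l m in auto)
  next
    fix r x assume r: "r \<in> carrier K" and "\<exists>\<kappa>\<in>J \<rightarrow> carrier K. x = (\<Oplus>\<^bsub>V\<^esub>u\<in>J. \<kappa> u \<odot>\<^bsub>V\<^esub> v u)"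
    then obtain \<kappa> where l: "\<kappa> \<in> J \<rightarrow> carrier K" "x = (\<Oplus>\<^bsub>V\<^esub>u\<in>J. \<kappa> u \<odot>\<^bsub>V\<^esub> v u)" by auto
    have "r \<odot>\<^bsub>V\<^esub> x = (\<Oplus>\<^bsub>V\<^esub>u\<in>J. r \<odot>\<^bsub>V\<^esub> (\<kappa> u \<odot>\<^bsub>V\<^esub> v u))"
      unfolding l by (rule finsum_smult_ldistr) (use l r v_closed finite_J in auto)
    also have "\<dots> = (\<Oplus>\<^bsub>V\<^esub>u\<in>J. (r \<otimes>\<^bsub>K\<^esub> \<kappa> u) \<odot>\<^bsub>V\<^esub> v u)"
      by (rule M.finsum_cong') (use l r v_closed in \<open>auto simp: smult_assoc1 Pi_iff\<close>)
    finally show "\<exists>\<kappa>\<in>J \<rightarrow> carrier K. r \<odot>\<^bsub>V\<^esub> x = (\<Oplus>\<^bsub>V\<^esub>u\<in>J. \<kappa> u \<odot>\<^bsub>V\<^esub> v u)"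
      by (intro bexI[of _ "\<lambda>u. r \<otimes>\<^bsub>K\<^esub> \<kappa> u"]) (use l r in auto)
  qed
  then obtain \<kappa> where l: "\<kappa> \<in> J \<rightarrow> carrier K" "z = (\<Oplus>\<^bsub>V\<^esub>u\<in>J. \<kappa> u \<odot>\<^bsub>V\<^esub> v u)" by auto
  have "\<pi> u z = \<kappa> u" if "u \<in> J" for u
    unfolding l(2) by (rule \<pi>_sum[OF that l(1)])
  then have "(\<Oplus>\<^bsub>V\<^esub>u\<in>J. \<pi> u z \<odot>\<^bsub>V\<^esub> v u) = (\<Oplus>\<^bsub>V\<^esub>u\<in>J. \<kappa> u \<odot>\<^bsub>V\<^esub> v u)"
    by (intro M.finsum_cong') (use l(1) v_closed in auto)
  then show ?thesis using l(2) by simp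
qed

lemma ex_coordinate_nonzero:
  assumes z: "z \<in> carrier V" "z \<noteq> \<zero>\<^bsub>V\<^esub>" obtains u where "u \<in> J" "\<pi> u z \<noteq> \<zero>\<^bsub>K\<^esub>"
proof (rule ccontr)
  assume "\<not> thesis"
  then have "\<forall>u\<in>J. \<pi> u z = \<zero>\<^bsub>K\<^esub>" using that by auto
  then have "(\<Oplus>\<^bsub>V\<^esub>u\<in>J. \<pi> u z \<odot>\<^bsub>V\<^esub> v u) = (\<Oplus>\<^bsub>V\<^esub>u\<in>J. \<zero>\<^bsub>V\<^esub>)"
    by (intro M.finsum_cong') (use v_closed in auto)
  then show False using expansion[OF z(1)] z(2) by (simp add: M.finsum_zero)
qed

lemma v_inj: "inj_on v J"
proof (rule inj_onI)
  fix u w assume u: "u \<in> J" and w: "w \<in> J" and "v u = v w"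
  then have "\<pi> u (v u) = \<pi> u (v w)" by simp
  then have "\<one>\<^bsub>K\<^esub> = (if w = u then \<one>\<^bsub>K\<^esub> else \<zero>\<^bsub>K\<^esub>)" unfolding \<pi>(2)[OF u u] \<pi>(2)[OF u w] by simp
  then show "u = w" by (metis one_not_zero)
qed

lemma fin_dim: "fin_dim"
  unfolding fin_dim_def using finite_J v_sub spanning by (intro exI[of _ "v ` J"]) auto

lemma dim_eq: "dim = card J"
proof -
  have "lin_indpt (v ` J)"
  proof (rule finite_lin_indpt2)
    fix a assume a: "a \<in> v ` J \<rightarrow> carrier K" "lincomb a (v ` J) = \<zero>\<^bsub>V\<^esub>"
    have "lincomb a (v ` J) = (\<Oplus>\<^bsub>V\<^esub>u\<in>J. a (v u) \<odot>\<^bsub>V\<^esub> v u)"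
      unfolding lincomb_def by (rule M.finsum_reindex[OF _ v_inj, simplified]) (use a v_closed in auto)
    then have *: "(\<Oplus>\<^bsub>V\<^esub>u\<in>J. a (v u) \<odot>\<^bsub>V\<^esub> v u) = \<zero>\<^bsub>V\<^esub>" using a by simp
    have "a (v w) = \<zero>\<^bsub>K\<^esub>" if w: "w \<in> J" for w
    proof -
      have "(\<lambda>u. a (v u)) \<in> J \<rightarrow> carrier K" using a by auto
      from \<pi>_sum[OF w this] show ?thesis
        unfolding * using module_hom_zero[OF module_axioms self_module \<pi>(1)[OF w]] by simp
    qed
    then show "\<forall>x\<in>v ` J. a x = \<zero>\<^bsub>K\<^esub>" by auto
  qed (use finite_J v_sub in auto)
  then have "basis (v ` J)" using spanning v_sub by (simp add: basis_def)
  then show ?thesis using dim_basis[of "v ` J"] finite_J card_image[OF v_inj] by simp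
qed

end

lemma (in coordinate_basis) functional_zero:
  assumes \<psi>: "\<psi> \<in> module_hom K V (self_algebra K)" and z: "z \<in> carrier V"
    and zero: "\<And>u. u \<in> J \<Longrightarrow> \<pi> u z = \<zero>\<^bsub>K\<^esub> \<or> \<psi> (v u) = \<zero>\<^bsub>K\<^esub>"
  shows "\<psi> z = \<zero>\<^bsub>K\<^esub>"
proof -
  have "\<psi> z = \<psi> (\<Oplus>\<^bsub>V\<^esub>u\<in>J. \<pi> u z \<odot>\<^bsub>V\<^esub> v u)" using expansion[OF z] by simp
  also have "\<dots> = (\<Oplus>\<^bsub>self_algebra K\<^esub>u\<in>J. \<psi> (\<pi> u z \<odot>\<^bsub>V\<^esub> v u))"
    by (rule module_hom_finsum[OF module_axioms self_module \<psi> finite_J])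
      (use z \<pi>(3) v_closed in auto)
  also have "\<dots> = (\<Oplus>\<^bsub>K\<^esub>u\<in>J. \<psi> (\<pi> u z \<odot>\<^bsub>V\<^esub> v u))"
    by (simp add: finsum_def finprod_def)
  also have "\<dots> = (\<Oplus>\<^bsub>K\<^esub>u\<in>J. \<zero>\<^bsub>K\<^esub>)"
  proof (rule R.finsum_cong')
    fix u assume u: "u \<in> J"
    have c: "\<pi> u z \<in> carrier K" "\<psi> (v u) \<in> carrier K"
      using \<pi>(3)[OF u z] module_homD(1)[OF \<psi> v_closed[OF u]] by simp_all
    then show "\<psi> (\<pi> u z \<odot>\<^bsub>V\<^esub> v u) = \<zero>\<^bsub>K\<^esub>"
      using zero[OF u] module_homD(3)[OF \<psi> c(1) v_closed[OF u]] by auto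
  qed auto
  also have "\<dots> = \<zero>\<^bsub>K\<^esub>" by (simp add: R.finsum_zero)
  finally show ?thesis .
qed

text \<open>Vectors with independent images are independent.\<close>

lemma coordinates_pullback:
  assumes f: "f \<in> module_hom K V W" and \<pi>: "coordinates K W J (\<lambda>u. f (v u)) \<pi>"
  shows "coordinates K V J v (\<lambda>u z. \<pi> u (f z))"
  using \<pi> by (auto simp: coordinates_def intro: module_hom_comp[OF f])

lemma coordinates_inj:
  assumes V: "vectorspace K V" and W: "vectorspace K W" and f: "f \<in> module_hom K V W"
    and J: "finite J" "\<And>u. u \<in> J \<Longrightarrow> v u \<in> carrier V" "module.span K V (v ` J) = carrier V"
    and \<pi>: "coordinates K W J (\<lambda>u. f (v u)) \<pi>"
  shows "inj_on f (carrier V)"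
proof (rule inj_onI)
  interpret V: vectorspace K V by fact
  interpret B: coordinate_basis K V J v "\<lambda>u z. \<pi> u (f z)"
    by unfold_locales (use J coordinates_pullback[OF f \<pi>] in auto)
  fix y z assume yz: "y \<in> carrier V" "z \<in> carrier V" "f y = f z"
  then show "y = z" using B.expansion[of y] B.expansion[of z] by simp
qed

lemma surj_on_span:
  assumes V: "vectorspace K V" and W: "vectorspace K W" and f: "f \<in> module_hom K V W"
    and B: "B \<subseteq> f ` carrier V" "module.span K W B = carrier W"
  shows "f ` carrier V = carrier W"
proof -
  interpret V: vectorspace K V by fact
  interpret W: vectorspace K W by fact
  interpret f: mod_hom K V W f by unfold_locales (rule f)
  have "W.span B \<subseteq> f.im" using B f.im_is_submodule by (intro W.span_is_subset) (auto simp: f.im_def)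
  then show ?thesis using B(2) module_homD(1)[OF f] by (auto simp: f.im_def)
qed

lemma coordinates_cong:
  assumes "coordinates K V J v \<pi>" "\<And>u. u \<in> J \<Longrightarrow> v u = v' u"
  shows "coordinates K V J v' \<pi>"
  using assms by (simp add: coordinates_def)

lemma coordinates_reindex:
  assumes "coordinates K V J v \<pi>" "inj_on r J'" "r ` J' \<subseteq> J"
  shows "coordinates K V J' (\<lambda>u. v (r u)) (\<lambda>u. \<pi> (r u))"
  using assms by (auto simp: coordinates_def image_subset_iff inj_on_def)

context two_algebras begin

lemma span_tensor:
  assumes X: "module.span K A BA = carrier A" "BA \<subseteq> carrier A"
    and Y: "module.span K B BB = carrier B" "BB \<subseteq> carrier B"
  shows "module.span K T {pt a b | a b. a \<in> BA \<and> b \<in> BB} = carrier T"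
proof -
  interpret T: k_algebra K T by (rule k_algebra_tensor)
  let ?P = "{pt a b | a b. a \<in> BA \<and> b \<in> BB}"
  let ?N = "T.span ?P"
  have P: "?P \<subseteq> carrier T" using X(2) Y(2) by auto
  interpret N: submodule K ?N T by (rule T.span_is_submodule[OF P])
  have right_zero: "pt a \<zero>\<^bsub>B\<^esub> = \<zero>\<^bsub>T\<^esub>" if "a \<in> carrier A" for a
    using module_hom_zero[OF B.module_self T.module_self, of "pt a"] bilinear_pt that by (simp add: bilinear_def)
  have 1: "pt a b \<in> ?N" if a: "a \<in> BA" and b: "b \<in> carrier B" for a b
  proof (rule B.span_induct[OF Y(1) b _ _ _ _ Y(2)])
    have ac: "a \<in> carrier A" using a X(2) by auto
    show "pt a b \<in> ?N" if "b \<in> BB" for b using T.in_own_span[OF P] a that by blast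
    show "pt a \<zero>\<^bsub>B\<^esub> \<in> ?N" by (simp add: right_zero ac)
    show "pt a (b \<oplus>\<^bsub>B\<^esub> b') \<in> ?N" if "b \<in> carrier B" "b' \<in> carrier B" "pt a b \<in> ?N" "pt a b' \<in> ?N" for b b'
      using that ac by (simp add: pt_add_right)
    show "pt a (r \<odot>\<^bsub>B\<^esub> b) \<in> ?N" if "r \<in> carrier K" "b \<in> carrier B" "pt a b \<in> ?N" for r b
      using that ac by (simp add: pt_smult_right)
  qed
  have 2: "pt a b \<in> ?N" if a: "a \<in> carrier A" and b: "b \<in> carrier B" for a b
  proof (rule A.span_induct[OF X(1) a _ _ _ _ X(2)])
    show "pt a b \<in> ?N" if "a \<in> BA" for a by (rule 1[OF that b])
    show "pt \<zero>\<^bsub>A\<^esub> b \<in> ?N" by (simp add: pt_zero_left b)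
    show "pt (a \<oplus>\<^bsub>A\<^esub> a') b \<in> ?N" if "a \<in> carrier A" "a' \<in> carrier A" "pt a b \<in> ?N" "pt a' b \<in> ?N" for a a'
      using that b by (simp add: pt_add_left)
    show "pt (r \<odot>\<^bsub>A\<^esub> a) b \<in> ?N" if "r \<in> carrier K" "a \<in> carrier A" "pt a b \<in> ?N" for r a
      using that b by (simp add: pt_smult_left)
  qed
  have "carrier T \<subseteq> ?N"
  proof
    fix z assume "z \<in> carrier T"
    then show "z \<in> ?N" by (rule tensor_induct) (use 2 in auto)
  qed
  then show ?thesis using T.span_is_subset2[OF P] by auto
qed

lemma coordinates_tensor:
  assumes X: "coordinates K A I1 v1 \<pi>1" "\<And>u. u \<in> I1 \<Longrightarrow> v1 u \<in> carrier A"
    and Y: "coordinates K B I2 v2 \<pi>2" "\<And>w. w \<in> I2 \<Longrightarrow> v2 w \<in> carrier B"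
  obtains \<pi> where "coordinates K T (I1 \<times> I2) (\<lambda>(u, w). pt (v1 u) (v2 w)) \<pi>"
proof -
  have K: "field K" ..
  have self: "module K (self_algebra K)"
    by (rule k_algebra.module_self[OF k_algebra_self_algebra[OF K]])
  let ?\<beta> = "\<lambda>u w a b. \<pi>1 u a \<otimes>\<^bsub>K\<^esub> \<pi>2 w b"
  have bil: "bilinear K A B (self_algebra K) (?\<beta> u w)" if "u \<in> I1" "w \<in> I2" for u w
    using coordinatesD(3-5)[OF X(1) that(1)] coordinatesD(3-5)[OF Y(1) that(2)]
    by (intro bilinearI module_homI)
      (simp_all add: A.m_assoc A.l_distr A.r_distr A.m_lcomm)
  have "coordinates K T (I1 \<times> I2) (\<lambda>(u, w). pt (v1 u) (v2 w))
    (\<lambda>(u, w). tensor_lift K (self_algebra K) (\<lambda>(a, b). ?\<beta> u w a b))"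
    unfolding coordinates_def
  proof (intro conjI ballI)
    fix q assume q: "q \<in> I1 \<times> I2"
    obtain u w where uw: "q = (u, w)" "u \<in> I1" "w \<in> I2" using q by auto
    show "(\<lambda>(u, w). tensor_lift K (self_algebra K) (\<lambda>(a, b). ?\<beta> u w a b)) q \<in> module_hom K T (self_algebra K)"
      unfolding uw(1) prod.case by (rule tensor_lift_hom[OF self bil[OF uw(2,3)]])
    fix q' assume q': "q' \<in> I1 \<times> I2"
    obtain u' w' where uw': "q' = (u', w')" "u' \<in> I1" "w' \<in> I2" using q' by auto
    show "(\<lambda>(u, w). tensor_lift K (self_algebra K) (\<lambda>(a, b). ?\<beta> u w a b)) q
        ((\<lambda>(u, w). pt (v1 u) (v2 w)) q') = (if q' = q then \<one>\<^bsub>K\<^esub> else \<zero>\<^bsub>K\<^esub>)"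
      unfolding uw(1) uw'(1) prod.case
      using tensor_lift_pt[OF self bil[OF uw(2,3)] X(2)[OF uw'(2)] Y(2)[OF uw'(3)]]
        coordinatesD(2)[OF X(1) uw(2) uw'(2)] coordinatesD(2)[OF Y(1) uw(3) uw'(3)]
      by simp
  qed
  then show thesis by (rule that)
qed

end

section \<open>A faithful representation\<close>

definition end_algebra ::
  "('k, 'c) ring_scheme \<Rightarrow> ('k, 'v, 'm) module_scheme \<Rightarrow> ('k, 'v \<Rightarrow> 'v) module" where
  "end_algebra K V =
    \<lparr>carrier = module_hom K V V \<inter> extensional (carrier V),
     monoid.mult = compose (carrier V), monoid.one = (\<lambda>v\<in>carrier V. v),
     ring.zero = (\<lambda>v\<in>carrier V. \<zero>\<^bsub>V\<^esub>), ring.add = (\<lambda>f h. \<lambda>v\<in>carrier V. f v \<oplus>\<^bsub>V\<^esub> h v),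
     smult = (\<lambda>r f. \<lambda>v\<in>carrier V. r \<odot>\<^bsub>V\<^esub> f v)\<rparr>"

lemma end_algebra_carrier:
  "f \<in> carrier (end_algebra K V) \<longleftrightarrow> f \<in> module_hom K V V \<and> f \<in> extensional (carrier V)"
  by (simp add: end_algebra_def)

lemma end_algebra_apply:
  assumes "v \<in> carrier V"
  shows "(f \<otimes>\<^bsub>end_algebra K V\<^esub> h) v = f (h v)" "\<one>\<^bsub>end_algebra K V\<^esub> v = v"
    "\<zero>\<^bsub>end_algebra K V\<^esub> v = \<zero>\<^bsub>V\<^esub>" "(f \<oplus>\<^bsub>end_algebra K V\<^esub> h) v = f v \<oplus>\<^bsub>V\<^esub> h v"
    "(r \<odot>\<^bsub>end_algebra K V\<^esub> f) v = r \<odot>\<^bsub>V\<^esub> f v"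
  using assms by (simp_all add: end_algebra_def compose_def)

lemma end_algebra_extensional:
  "f \<otimes>\<^bsub>end_algebra K V\<^esub> h \<in> extensional (carrier V)" "\<one>\<^bsub>end_algebra K V\<^esub> \<in> extensional (carrier V)"
    "\<zero>\<^bsub>end_algebra K V\<^esub> \<in> extensional (carrier V)" "f \<oplus>\<^bsub>end_algebra K V\<^esub> h \<in> extensional (carrier V)"
    "r \<odot>\<^bsub>end_algebra K V\<^esub> f \<in> extensional (carrier V)"
  by (simp_all add: end_algebra_def compose_def)

lemma k_algebra_end_algebra:
  assumes V: "vectorspace K V" shows "k_algebra K (end_algebra K V)"
proof -
  interpret V: vectorspace K V by fact
  let ?E = "end_algebra K V"
  have ext: "f \<in> extensional (carrier V)" if "f \<in> carrier ?E" for f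
    using that by (simp add: end_algebra_carrier)
  have fhom: "f \<in> module_hom K V V" if "f \<in> carrier ?E" for f
    using that by (simp add: end_algebra_carrier)
  note fD = module_homD[OF fhom]
  have K: "field K" ..
  have eqI: "f = h" if "f \<in> extensional (carrier V)" "h \<in> extensional (carrier V)"
    "\<And>v. v \<in> carrier V \<Longrightarrow> f v = h v" for f h :: "'c \<Rightarrow> 'c"
    using that by (rule extensionalityI)
  note e = end_algebra_extensional ext
  have zero: "f \<zero>\<^bsub>V\<^esub> = \<zero>\<^bsub>V\<^esub>" if "f \<in> carrier ?E" for f
    using module_hom_zero[OF V.module_axioms V.module_axioms fhom[OF that]] .
  have "vectorspace K ?E"
  proof (rule vectorspaceI[OF K])
    fix f assume f: "f \<in> carrier ?E"
    show "\<exists>h\<in>carrier ?E. h \<oplus>\<^bsub>?E\<^esub> f = \<zero>\<^bsub>?E\<^esub>"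
    proof (rule bexI[of _ "(\<ominus>\<^bsub>K\<^esub> \<one>\<^bsub>K\<^esub>) \<odot>\<^bsub>?E\<^esub> f"])
      show "(\<ominus>\<^bsub>K\<^esub> \<one>\<^bsub>K\<^esub>) \<odot>\<^bsub>?E\<^esub> f \<oplus>\<^bsub>?E\<^esub> f = \<zero>\<^bsub>?E\<^esub>"
        by (rule eqI) (use f in \<open>simp_all add: e end_algebra_apply V.smult_l_minus V.M.l_neg fD\<close>)
      show "(\<ominus>\<^bsub>K\<^esub> \<one>\<^bsub>K\<^esub>) \<odot>\<^bsub>?E\<^esub> f \<in> carrier ?E"
        unfolding end_algebra_carrier
        by (intro conjI e module_homI) (use f in \<open>simp_all add: end_algebra_apply V.smult_r_distr fD
            V.smult_assoc1[symmetric] V.m_comm\<close>)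
    qed
  next
    fix f h assume "f \<in> carrier ?E" "h \<in> carrier ?E"
    then show "f \<oplus>\<^bsub>?E\<^esub> h \<in> carrier ?E"
      unfolding end_algebra_carrier[of "f \<oplus>\<^bsub>?E\<^esub> h"]
      by (intro conjI e module_homI) (simp_all add: end_algebra_apply V.smult_r_distr fD V.M.a_ac)
    show "f \<oplus>\<^bsub>?E\<^esub> h = h \<oplus>\<^bsub>?E\<^esub> f"
      by (rule eqI) (use \<open>f \<in> carrier ?E\<close> \<open>h \<in> carrier ?E\<close> in \<open>simp_all add: e end_algebra_apply V.M.a_comm fD\<close>)
  next
    show "\<zero>\<^bsub>?E\<^esub> \<in> carrier ?E"
      unfolding end_algebra_carrier by (intro conjI e module_homI) (simp_all add: end_algebra_apply)
  next
    fix r f assume "r \<in> carrier K" "f \<in> carrier ?E"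
    then show "r \<odot>\<^bsub>?E\<^esub> f \<in> carrier ?E"
      unfolding end_algebra_carrier[of "r \<odot>\<^bsub>?E\<^esub> f"]
      by (intro conjI e module_homI) (simp_all add: end_algebra_apply V.smult_r_distr fD
            V.smult_assoc1[symmetric] V.m_comm)
  qed (rule eqI; simp add: e end_algebra_apply fD V.M.a_assoc V.smult_l_distr V.smult_r_distr V.smult_assoc1)+
  then show ?thesis
  proof (rule k_algebraI)
    fix f h assume fh: "f \<in> carrier ?E" "h \<in> carrier ?E"
    show "f \<otimes>\<^bsub>?E\<^esub> h \<in> carrier ?E"
      unfolding end_algebra_carrier[of "f \<otimes>\<^bsub>?E\<^esub> h"]
      by (intro conjI e module_homI) (use fh in \<open>simp_all add: end_algebra_apply fD\<close>)
  next
    show "\<one>\<^bsub>?E\<^esub> \<in> carrier ?E"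
      unfolding end_algebra_carrier by (intro conjI e module_homI) (simp_all add: end_algebra_apply)
  qed (rule eqI; simp add: e end_algebra_apply fD)+
qed

text \<open>The left regular representation of \<open>H\<^bsub>4n,\<omega>\<^esub>\<close> in monomial coordinates, written down before the
  monomials are known to be independent. Applied to \<open>vac\<close>, the coordinate vector of \<open>1\<close>, a monomial
  gives the coordinate vector of itself.\<close>

locale regular_model = K: field K for K :: "('k, 'c) ring_scheme" (structure) +
  fixes n :: nat and \<omega> :: 'k
  assumes n_pos: "n > 0" and \<omega>: "\<omega> \<in> U n K"
begin

abbreviation "V \<equiv> K.func_space (indices n)"
abbreviation "B \<equiv> end_algebra K V"

definition "op_g = (\<lambda>f\<in>carrier V. \<lambda>(s, a, d)\<in>indices n. f (s, \<not> a, d))"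
definition "op_x = (\<lambda>f\<in>carrier V. \<lambda>(s, a, d)\<in>indices n.
  if s then if a then \<ominus>\<^bsub>K\<^esub> f (False, a, d) else f (False, a, d) else \<zero>\<^bsub>K\<^esub>)"
definition "op_c = (\<lambda>f\<in>carrier V. \<lambda>(s, a, d)\<in>indices n.
  if s then \<omega> \<otimes>\<^bsub>K\<^esub> f (s, a, (d + (n - Suc 0)) mod n) else f (s, a, (d + (n - Suc 0)) mod n))"
definition "vac = (\<lambda>u\<in>indices n. if u = (False, False, 0) then \<one>\<^bsub>K\<^esub> else \<zero>\<^bsub>K\<^esub>)"

lemma \<omega>_closed: "\<omega> \<in> carrier K" and \<omega>_pow: "\<omega> [^]\<^bsub>K\<^esub> n = \<one>\<^bsub>K\<^esub>"
  using \<omega> by (simp_all add: U_def)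

interpretation V: vectorspace K V
proof -
  have "field K" ..
  then show "vectorspace K V" unfolding vectorspace_def using K.func_space_is_module by blast
qed

lemma V_mem: "f \<in> carrier V \<longleftrightarrow> f \<in> extensional (indices n) \<and> (\<forall>s a. \<forall>d<n. f (s, a, d) \<in> carrier K)"
  by (auto simp: K.func_space_def PiE_def Pi_iff)

lemma V_val: "f \<in> carrier V \<Longrightarrow> d < n \<Longrightarrow> f (s, a, d) \<in> carrier K"
  by (simp add: V_mem)

lemma V_eqI:
  assumes "f \<in> carrier V" "h \<in> carrier V" "\<And>s a d. d < n \<Longrightarrow> f (s, a, d) = h (s, a, d)"
  shows "f = h"
  using assms by (intro extensionalityI[of f "indices n"]) (auto simp: V_mem)

lemma V_apply:
  assumes "d < n"
  shows "\<zero>\<^bsub>V\<^esub> (s, a, d) = \<zero>\<^bsub>K\<^esub>" "(f \<oplus>\<^bsub>V\<^esub> h) (s, a, d) = f (s, a, d) \<oplus>\<^bsub>K\<^esub> h (s, a, d)"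
    "(r \<odot>\<^bsub>V\<^esub> f) (s, a, d) = r \<otimes>\<^bsub>K\<^esub> f (s, a, d)"
  using assms by (simp_all add: K.func_space_def)

lemma op_apply:
  assumes "f \<in> carrier V" "d < n"
  shows "op_g f (s, a, d) = f (s, \<not> a, d)"
    "op_x f (s, a, d) = (if s then if a then \<ominus>\<^bsub>K\<^esub> f (False, a, d) else f (False, a, d) else \<zero>\<^bsub>K\<^esub>)"
    "op_c f (s, a, d) =
      (if s then \<omega> \<otimes>\<^bsub>K\<^esub> f (s, a, (d + (n - Suc 0)) mod n) else f (s, a, (d + (n - Suc 0)) mod n))"
  using assms by (simp_all add: op_g_def op_x_def op_c_def)

lemma op_V:
  assumes "f \<in> carrier V" shows "op_g f \<in> carrier V" "op_x f \<in> carrier V" "op_c f \<in> carrier V"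
  unfolding V_mem using assms n_pos
  by (auto simp: op_apply V_val \<omega>_closed) (auto simp: op_g_def op_x_def op_c_def)

lemma op_closed: "op_g \<in> carrier B" "op_x \<in> carrier B" "op_c \<in> carrier B"
  unfolding end_algebra_carrier
  by (intro conjI module_homI V_eqI;
      (simp add: op_V op_apply V_apply V_val n_pos \<omega>_closed K.m_ac K.r_distr K.minus_add K.r_minus)?;
      simp add: op_g_def op_x_def op_c_def)+

sublocale B: k_algebra K B
  by (rule k_algebra_end_algebra) (rule V.vectorspace_axioms)

lemma B_eqI:
  assumes "S \<in> carrier B" "T \<in> carrier B"
    "\<And>f s a d. f \<in> carrier V \<Longrightarrow> d < n \<Longrightarrow> S f (s, a, d) = T f (s, a, d)"
  shows "S = T"
proof (rule extensionalityI)
  show "S \<in> extensional (carrier V)" "T \<in> extensional (carrier V)"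
    using assms by (simp_all add: end_algebra_carrier)
  show "S f = T f" if "f \<in> carrier V" for f
    by (rule V_eqI) (use assms that in \<open>auto simp: end_algebra_carrier dest: module_homD(1)\<close>)
qed

lemma B_val: "T \<in> carrier B \<Longrightarrow> f \<in> carrier V \<Longrightarrow> T f \<in> carrier V"
  by (auto simp: end_algebra_carrier dest: module_homD(1))

lemma B_minus_apply:
  assumes "T \<in> carrier B" "f \<in> carrier V" "d < n"
  shows "(\<ominus>\<^bsub>B\<^esub> T) f (s, a, d) = \<ominus>\<^bsub>K\<^esub> T f (s, a, d)"
proof -
  have "\<ominus>\<^bsub>B\<^esub> T = (\<ominus>\<^bsub>K\<^esub> \<one>\<^bsub>K\<^esub>) \<odot>\<^bsub>B\<^esub> T" using assms by (simp add: B.smult_l_minus)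
  then show ?thesis
    using assms V_val[OF B_val] by (simp add: end_algebra_apply V_apply K.l_minus)
qed

lemma op_c_pow_apply:
  assumes "f \<in> carrier V" "d < n"
  shows "(op_c [^]\<^bsub>B\<^esub> (k::nat)) f (s, a, d) =
    (if s then \<omega> [^]\<^bsub>K\<^esub> k \<otimes>\<^bsub>K\<^esub> f (s, a, (d + k * (n - Suc 0)) mod n) else f (s, a, (d + k * (n - Suc 0)) mod n))"
  using assms
proof (induction k arbitrary: f)
  case 0
  then show ?case by (simp add: end_algebra_apply V_val)
next
  case (Suc k)
  have "((d + k * (n - Suc 0)) mod n + (n - Suc 0)) mod n = (d + Suc k * (n - Suc 0)) mod n"
    by (simp add: mod_simps ac_simps)
  then show ?case
    using Suc n_pos
    by (simp add: end_algebra_apply op_V op_apply V_val \<omega>_closed K.m_assoc)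
qed

lemma relations: "sweedler_relations K B op_g op_x op_c n \<omega>"
proof
  have shift: "(d + n * (n - Suc 0)) mod n = d" if "d < n" for d using that by simp
  show "op_c [^]\<^bsub>B\<^esub> n = \<one>\<^bsub>B\<^esub>"
    by (rule B_eqI) (simp_all add: op_closed op_c_pow_apply shift \<omega>_pow end_algebra_apply V_val)
  show "op_x \<otimes>\<^bsub>B\<^esub> op_g = \<ominus>\<^bsub>B\<^esub> (op_g \<otimes>\<^bsub>B\<^esub> op_x)"
    by (rule B_eqI) (auto simp add: op_closed end_algebra_apply op_V op_apply B_minus_apply V_val)
qed (simp_all add: op_closed \<omega>_closed n_pos,
    (rule B_eqI; auto simp add: op_closed \<omega>_closed end_algebra_apply op_V op_apply V_apply V_val n_pos K.r_minus)+)

lemma vac_closed: "vac \<in> carrier V"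
  by (auto simp: vac_def V_mem)

text \<open>The operator \<open>op_c\<close> shifts by \<open>n - 1\<close>, that is by \<open>-1\<close> modulo \<open>n\<close>, so its \<open>e\<close>-th power moves the
  support from \<open>0\<close> to \<open>e\<close>.\<close>

lemma vac_shift:
  assumes "d < n" "e < n"
  shows "vac (s, a, (d + e * (n - Suc 0)) mod n) = (if \<not> s \<and> \<not> a \<and> d = e then \<one>\<^bsub>K\<^esub> else \<zero>\<^bsub>K\<^esub>)"
proof -
  have "(d + e * (n - Suc 0)) mod n = 0 \<longleftrightarrow> d = e"
  proof -
    have "int (d + e * (n - Suc 0)) = (int d - int e) + int e * int n"
      using n_pos by (cases n) (simp_all add: algebra_simps)
    then have "int ((d + e * (n - Suc 0)) mod n) = (int d - int e) mod int n"
      by (simp only: zmod_int mod_mult_self1)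
    then have "(d + e * (n - Suc 0)) mod n = 0 \<longleftrightarrow> int n dvd (int d - int e)"
      by (metis of_nat_eq_0_iff dvd_eq_mod_eq_0)
    also have "\<dots> \<longleftrightarrow> int d mod int n = int e mod int n" by (simp add: mod_eq_dvd_iff)
    finally show ?thesis using assms by (simp add: zmod_int[symmetric])
  qed
  then show ?thesis using n_pos by (simp add: vac_def)
qed

interpretation R: sweedler_relations K B op_g op_x op_c n \<omega> by (rule relations)

lemma monomial_vac:
  assumes d: "d < n" "e < n"
  shows "R.\<mu> (t, b, e) vac (s, a, d) = (if (t, b, e) = (s, a, d) then \<one>\<^bsub>K\<^esub> else \<zero>\<^bsub>K\<^esub>)"
  using d vac_closed
  by (simp add: monomial_def end_algebra_apply op_closed op_V B_val op_apply op_c_pow_apply vac_shift)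

lemma coordinates_model:
  "coordinates K B (indices n) R.\<mu> (\<lambda>w T. T vac w)"
  unfolding coordinates_def
proof (intro conjI ballI)
  fix w assume "w \<in> indices n"
  then obtain s a d where w: "w = (s, a, d)" "d < n" by auto
  show "(\<lambda>T. T vac w) \<in> module_hom K B (self_algebra K)"
    by (rule module_homI) (use w vac_closed V_val[OF B_val] in \<open>auto simp: end_algebra_apply V_apply\<close>)
  fix u assume "u \<in> indices n"
  then obtain t b e where u: "u = (t, b, e)" "e < n" by auto
  show "R.\<mu> u vac w = (if u = w then \<one>\<^bsub>K\<^esub> else \<zero>\<^bsub>K\<^esub>)"
    unfolding w u by (rule monomial_vac[OF w(2) u(2)])
qed

end

section \<open>The Hopf algebras \<open>H\<^sub>4\<close> and \<open>H\<^bsub>4n,\<omega>\<^esub>\<close>\<close>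

context comult_algebra begin

lemma grouplike_monomial:
  assumes "grouplike K A g" "grouplike K A c"
  shows "grouplike K A (monomial A g x c (False, a, d))"
  using assms by (simp add: monomial_def grouplike_mult grouplike_pow grouplike_one grouplikeD(1))

lemma skew_primitive_monomial:
  assumes g: "grouplike K A g" and c: "grouplike K A c" and x: "skew_primitive K A \<one>\<^bsub>A\<^esub> g x"
    and gg: "g \<otimes>\<^bsub>A\<^esub> g = \<one>\<^bsub>A\<^esub>"
  shows "skew_primitive K A (monomial A g x c (False, a, d)) (monomial A g x c (False, \<not> a, d))
    (monomial A g x c (True, a, d))"
proof -
  let ?g = "if a then g else \<one>\<^bsub>A\<^esub>"
  have cl: "g \<in> carrier A" "c [^]\<^bsub>A\<^esub> d \<in> carrier A"
    using grouplikeD(1)[OF g] grouplikeD(1)[OF c] by auto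
  have "?g \<otimes>\<^bsub>A\<^esub> (g \<otimes>\<^bsub>A\<^esub> c [^]\<^bsub>A\<^esub> d) = monomial A g x c (False, \<not> a, d)"
    using cl gg by (simp add: monomial_def A.m_assoc[symmetric])
  moreover have "grouplike K A ?g" using g grouplike_one by simp
  ultimately show ?thesis
    using skew_primitive_mult(1)[OF skew_primitive_mult(2)[OF x grouplike_pow[OF c, of d]], of ?g]
    by (simp add: monomial_def)
qed

end

locale sweedler_comult = comult_algebra K A + sweedler_relations K A g x c n \<omega>
  for K :: "('k, 'c) ring_scheme" (structure) and A :: "('k, 'a, 'm) hopf_data_scheme" (structure)
    and g x c n \<omega> +
  assumes gl_g: "grouplike K A g" and gl_c: "grouplike K A c" and sk_x: "skew_primitive K A \<one>\<^bsub>A\<^esub> g x"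
    and spanning: "span (\<mu> ` indices n) = carrier A"
begin

lemma gl_mon: "grouplike K A (\<mu> (False, a, d))"
  by (rule grouplike_monomial[OF gl_g gl_c])

lemma sk_mon: "skew_primitive K A (\<mu> (False, a, d)) (\<mu> (False, \<not> a, d)) (\<mu> (True, a, d))"
  by (rule skew_primitive_monomial[OF gl_g gl_c sk_x gg])

text \<open>The antipode identities hold for \<open>g\<close>, \<open>c\<close> and \<open>x\<close>, and they are inherited by the monomials: since
  \<open>S\<close> reverses products, \<open>S(hk) hk = S(k) S(h) h k\<close> collapses from the inside.\<close>

lemma hopf_algebra_if_antipode:
  assumes S: "antipode A \<in> alg_hom K A (opposite A)"
    and Sg: "antipode A g = g" and Sx: "antipode A x = \<ominus>\<^bsub>A\<^esub> (g \<otimes>\<^bsub>A\<^esub> x)" and Sc: "antipode A c = c [^]\<^bsub>A\<^esub> (n - 1)"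
  shows "hopf_algebra K A"
proof -
  let ?S = "antipode A"
  note S' = alg_homD[OF S, simplified]
  define antipodal where "antipodal h \<longleftrightarrow> h \<in> carrier A \<and> ?S h \<otimes>\<^bsub>A\<^esub> h = \<one>\<^bsub>A\<^esub> \<and> h \<otimes>\<^bsub>A\<^esub> ?S h = \<one>\<^bsub>A\<^esub>" for h
  define skew where "skew h k y \<longleftrightarrow> h \<in> carrier A \<and> k \<in> carrier A \<and> y \<in> carrier A \<and>
    ?S y \<otimes>\<^bsub>A\<^esub> h \<oplus>\<^bsub>A\<^esub> ?S k \<otimes>\<^bsub>A\<^esub> y = \<zero>\<^bsub>A\<^esub> \<and> y \<otimes>\<^bsub>A\<^esub> ?S h \<oplus>\<^bsub>A\<^esub> k \<otimes>\<^bsub>A\<^esub> ?S y = \<zero>\<^bsub>A\<^esub>" for h k y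
  have cancel: "p \<otimes>\<^bsub>A\<^esub> (q \<otimes>\<^bsub>A\<^esub> z) = z" if "p \<otimes>\<^bsub>A\<^esub> q = \<one>\<^bsub>A\<^esub>" "p \<in> carrier A" "q \<in> carrier A" "z \<in> carrier A" for p q z
    using that by (simp add: A.m_assoc[symmetric])
  have antipodal_mult: "antipodal (h \<otimes>\<^bsub>A\<^esub> k)" if "antipodal h" "antipodal k" for h k
    using that by (simp add: antipodal_def S'(3,4) A.m_assoc cancel)
  have antipodal_one: "antipodal \<one>\<^bsub>A\<^esub>" using S'(7) by (simp add: antipodal_def)
  have antipodal_g: "antipodal g" by (simp add: antipodal_def Sg gg)
  have "c [^]\<^bsub>A\<^esub> (n - 1) \<otimes>\<^bsub>A\<^esub> c = \<one>\<^bsub>A\<^esub>" "c \<otimes>\<^bsub>A\<^esub> c [^]\<^bsub>A\<^esub> (n - 1) = \<one>\<^bsub>A\<^esub>"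
    using cn n_pos c_pow_Suc[of "n - 1"] A.nat_pow_Suc[of c "n - 1"] by simp_all
  then have antipodal_c: "antipodal c" by (simp add: antipodal_def Sc)
  have antipodal_pow: "antipodal (c [^]\<^bsub>A\<^esub> (d::nat))" for d
    by (induction d) (simp_all add: antipodal_one antipodal_mult antipodal_c)
  have skew_left: "skew (h' \<otimes>\<^bsub>A\<^esub> h) (h' \<otimes>\<^bsub>A\<^esub> k) (h' \<otimes>\<^bsub>A\<^esub> y)" if y: "skew h k y" and h': "antipodal h'" for h' h k y
  proof -
    have c: "h \<in> carrier A" "k \<in> carrier A" "y \<in> carrier A" "h' \<in> carrier A"
      using y h' by (simp_all add: skew_def antipodal_def)
    have "?S (h' \<otimes>\<^bsub>A\<^esub> y) \<otimes>\<^bsub>A\<^esub> (h' \<otimes>\<^bsub>A\<^esub> h) \<oplus>\<^bsub>A\<^esub> ?S (h' \<otimes>\<^bsub>A\<^esub> k) \<otimes>\<^bsub>A\<^esub> (h' \<otimes>\<^bsub>A\<^esub> y) = \<zero>\<^bsub>A\<^esub>"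
      using y h' c by (simp add: skew_def antipodal_def S'(3,4) A.m_assoc cancel)
    moreover have "h' \<otimes>\<^bsub>A\<^esub> y \<otimes>\<^bsub>A\<^esub> ?S (h' \<otimes>\<^bsub>A\<^esub> h) \<oplus>\<^bsub>A\<^esub> h' \<otimes>\<^bsub>A\<^esub> k \<otimes>\<^bsub>A\<^esub> ?S (h' \<otimes>\<^bsub>A\<^esub> y)
        = h' \<otimes>\<^bsub>A\<^esub> ((y \<otimes>\<^bsub>A\<^esub> ?S h \<oplus>\<^bsub>A\<^esub> k \<otimes>\<^bsub>A\<^esub> ?S y) \<otimes>\<^bsub>A\<^esub> ?S h')"
      using c by (simp add: S'(3,4) A.m_assoc A.l_distr A.r_distr)
    ultimately show ?thesis using y c S'(3) by (simp add: skew_def)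
  qed
  have skew_right: "skew (h \<otimes>\<^bsub>A\<^esub> h') (k \<otimes>\<^bsub>A\<^esub> h') (y \<otimes>\<^bsub>A\<^esub> h')" if y: "skew h k y" and h': "antipodal h'" for h' h k y
  proof -
    have c: "h \<in> carrier A" "k \<in> carrier A" "y \<in> carrier A" "h' \<in> carrier A"
      using y h' by (simp_all add: skew_def antipodal_def)
    have "(y \<otimes>\<^bsub>A\<^esub> h') \<otimes>\<^bsub>A\<^esub> ?S (h \<otimes>\<^bsub>A\<^esub> h') \<oplus>\<^bsub>A\<^esub> (k \<otimes>\<^bsub>A\<^esub> h') \<otimes>\<^bsub>A\<^esub> ?S (y \<otimes>\<^bsub>A\<^esub> h') = \<zero>\<^bsub>A\<^esub>"
      using y h' c by (simp add: skew_def antipodal_def S'(3,4) A.m_assoc cancel)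
    moreover have "?S (y \<otimes>\<^bsub>A\<^esub> h') \<otimes>\<^bsub>A\<^esub> (h \<otimes>\<^bsub>A\<^esub> h') \<oplus>\<^bsub>A\<^esub> ?S (k \<otimes>\<^bsub>A\<^esub> h') \<otimes>\<^bsub>A\<^esub> (y \<otimes>\<^bsub>A\<^esub> h')
        = ?S h' \<otimes>\<^bsub>A\<^esub> ((?S y \<otimes>\<^bsub>A\<^esub> h \<oplus>\<^bsub>A\<^esub> ?S k \<otimes>\<^bsub>A\<^esub> y) \<otimes>\<^bsub>A\<^esub> h')"
      using c by (simp add: S'(3,4) A.m_assoc A.l_distr A.r_distr)
    ultimately show ?thesis using y c S'(3) by (simp add: skew_def)
  qed
  have skew_x: "skew \<one>\<^bsub>A\<^esub> g x"
    using S'(7) by (simp add: skew_def Sx Sg M.l_neg M.r_neg A.r_minus gg_assoc)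
  have antipodal_mon: "antipodal (\<mu> (False, a, d))" for a d
    using antipodal_pow[of d] antipodal_mult[OF antipodal_g antipodal_pow[of d]] by (simp add: monomial_def)
  have skew_mon: "skew (\<mu> (False, a, d)) (\<mu> (False, \<not> a, d)) (\<mu> (True, a, d))" for a d
  proof -
    have "skew (c [^]\<^bsub>A\<^esub> d) (g \<otimes>\<^bsub>A\<^esub> c [^]\<^bsub>A\<^esub> d) (x \<otimes>\<^bsub>A\<^esub> c [^]\<^bsub>A\<^esub> d)"
      using skew_right[OF skew_x antipodal_pow[of d]] by simp
    with skew_left[OF this antipodal_g] show ?thesis by (simp add: monomial_def gg_assoc)
  qed
  have S_hom: "?S \<in> module_hom K A A"
    using S'(1) by (simp add: module_hom_def)
  show ?thesis
  proof (rule hopf_algebraI[OF S_hom spanning])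
    fix b assume "b \<in> \<mu> ` indices n"
    then obtain s a d where b: "b = \<mu> (s, a, d)" by auto
    show "(grouplike K A b \<and> ?S b \<otimes>\<^bsub>A\<^esub> b = \<one>\<^bsub>A\<^esub> \<and> b \<otimes>\<^bsub>A\<^esub> ?S b = \<one>\<^bsub>A\<^esub>) \<or>
      (\<exists>h k. skew_primitive K A h k b \<and> ?S b \<otimes>\<^bsub>A\<^esub> h \<oplus>\<^bsub>A\<^esub> ?S k \<otimes>\<^bsub>A\<^esub> b = \<zero>\<^bsub>A\<^esub> \<and>
        b \<otimes>\<^bsub>A\<^esub> ?S h \<oplus>\<^bsub>A\<^esub> k \<otimes>\<^bsub>A\<^esub> ?S b = \<zero>\<^bsub>A\<^esub>)"
    proof (cases s)
      case False
      with b have b': "b = \<mu> (False, a, d)" by simp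
      show ?thesis using gl_mon[of a d] antipodal_mon[of a d] unfolding b' antipodal_def by blast
    next
      case True
      with b have b': "b = \<mu> (True, a, d)" by simp
      show ?thesis using sk_mon[of a d] skew_mon[of a d] unfolding b' skew_def by blast
    qed
  qed
qed

end

locale sweedler_hopf = hopf_algebra K A + sweedler_comult K A g x c n \<omega>
  for K :: "('k, 'c) ring_scheme" (structure) and A :: "('k, 'a, 'm) hopf_data_scheme" (structure)
    and g x c n \<omega>

lemma alg_hom_monomial:
  assumes A: "k_algebra K A" and B: "k_algebra K B" and f: "f \<in> alg_hom K A B"
    and cl: "g \<in> carrier A" "x \<in> carrier A" "c \<in> carrier A"
  shows "f (monomial A g x c u) = monomial B (f g) (f x) (f c) u"
proof -
  interpret A: k_algebra K A by fact
  interpret B: k_algebra K B by fact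
  note f' = alg_homD[OF f]
  show ?thesis
    using cl by (cases u) (simp add: monomial_def f' alg_hom_pow[OF A B f])
qed

lemma monomial_cong:
  assumes "monoid.mult B = monoid.mult A" "monoid.one B = monoid.one A"
  shows "monomial B = monomial A"
  unfolding monomial_def nat_pow_cong[OF assms] assms ..

text \<open>One argument for \<open>H\<^sub>4\<close> and \<open>H\<^bsub>4n,\<omega>\<^esub>\<close>. If \<open>c\<close> is not a generator, it stands for \<open>1\<close>, so that the
  prescribed values for \<open>c\<close> are correct in both cases. The hypotheses \<open>respects\<close> make \<open>\<Delta>\<close>, \<open>\<epsilon>\<close>, \<open>S\<close>
  well defined, and the monomials span because the generators permute them up to scalars.\<close>

lemma presented_sweedler_hopf:
  fixes K :: "('k, 'c) ring_scheme" and gens :: "gen set"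
    and R :: "((gen list \<Rightarrow> 'k) \<times> (gen list \<Rightarrow> 'k)) set"
  defines "Q \<equiv> presented_algebra K gens R"
  defines "g \<equiv> presented_gen K gens R Gen_g" and "x \<equiv> presented_gen K gens R Gen_x"
  assumes pres: "presentation K gens R"
    and gens: "Gen_g \<in> gens" "Gen_x \<in> gens"
    and rel: "sweedler_relations K Q g x c n \<omega>"
    and c: "Gen_c \<in> gens \<and> c = presented_gen K gens R Gen_c \<or> Gen_c \<notin> gens \<and> c = \<one>\<^bsub>Q\<^esub> \<and> n = 1"
    and cm: "cm = case_gen (pure_tensor K Q Q g g)
      (pure_tensor K Q Q x \<one>\<^bsub>Q\<^esub> \<oplus>\<^bsub>tensor K Q Q\<^esub> pure_tensor K Q Q g x) (pure_tensor K Q Q c c)"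
    and cu: "cu = case_gen \<one>\<^bsub>K\<^esub> \<zero>\<^bsub>K\<^esub> \<one>\<^bsub>K\<^esub>"
    and an: "an = case_gen g (\<ominus>\<^bsub>Q\<^esub> (g \<otimes>\<^bsub>Q\<^esub> x)) (c [^]\<^bsub>Q\<^esub> (n - 1))"
    and respects:
      "\<And>l r. (l, r) \<in> R \<Longrightarrow> free_ext K (tensor K Q Q) cm l = free_ext K (tensor K Q Q) cm r"
      "\<And>l r. (l, r) \<in> R \<Longrightarrow> free_ext K (self_algebra K) cu l = free_ext K (self_algebra K) cu r"
      "\<And>l r. (l, r) \<in> R \<Longrightarrow> free_ext K (opposite Q) an l = free_ext K (opposite Q) an r"
  shows "sweedler_hopf K (presented_hopf K gens R cm cu an) g x c n \<omega>"
proof -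
  interpret P: presentation K gens R by fact
  interpret Q: sweedler_relations K Q g x c n \<omega> by fact
  let ?H = "presented_hopf K gens R cm cu an"
  note simps = presented_hopf_simps[of K gens R cm cu an, folded Q_def]
  have H: "k_algebra K ?H" by (rule k_algebra_cong[OF Q.k_algebra_self]) (simp_all add: simps)
  interpret H: k_algebra K ?H by fact
  interpret T: two_algebras K Q Q by (rule Q.two_algebras_self)
  interpret TA: k_algebra K T.T by (rule T.k_algebra_tensor)
  interpret KK: k_algebra K "self_algebra K" by (rule k_algebra_self_algebra) (rule P.K.field_axioms)
  interpret O: k_algebra K "opposite Q" by (rule k_algebra_opposite[OF Q.k_algebra_self])
  interpret TR: sweedler_relations K T.T "T.pt g g" "T.pt x \<one>\<^bsub>Q\<^esub> \<oplus>\<^bsub>T.T\<^esub> T.pt g x" "T.pt c c" n \<omega>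
    by (rule Q.sweedler_relations_tensor)
  have T_eq: "tensor K ?H ?H = T.T" "pure_tensor K ?H ?H = T.pt"
    by (rule tensor_cong; simp add: simps)+
  have minus_eq: "\<ominus>\<^bsub>?H\<^esub> z = \<ominus>\<^bsub>Q\<^esub> z" for z by (rule a_inv_cong) (simp_all add: simps)
  have pow_eq: "z [^]\<^bsub>?H\<^esub> (m::nat) = z [^]\<^bsub>Q\<^esub> m" for z m by (rule nat_pow_cong) (simp_all add: simps)
  have mon_eq: "monomial ?H = monomial Q" by (rule monomial_cong) (simp_all add: simps)
  have span_eq: "module.span K ?H = module.span K Q"
    by (rule span_cong[OF Q.module_self H.module_self]) (simp_all add: simps)
  have gens_cases: "s = Gen_g \<or> s = Gen_x \<or> s = Gen_c" for s by (cases s) auto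
  have cm_closed: "cm \<in> gens \<rightarrow> carrier T.T" unfolding cm by (auto split: gen.split)
  have cu_closed: "cu \<in> gens \<rightarrow> carrier (self_algebra K)" unfolding cu by (auto split: gen.split)
  have an_closed: "an \<in> gens \<rightarrow> carrier (opposite Q)" unfolding an by (auto split: gen.split)
  note \<Delta> = P.presented_lift[OF TA.k_algebra_self cm_closed respects(1), folded Q_def]
  note \<epsilon> = P.presented_lift[OF KK.k_algebra_self cu_closed respects(2), folded Q_def]
  note S = P.presented_lift[OF O.k_algebra_self an_closed respects(3), folded Q_def]
  have \<Delta>_hom: "comult ?H \<in> alg_hom K ?H (tensor K ?H ?H)"
    using \<Delta>(1) unfolding T_eq simps by (subst alg_hom_cong[of ?H Q T.T T.T]) (simp_all add: simps)
  have \<epsilon>_hom: "counit ?H \<in> alg_hom K ?H (self_algebra K)"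
    using \<epsilon>(1) unfolding simps by (subst alg_hom_cong[of ?H Q]) (simp_all add: simps)
  have S_hom: "antipode ?H \<in> alg_hom K ?H (opposite ?H)"
    using S(1) unfolding simps by (subst alg_hom_cong[of ?H Q _ "opposite Q"]) (simp_all add: simps)
  interpret H: comult_algebra K ?H by unfold_locales (rule \<Delta>_hom \<epsilon>_hom)+
  have H_rel: "sweedler_relations K ?H g x c n \<omega>"
    by unfold_locales (use Q.gg Q.xx Q.xg Q.cn Q.cg Q.cx Q.n_pos in \<open>simp_all add: simps minus_eq pow_eq\<close>)
  interpret H: sweedler_relations K ?H g x c n \<omega> by (rule H_rel)
  have on_g: "comult ?H g = T.pt g g" "counit ?H g = \<one>\<^bsub>K\<^esub>" "antipode ?H g = g"
    using \<Delta>(2)[OF _ gens(1)] \<epsilon>(2)[OF _ gens(1)] S(2)[OF _ gens(1)]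
    unfolding simps g_def[symmetric] by (simp_all add: cm cu an)
  have on_x: "comult ?H x = T.pt x \<one>\<^bsub>Q\<^esub> \<oplus>\<^bsub>T.T\<^esub> T.pt g x" "counit ?H x = \<zero>\<^bsub>K\<^esub>"
      "antipode ?H x = \<ominus>\<^bsub>Q\<^esub> (g \<otimes>\<^bsub>Q\<^esub> x)"
    using \<Delta>(2)[OF _ gens(2)] \<epsilon>(2)[OF _ gens(2)] S(2)[OF _ gens(2)]
    unfolding simps x_def[symmetric] by (simp_all add: cm cu an)
  have on_c: "comult ?H c = T.pt c c \<and> counit ?H c = \<one>\<^bsub>K\<^esub> \<and> antipode ?H c = c [^]\<^bsub>Q\<^esub> (n - 1)"
    using c
  proof (elim disjE conjE)
    assume "Gen_c \<in> gens" "c = presented_gen K gens R Gen_c"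
    then show ?thesis
      using \<Delta>(2)[of Gen_c] \<epsilon>(2)[of Gen_c] S(2)[of Gen_c] unfolding simps by (simp add: cm cu an)
  next
    assume c1: "c = \<one>\<^bsub>Q\<^esub>" and n1: "n = 1"
    show ?thesis
      using alg_homD(7)[OF \<Delta>_hom] alg_homD(7)[OF \<epsilon>_hom] alg_homD(7)[OF S_hom]
      unfolding c1 n1 T_eq by (simp add: simps(3) T.one_T)
  qed
  have gl_g: "grouplike K ?H g" and gl_c: "grouplike K ?H c"
    using on_g on_c by (simp_all add: grouplike_def T_eq simps(1))
  then have sk_x: "skew_primitive K ?H \<one>\<^bsub>?H\<^esub> g x"
    using on_x H.grouplike_one by (simp add: skew_primitive_def T_eq simps(1,3))
  have span_Q: "Q.span (Q.\<mu> ` indices n) = carrier Q"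
    unfolding Q_def
  proof (rule P.presented_induct, unfold Q_def[symmetric])
    have "Q.\<mu> ` indices n \<subseteq> carrier Q" by auto
    then show "submodule K (Q.span (Q.\<mu> ` indices n)) Q" by (rule Q.span_is_submodule)
    show "\<one>\<^bsub>Q\<^esub> \<in> Q.span (Q.\<mu> ` indices n)" by (rule Q.one_in_span_mon)
    fix s z assume s: "s \<in> gens" and z: "z \<in> Q.span (Q.\<mu> ` indices n)"
    have "presented_gen K gens R s \<in> {g, x, c}"
      using gens_cases[of s] s c by (auto simp: g_def x_def)
    then show "presented_gen K gens R s \<otimes>\<^bsub>Q\<^esub> z \<in> Q.span (Q.\<mu> ` indices n)"
      by (rule Q.span_mon_left_closed[OF z])
  qed
  interpret H: sweedler_comult K ?H g x c n \<omega>
    by unfold_locales (use gl_g gl_c sk_x span_Q in \<open>simp_all add: mon_eq span_eq simps(1)\<close>)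
  have "hopf_algebra K ?H"
    by (rule H.hopf_algebra_if_antipode[OF S_hom])
      (use on_g on_x on_c in \<open>simp_all add: minus_eq pow_eq simps(2)\<close>)
  then show ?thesis
    by (intro sweedler_hopf.intro H.sweedler_comult_axioms)
qed

abbreviation "H4_gen K \<equiv> presented_gen K {Gen_g, Gen_x} (H4_rels K)"
abbreviation "H4n_gen K n \<omega> \<equiv> presented_gen K {Gen_g, Gen_x, Gen_c} (H4n_rels K n \<omega>)"

lemma k_algebra_free_algebra:
  assumes "field K" shows "k_algebra K (free_algebra K S)"
proof -
  interpret presentation K S "{}" using assms by (simp add: presentation_def presentation_axioms_def)
  show ?thesis unfolding FA_eq by (rule W.k_algebra_monoid_algebra)
qed

lemma letter_in_free_algebra:
  assumes "field K" "s \<in> S" shows "basis_elt K [s] \<in> carrier (free_algebra K S)"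
proof -
  interpret presentation K S "{}" using assms by (simp add: presentation_def presentation_axioms_def)
  show ?thesis by (rule letter_closed[OF assms(2)])
qed

lemma H4_presentation:
  assumes K: "field K" shows "presentation K {Gen_g, Gen_x} (H4_rels K)"
proof -
  interpret k_algebra K "free_algebra K {Gen_g, Gen_x}" by (rule k_algebra_free_algebra[OF K])
  show ?thesis
    using letter_in_free_algebra[OF K, of _ "{Gen_g, Gen_x}"] K
    by (auto simp: presentation_def presentation_axioms_def H4_rels_def Let_def)
qed

lemma H4n_presentation:
  assumes K: "field K" and "\<omega> \<in> carrier K"
  shows "presentation K {Gen_g, Gen_x, Gen_c} (H4n_rels K n \<omega>)"
proof -
  interpret k_algebra K "free_algebra K {Gen_g, Gen_x, Gen_c}" by (rule k_algebra_free_algebra[OF K])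
  show ?thesis
    using letter_in_free_algebra[OF K, of _ "{Gen_g, Gen_x, Gen_c}"] assms
    by (auto simp: presentation_def presentation_axioms_def H4n_rels_def Let_def)
qed

lemma H4_respects:
  assumes B: "sweedler_relations K B g x c n \<omega>" and v: "v Gen_g = g" "v Gen_x = x"
    and lr: "(l, r) \<in> H4_rels K"
  shows "free_ext K B v l = free_ext K B v r"
proof -
  interpret B: sweedler_relations K B g x c n \<omega> by fact
  have K: "field K" ..
  interpret P: presentation K "{Gen_g, Gen_x}" "H4_rels K" by (rule H4_presentation[OF K])
  let ?F = "free_algebra K {Gen_g, Gen_x}" and ?f = "free_ext K B v"
  have F: "k_algebra K ?F" by (rule k_algebra_free_algebra[OF K])
  interpret F: k_algebra K ?F by (rule F)
  have vc: "v \<in> {Gen_g, Gen_x} \<rightarrow> carrier B" using v by auto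
  have f: "?f \<in> alg_hom K ?F B" by (rule P.free_ext_alg_hom[OF B.k_algebra_self vc])
  note e = P.letter_closed P.free_ext_letter[OF B.k_algebra_self vc]
  note f' = alg_homD[OF f] alg_hom_pow[OF F B.k_algebra_self f] alg_hom_minus[OF F B.k_algebra_self f]
    module_hom_zero[OF F.module_self B.module_self alg_homD(1)[OF f]]
  show ?thesis
    using lr by (auto simp: H4_rels_def Let_def f' e v pow_two[OF B.k_algebra_self] B.gg B.xx B.xg)
qed

lemma H4n_respects:
  assumes B: "sweedler_relations K B g x c n \<omega>" and v: "v Gen_g = g" "v Gen_x = x" "v Gen_c = c"
    and lr: "(l, r) \<in> H4n_rels K n \<omega>"
  shows "free_ext K B v l = free_ext K B v r"
proof -
  interpret B: sweedler_relations K B g x c n \<omega> by fact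
  have K: "field K" ..
  interpret P: presentation K "{Gen_g, Gen_x, Gen_c}" "H4n_rels K n \<omega>"
    by (rule H4n_presentation[OF K B.closed(4)])
  let ?F = "free_algebra K {Gen_g, Gen_x, Gen_c}" and ?f = "free_ext K B v"
  have F: "k_algebra K ?F" by (rule k_algebra_free_algebra[OF K])
  interpret F: k_algebra K ?F by (rule F)
  have vc: "v \<in> {Gen_g, Gen_x, Gen_c} \<rightarrow> carrier B" using v by auto
  have f: "?f \<in> alg_hom K ?F B" by (rule P.free_ext_alg_hom[OF B.k_algebra_self vc])
  note e = P.letter_closed P.free_ext_letter[OF B.k_algebra_self vc]
  note f' = alg_homD[OF f] alg_hom_pow[OF F B.k_algebra_self f] alg_hom_minus[OF F B.k_algebra_self f]
    module_hom_zero[OF F.module_self B.module_self alg_homD(1)[OF f]]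
  show ?thesis
    using lr by (auto simp: H4n_rels_def Let_def f' e v pow_two[OF B.k_algebra_self]
        B.gg B.xx B.xg B.cn B.cg B.cx)
qed

lemma H4_relations:
  assumes K: "field K"
  shows "sweedler_relations K (presented_algebra K {Gen_g, Gen_x} (H4_rels K))
    (H4_gen K Gen_g) (H4_gen K Gen_x) \<one>\<^bsub>presented_algebra K {Gen_g, Gen_x} (H4_rels K)\<^esub> 1 \<one>\<^bsub>K\<^esub>"
proof -
  interpret P: presentation K "{Gen_g, Gen_x}" "H4_rels K" by (rule H4_presentation[OF K])
  interpret Q: k_algebra K P.Q by (rule P.k_algebra_Q)
  have F: "k_algebra K P.FA" by (rule k_algebra_free_algebra[OF K])
  interpret F: k_algebra K P.FA by (rule F)
  obtain p where p: "p \<in> alg_hom K P.FA P.Q" "\<And>s. p (basis_elt K [s]) = H4_gen K s"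
    "\<And>l r. (l, r) \<in> H4_rels K \<Longrightarrow> p l = p r"
    using P.proj_relation by blast
  note p' = alg_homD[OF p(1)] alg_hom_pow[OF F Q.k_algebra_self p(1)]
    alg_hom_minus[OF F Q.k_algebra_self p(1)] module_hom_zero[OF F.module_self Q.module_self alg_homD(1)[OF p(1)]]
  note s = p'(2-) p(2) P.letter_closed pow_two[OF Q.k_algebra_self] P.gen_closed
  have rel: "p (basis_elt K [Gen_g] [^]\<^bsub>P.FA\<^esub> (2::nat)) = p \<one>\<^bsub>P.FA\<^esub>"
    "p (basis_elt K [Gen_x] [^]\<^bsub>P.FA\<^esub> (2::nat)) = p \<zero>\<^bsub>P.FA\<^esub>"
    "p (basis_elt K [Gen_x] \<otimes>\<^bsub>P.FA\<^esub> basis_elt K [Gen_g]) =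
      p (\<ominus>\<^bsub>P.FA\<^esub> (basis_elt K [Gen_g] \<otimes>\<^bsub>P.FA\<^esub> basis_elt K [Gen_x]))"
    by (rule p(3); simp add: H4_rels_def Let_def)+
  show ?thesis
    by unfold_locales (use rel in \<open>simp_all add: s\<close>)
qed

lemma H4n_relations:
  assumes K: "field K" and n: "n > 0" and \<omega>: "\<omega> \<in> carrier K"
  shows "sweedler_relations K (presented_algebra K {Gen_g, Gen_x, Gen_c} (H4n_rels K n \<omega>))
    (H4n_gen K n \<omega> Gen_g) (H4n_gen K n \<omega> Gen_x) (H4n_gen K n \<omega> Gen_c) n \<omega>"
proof -
  interpret P: presentation K "{Gen_g, Gen_x, Gen_c}" "H4n_rels K n \<omega>" by (rule H4n_presentation[OF K \<omega>])
  interpret Q: k_algebra K P.Q by (rule P.k_algebra_Q)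
  have F: "k_algebra K P.FA" by (rule k_algebra_free_algebra[OF K])
  interpret F: k_algebra K P.FA by (rule F)
  obtain p where p: "p \<in> alg_hom K P.FA P.Q" "\<And>s. p (basis_elt K [s]) = H4n_gen K n \<omega> s"
    "\<And>l r. (l, r) \<in> H4n_rels K n \<omega> \<Longrightarrow> p l = p r"
    using P.proj_relation by blast
  note p' = alg_homD[OF p(1)] alg_hom_pow[OF F Q.k_algebra_self p(1)]
    alg_hom_minus[OF F Q.k_algebra_self p(1)] module_hom_zero[OF F.module_self Q.module_self alg_homD(1)[OF p(1)]]
  note s = p'(2-) p(2) P.letter_closed pow_two[OF Q.k_algebra_self] P.gen_closed
  let ?g = "basis_elt K [Gen_g]" and ?x = "basis_elt K [Gen_x]" and ?c = "basis_elt K [Gen_c]"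
  have rel: "p (?g [^]\<^bsub>P.FA\<^esub> (2::nat)) = p \<one>\<^bsub>P.FA\<^esub>" "p (?c [^]\<^bsub>P.FA\<^esub> n) = p \<one>\<^bsub>P.FA\<^esub>"
    "p (?x [^]\<^bsub>P.FA\<^esub> (2::nat)) = p \<zero>\<^bsub>P.FA\<^esub>"
    "p (?x \<otimes>\<^bsub>P.FA\<^esub> ?g) = p (\<ominus>\<^bsub>P.FA\<^esub> (?g \<otimes>\<^bsub>P.FA\<^esub> ?x))"
    "p (?c \<otimes>\<^bsub>P.FA\<^esub> ?g) = p (?g \<otimes>\<^bsub>P.FA\<^esub> ?c)"
    "p (?c \<otimes>\<^bsub>P.FA\<^esub> ?x) = p (\<omega> \<odot>\<^bsub>P.FA\<^esub> (?x \<otimes>\<^bsub>P.FA\<^esub> ?c))"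
    by (rule p(3); simp add: H4n_rels_def Let_def)+
  show ?thesis
    by unfold_locales (use rel n \<omega> in \<open>simp_all add: s\<close>)
qed

lemma H4_simps:
  "carrier (H4 K) = carrier (presented_algebra K {Gen_g, Gen_x} (H4_rels K))"
  "monoid.mult (H4 K) = monoid.mult (presented_algebra K {Gen_g, Gen_x} (H4_rels K))"
  "monoid.one (H4 K) = monoid.one (presented_algebra K {Gen_g, Gen_x} (H4_rels K))"
  "ring.zero (H4 K) = ring.zero (presented_algebra K {Gen_g, Gen_x} (H4_rels K))"
  "ring.add (H4 K) = ring.add (presented_algebra K {Gen_g, Gen_x} (H4_rels K))"
  "smult (H4 K) = smult (presented_algebra K {Gen_g, Gen_x} (H4_rels K))"
  unfolding H4_def Let_def by (simp_all add: presented_hopf_simps)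

lemma H4n_simps:
  "carrier (H4n K n \<omega>) = carrier (presented_algebra K {Gen_g, Gen_x, Gen_c} (H4n_rels K n \<omega>))"
  "monoid.mult (H4n K n \<omega>) = monoid.mult (presented_algebra K {Gen_g, Gen_x, Gen_c} (H4n_rels K n \<omega>))"
  "monoid.one (H4n K n \<omega>) = monoid.one (presented_algebra K {Gen_g, Gen_x, Gen_c} (H4n_rels K n \<omega>))"
  "ring.zero (H4n K n \<omega>) = ring.zero (presented_algebra K {Gen_g, Gen_x, Gen_c} (H4n_rels K n \<omega>))"
  "ring.add (H4n K n \<omega>) = ring.add (presented_algebra K {Gen_g, Gen_x, Gen_c} (H4n_rels K n \<omega>))"
  "smult (H4n K n \<omega>) = smult (presented_algebra K {Gen_g, Gen_x, Gen_c} (H4n_rels K n \<omega>))"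
  unfolding H4n_def Let_def by (simp_all add: presented_hopf_simps)

lemma sweedler_hopf_H4:
  assumes K: "field K"
  shows "sweedler_hopf K (H4 K) (H4_gen K Gen_g) (H4_gen K Gen_x) \<one>\<^bsub>H4 K\<^esub> 1 \<one>\<^bsub>K\<^esub>"
proof -
  let ?Q = "presented_algebra K {Gen_g, Gen_x} (H4_rels K)"
  let ?g = "H4_gen K Gen_g" and ?x = "H4_gen K Gen_x"
  interpret Q: sweedler_relations K ?Q ?g ?x "\<one>\<^bsub>?Q\<^esub>" 1 "\<one>\<^bsub>K\<^esub>" by (rule H4_relations[OF K])
  interpret T: two_algebras K ?Q ?Q by (rule Q.two_algebras_self)
  let ?cm = "case_gen (T.pt ?g ?g) (T.pt ?x \<one>\<^bsub>?Q\<^esub> \<oplus>\<^bsub>T.T\<^esub> T.pt ?g ?x) (T.pt \<one>\<^bsub>?Q\<^esub> \<one>\<^bsub>?Q\<^esub>)"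
  let ?cu = "case_gen \<one>\<^bsub>K\<^esub> \<zero>\<^bsub>K\<^esub> \<one>\<^bsub>K\<^esub>"
  let ?an = "case_gen ?g (\<ominus>\<^bsub>?Q\<^esub> (?g \<otimes>\<^bsub>?Q\<^esub> ?x)) (\<one>\<^bsub>?Q\<^esub> [^]\<^bsub>?Q\<^esub> (1 - 1 :: nat))"
  have eq: "H4 K = presented_hopf K {Gen_g, Gen_x} (H4_rels K) ?cm ?cu ?an"
    unfolding H4_def Let_def by (simp add: T.one_T)
  have "sweedler_hopf K (presented_hopf K {Gen_g, Gen_x} (H4_rels K) ?cm ?cu ?an) ?g ?x \<one>\<^bsub>?Q\<^esub> 1 \<one>\<^bsub>K\<^esub>"
    by (rule presented_sweedler_hopf[OF H4_presentation[OF K] _ _ H4_relations[OF K] _ refl refl refl])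
      (use H4_respects[OF Q.sweedler_relations_tensor] H4_respects[OF Q.sweedler_relations_opposite]
        H4_respects[OF sweedler_relations_self[OF K, of 1 "\<one>\<^bsub>K\<^esub>"]] in auto)
  then show ?thesis unfolding eq[symmetric] H4_simps(3) .
qed

lemma sweedler_hopf_H4n:
  assumes K: "field K" and n: "n > 0" and \<omega>: "\<omega> \<in> carrier K"
  shows "sweedler_hopf K (H4n K n \<omega>) (H4n_gen K n \<omega> Gen_g) (H4n_gen K n \<omega> Gen_x) (H4n_gen K n \<omega> Gen_c) n \<omega>"
proof -
  let ?Q = "presented_algebra K {Gen_g, Gen_x, Gen_c} (H4n_rels K n \<omega>)"
  let ?g = "H4n_gen K n \<omega> Gen_g" and ?x = "H4n_gen K n \<omega> Gen_x" and ?c = "H4n_gen K n \<omega> Gen_c"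
  note rel = H4n_relations[OF K n \<omega>]
  interpret Q: sweedler_relations K ?Q ?g ?x ?c n \<omega> by (rule rel)
  interpret T: two_algebras K ?Q ?Q by (rule Q.two_algebras_self)
  let ?cm = "case_gen (T.pt ?g ?g) (T.pt ?x \<one>\<^bsub>?Q\<^esub> \<oplus>\<^bsub>T.T\<^esub> T.pt ?g ?x) (T.pt ?c ?c)"
  let ?cu = "case_gen \<one>\<^bsub>K\<^esub> \<zero>\<^bsub>K\<^esub> \<one>\<^bsub>K\<^esub>"
  let ?an = "case_gen ?g (\<ominus>\<^bsub>?Q\<^esub> (?g \<otimes>\<^bsub>?Q\<^esub> ?x)) (?c [^]\<^bsub>?Q\<^esub> (n - 1))"
  have eq: "H4n K n \<omega> = presented_hopf K {Gen_g, Gen_x, Gen_c} (H4n_rels K n \<omega>) ?cm ?cu ?an"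
    unfolding H4n_def Let_def by simp
  have "sweedler_hopf K (presented_hopf K {Gen_g, Gen_x, Gen_c} (H4n_rels K n \<omega>) ?cm ?cu ?an) ?g ?x ?c n \<omega>"
    by (rule presented_sweedler_hopf[OF H4n_presentation[OF K \<omega>] _ _ rel _ refl refl refl])
      (use H4n_respects[OF Q.sweedler_relations_tensor] H4n_respects[OF Q.sweedler_relations_opposite]
        H4n_respects[OF sweedler_relations_self[OF K n \<omega>]] in auto)
  then show ?thesis unfolding eq[symmetric] .
qed

lemma H4_lift:
  assumes B: "sweedler_relations K B g x c n \<omega>"
  obtains f where "f \<in> alg_hom K (H4 K) B" "f (H4_gen K Gen_g) = g" "f (H4_gen K Gen_x) = x"
proof -
  interpret B: sweedler_relations K B g x c n \<omega> by fact
  have K: "field K" ..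
  interpret P: presentation K "{Gen_g, Gen_x}" "H4_rels K" by (rule H4_presentation[OF K])
  let ?v = "case_gen g x c"
  have v: "?v \<in> {Gen_g, Gen_x} \<rightarrow> carrier B" by auto
  note lift = P.presented_lift[OF B.k_algebra_self v H4_respects[OF B, of ?v]]
  show thesis
    by (rule that[of "\<lambda>q. the_elem (free_ext K B ?v ` q)"])
      (use lift(1) lift(2)[of Gen_g] lift(2)[of Gen_x] in
        \<open>simp_all add: alg_hom_cong[of "H4 K" "P.Q" B B, OF H4_simps(1,5,6,2,3)]\<close>)
qed

lemma H4n_lift:
  assumes B: "sweedler_relations K B g x c n \<omega>"
  obtains f where "f \<in> alg_hom K (H4n K n \<omega>) B" "f (H4n_gen K n \<omega> Gen_g) = g"
    "f (H4n_gen K n \<omega> Gen_x) = x" "f (H4n_gen K n \<omega> Gen_c) = c"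
proof -
  interpret B: sweedler_relations K B g x c n \<omega> by fact
  have K: "field K" ..
  interpret P: presentation K "{Gen_g, Gen_x, Gen_c}" "H4n_rels K n \<omega>"
    by (rule H4n_presentation[OF K B.closed(4)])
  let ?v = "case_gen g x c"
  have v: "?v \<in> {Gen_g, Gen_x, Gen_c} \<rightarrow> carrier B" by auto
  note lift = P.presented_lift[OF B.k_algebra_self v H4n_respects[OF B, of ?v]]
  show thesis
    by (rule that[of "\<lambda>q. the_elem (free_ext K B ?v ` q)"])
      (use lift(1) lift(2)[of Gen_g] lift(2)[of Gen_x] lift(2)[of Gen_c] in
        \<open>simp_all add: alg_hom_cong[of "H4n K n \<omega>" "P.Q" B B, OF H4n_simps(1,5,6,2,3)]\<close>)
qed

text \<open>The monomials are mapped to those in the regular model, which are independent.\<close>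

lemma coordinates_H4n:
  assumes K: "field K" and n: "n > 0" and \<omega>: "\<omega> \<in> U n K"
  obtains \<pi> where "coordinates K (H4n K n \<omega>) (indices n)
    (monomial (H4n K n \<omega>) (H4n_gen K n \<omega> Gen_g) (H4n_gen K n \<omega> Gen_x) (H4n_gen K n \<omega> Gen_c)) \<pi>"
proof -
  interpret M: regular_model K n \<omega>
    using K n \<omega> by (simp add: regular_model_def regular_model_axioms_def)
  obtain f where f: "f \<in> alg_hom K (H4n K n \<omega>) M.B" "f (H4n_gen K n \<omega> Gen_g) = M.op_g"
    "f (H4n_gen K n \<omega> Gen_x) = M.op_x" "f (H4n_gen K n \<omega> Gen_c) = M.op_c"
    by (rule H4n_lift[OF M.relations])
  interpret H: sweedler_hopf K "H4n K n \<omega>" "H4n_gen K n \<omega> Gen_g" "H4n_gen K n \<omega> Gen_x"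
      "H4n_gen K n \<omega> Gen_c" n \<omega>
    by (rule sweedler_hopf_H4n[OF K n M.\<omega>_closed])
  have "f (H.\<mu> u) = monomial M.B M.op_g M.op_x M.op_c u" for u
    using alg_hom_monomial[OF H.k_algebra_self M.B.k_algebra_self f(1), of "H4n_gen K n \<omega> Gen_g"
      "H4n_gen K n \<omega> Gen_x" "H4n_gen K n \<omega> Gen_c" u] f by simp
  then have "coordinates K M.B (indices n) (\<lambda>u. f (H.\<mu> u)) (\<lambda>w T. T M.vac w)"
    using M.coordinates_model by simp
  then show thesis using coordinates_pullback[OF alg_homD(1)[OF f(1)]] that by blast
qed

lemma coordinates_H4:
  assumes K: "field K"
  obtains \<pi> where "coordinates K (H4 K) (indices 1)
    (monomial (H4 K) (H4_gen K Gen_g) (H4_gen K Gen_x) \<one>\<^bsub>H4 K\<^esub>) \<pi>"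
proof -
  interpret K: field K by fact
  interpret M: regular_model K 1 "\<one>\<^bsub>K\<^esub>"
    by unfold_locales (auto simp: U_def)
  obtain f where f: "f \<in> alg_hom K (H4 K) M.B" "f (H4_gen K Gen_g) = M.op_g"
    "f (H4_gen K Gen_x) = M.op_x"
    by (rule H4_lift[OF M.relations])
  interpret H: sweedler_hopf K "H4 K" "H4_gen K Gen_g" "H4_gen K Gen_x" "\<one>\<^bsub>H4 K\<^esub>" 1 "\<one>\<^bsub>K\<^esub>"
    by (rule sweedler_hopf_H4[OF K])
  have "f (H.\<mu> u) = monomial M.B M.op_g M.op_x M.op_c u" if "u \<in> indices 1" for u
    using alg_hom_monomial[OF H.k_algebra_self M.B.k_algebra_self f(1), of "H4_gen K Gen_g"
      "H4_gen K Gen_x" "\<one>\<^bsub>H4 K\<^esub>" u] f that by (auto simp: monomial_def)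
  then have "coordinates K M.B (indices 1) (\<lambda>u. f (H.\<mu> u)) (\<lambda>w T. T M.vac w)"
    by (intro coordinates_cong[OF M.coordinates_model]) auto
  then show thesis using coordinates_pullback[OF alg_homD(1)[OF f(1)]] that by blast
qed

text \<open>The left ideal \<open>L = Ax\<close> has no complement. If \<open>L'\<close> were one and \<open>1 = l + l'\<close>, then \<open>x l = 0\<close> because
  \<open>L\<close> has square zero, so \<open>x = x l'\<close> would lie in \<open>L \<inter> L' = 0\<close>.\<close>

lemma (in sweedler_comult) not_semisimple:
  assumes x: "x \<noteq> \<zero>\<^bsub>A\<^esub>"
  shows "\<not> semisimple A"
proof
  assume ss: "semisimple A"
  define L where "L = {a \<otimes>\<^bsub>A\<^esub> x | a. a \<in> carrier A}"
  have L_mem: "a \<otimes>\<^bsub>A\<^esub> x \<in> L" if "a \<in> carrier A" for a using that by (auto simp: L_def)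
  have "left_ideal L A"
    unfolding left_ideal_def
  proof (intro conjI ballI)
    show "additive_subgroup L A"
    proof (intro additive_subgroup.intro subgroup.intro)
      show "L \<subseteq> carrier (add_monoid A)" by (auto simp: L_def)
      show "\<one>\<^bsub>add_monoid A\<^esub> \<in> L" using L_mem[of "\<zero>\<^bsub>A\<^esub>"] by simp
      show "y \<otimes>\<^bsub>add_monoid A\<^esub> z \<in> L" if yz: "y \<in> L" "z \<in> L" for y z
      proof -
        obtain a b where "y = a \<otimes>\<^bsub>A\<^esub> x" "z = b \<otimes>\<^bsub>A\<^esub> x" "a \<in> carrier A" "b \<in> carrier A"
          using yz by (auto simp: L_def)
        then show ?thesis using L_mem[of "a \<oplus>\<^bsub>A\<^esub> b"] by (simp add: A.l_distr)
      qed
      show "inv\<^bsub>add_monoid A\<^esub> y \<in> L" if y: "y \<in> L" for y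
      proof -
        obtain a where "y = a \<otimes>\<^bsub>A\<^esub> x" "a \<in> carrier A" using y by (auto simp: L_def)
        then show ?thesis using L_mem[of "\<ominus>\<^bsub>A\<^esub> a"] by (simp add: A.l_minus a_inv_def[symmetric])
      qed
    qed
    show "r \<otimes>\<^bsub>A\<^esub> y \<in> L" if ry: "r \<in> carrier A" "y \<in> L" for r y
    proof -
      obtain a where "y = a \<otimes>\<^bsub>A\<^esub> x" "a \<in> carrier A" using ry by (auto simp: L_def)
      then show ?thesis using L_mem[of "r \<otimes>\<^bsub>A\<^esub> a"] ry by (simp add: A.m_assoc)
    qed
  qed
  then obtain L' where L': "left_ideal L' A" "L \<inter> L' = {\<zero>\<^bsub>A\<^esub>}" "L <+>\<^bsub>A\<^esub> L' = carrier A"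
    using ss unfolding semisimple_def by blast
  have "\<one>\<^bsub>A\<^esub> \<in> L <+>\<^bsub>A\<^esub> L'" using L'(3) by simp
  then obtain l l' where l: "l \<in> L" "l' \<in> L'" "\<one>\<^bsub>A\<^esub> = l \<oplus>\<^bsub>A\<^esub> l'"
    by (auto simp: set_add_def set_mult_def)
  obtain a where a: "a \<in> carrier A" "l = a \<otimes>\<^bsub>A\<^esub> x" using l(1) by (auto simp: L_def)
  have l'c: "l' \<in> carrier A"
    using l(2) L'(1) by (auto simp: left_ideal_def dest: additive_subgroup.a_subset)
  have "x = x \<otimes>\<^bsub>A\<^esub> (l \<oplus>\<^bsub>A\<^esub> l')" using l(3) closed(2) A.r_one by metis
  also have "\<dots> = x \<otimes>\<^bsub>A\<^esub> l'"
    using a l'c x_mult_x[OF spanning a(1)] by (simp add: A.r_distr)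
  finally have "x \<in> L'" using L'(1) l(2) closed(2) unfolding left_ideal_def by metis
  moreover have "x \<in> L" using L_mem[of "\<one>\<^bsub>A\<^esub>"] by simp
  ultimately show False using L'(2) x by blast
qed

section \<open>Hopf algebras with a basis of group-like and skew-primitive elements\<close>

text \<open>The coalgebra structure shared by \<open>H\<^bsub>4n,\<omega>\<^esub>\<close> and by the Hopf algebras \<open>E\<close> that factorize. The index \<open>i\<close>
  stands for \<open>g\<^sup>a c\<^sup>d\<close>, and the involution \<open>\<sigma>\<close> for multiplication by \<open>g\<close>.\<close>

locale pointed_basis = hopf_algebra K A
  for K :: "('k, 'c) ring_scheme" (structure) and A :: "('k, 'a, 'm) hopf_data_scheme" (structure) +
  fixes I :: "'i set" and h y :: "'i \<Rightarrow> 'a" and \<sigma> :: "'i \<Rightarrow> 'i" and \<pi> :: "bool \<times> 'i \<Rightarrow> 'a \<Rightarrow> 'k"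
  assumes finite_I: "finite I"
    and \<sigma>: "i \<in> I \<Longrightarrow> \<sigma> i \<in> I" "i \<in> I \<Longrightarrow> \<sigma> (\<sigma> i) = i" "i \<in> I \<Longrightarrow> \<sigma> i \<noteq> i"
    and skew: "i \<in> I \<Longrightarrow> skew_primitive K A (h i) (h (\<sigma> i)) (y i)"
    and basis_span: "span ((\<lambda>(s, i). if s then y i else h i) ` (UNIV \<times> I)) = carrier A"
    and basis_coords: "coordinates K A (UNIV \<times> I) (\<lambda>(s, i). if s then y i else h i) \<pi>"
begin

abbreviation "v \<equiv> \<lambda>(s, i). if s then y i else h i"

lemma gl: "i \<in> I \<Longrightarrow> grouplike K A (h i)" by (rule skew_primitiveD(1)[OF skew])

lemma hy_closed [simp]: "i \<in> I \<Longrightarrow> h i \<in> carrier A" "i \<in> I \<Longrightarrow> y i \<in> carrier A"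
  by (rule grouplikeD(1)[OF gl], assumption) (rule skew_primitiveD(3)[OF skew])

sublocale cb: coordinate_basis K A "UNIV \<times> I" v \<pi>
proof unfold_locales
  show "finite ((UNIV :: bool set) \<times> I)" using finite_I by simp
  show "v u \<in> carrier A" if "u \<in> UNIV \<times> I" for u using that by (cases u) simp
qed (rule basis_span basis_coords)+

lemma coord_simps [simp]:
  assumes "i \<in> I" "j \<in> I"
  shows "\<pi> (True, i) (y j) = (if j = i then \<one>\<^bsub>K\<^esub> else \<zero>\<^bsub>K\<^esub>)" "\<pi> (True, i) (h j) = \<zero>\<^bsub>K\<^esub>"
    "\<pi> (False, i) (h j) = (if j = i then \<one>\<^bsub>K\<^esub> else \<zero>\<^bsub>K\<^esub>)" "\<pi> (False, i) (y j) = \<zero>\<^bsub>K\<^esub>"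
  using cb.\<pi>(2)[of "(True, i)" "(True, j)"] cb.\<pi>(2)[of "(True, i)" "(False, j)"]
    cb.\<pi>(2)[of "(False, i)" "(False, j)"] cb.\<pi>(2)[of "(False, i)" "(True, j)"] assms by auto

lemma coord_lin:
  assumes "i \<in> I"
  shows "z \<in> carrier A \<Longrightarrow> \<pi> (s, i) z \<in> carrier K"
    "w \<in> carrier A \<Longrightarrow> z \<in> carrier A \<Longrightarrow> \<pi> (s, i) (w \<oplus>\<^bsub>A\<^esub> z) = \<pi> (s, i) w \<oplus>\<^bsub>K\<^esub> \<pi> (s, i) z"
    "r \<in> carrier K \<Longrightarrow> z \<in> carrier A \<Longrightarrow> \<pi> (s, i) (r \<odot>\<^bsub>A\<^esub> z) = r \<otimes>\<^bsub>K\<^esub> \<pi> (s, i) z"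
  using cb.\<pi>(3-5)[of "(s, i)"] assms by auto

text \<open>The maps \<open>\<phi> \<otimes> id\<close> and \<open>id \<otimes> \<phi>\<close> on the tensor square.\<close>

definition "slice_left \<phi> = tensor_lift K A (\<lambda>(a, b). \<phi> a \<odot>\<^bsub>A\<^esub> b)"
definition "slice_right \<phi> = tensor_lift K A (\<lambda>(a, b). \<phi> b \<odot>\<^bsub>A\<^esub> a)"

lemma slice:
  assumes \<phi>: "\<phi> \<in> module_hom K A (self_algebra K)"
  shows "slice_left \<phi> \<in> module_hom K (tensor K A A) A" "slice_right \<phi> \<in> module_hom K (tensor K A A) A"
    "a \<in> carrier A \<Longrightarrow> b \<in> carrier A \<Longrightarrow> slice_left \<phi> (AA.pt a b) = \<phi> a \<odot>\<^bsub>A\<^esub> b"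
    "a \<in> carrier A \<Longrightarrow> b \<in> carrier A \<Longrightarrow> slice_right \<phi> (AA.pt a b) = \<phi> b \<odot>\<^bsub>A\<^esub> a"
proof -
  note \<phi>' = module_homD[OF \<phi>, simplified]
  have L: "bilinear K A A A (\<lambda>a b. \<phi> a \<odot>\<^bsub>A\<^esub> b)" and R: "bilinear K A A A (\<lambda>a b. \<phi> b \<odot>\<^bsub>A\<^esub> a)"
    by (auto intro!: bilinearI module_homI simp: \<phi>' smult_l_distr smult_r_distr smult_assoc1[symmetric] m_comm)
  show "slice_left \<phi> \<in> module_hom K (tensor K A A) A" "slice_right \<phi> \<in> module_hom K (tensor K A A) A"
    unfolding slice_left_def slice_right_def
    by (rule AA.tensor_lift_hom[OF module_self L] AA.tensor_lift_hom[OF module_self R])+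
  show "slice_left \<phi> (AA.pt a b) = \<phi> a \<odot>\<^bsub>A\<^esub> b" "slice_right \<phi> (AA.pt a b) = \<phi> b \<odot>\<^bsub>A\<^esub> a"
    if "a \<in> carrier A" "b \<in> carrier A"
    unfolding slice_left_def slice_right_def
    using AA.tensor_lift_pt[OF module_self L] AA.tensor_lift_pt[OF module_self R] that by auto
qed

lemma coord_hom: "i \<in> I \<Longrightarrow> \<pi> (s, i) \<in> module_hom K A (self_algebra K)"
  using cb.\<pi>(1)[of "(s, i)"] by auto

lemma skew_slice_left:
  assumes \<phi>: "\<phi> \<in> module_hom K A (self_algebra K)" and z: "skew_primitive K A k l z"
  shows "slice_left \<phi> (comult A z) = \<phi> z \<odot>\<^bsub>A\<^esub> k \<oplus>\<^bsub>A\<^esub> \<phi> l \<odot>\<^bsub>A\<^esub> z"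
    and "slice_right \<phi> (comult A z) = \<phi> k \<odot>\<^bsub>A\<^esub> z \<oplus>\<^bsub>A\<^esub> \<phi> z \<odot>\<^bsub>A\<^esub> l"
  using skew_primitiveD(3,5)[OF z] grouplikeD(1)[OF skew_primitiveD(1)[OF z]]
    grouplikeD(1)[OF skew_primitiveD(2)[OF z]] slice[OF \<phi>]
    module_homD[OF slice(1)[OF \<phi>]] module_homD[OF slice(2)[OF \<phi>]] by simp_all

lemma grouplike_slice:
  assumes \<phi>: "\<phi> \<in> module_hom K A (self_algebra K)" and k: "grouplike K A k"
  shows "slice_left \<phi> (comult A k) = \<phi> k \<odot>\<^bsub>A\<^esub> k" "slice_right \<phi> (comult A k) = \<phi> k \<odot>\<^bsub>A\<^esub> k"
  using grouplikeD(1,2)[OF k] slice(3,4)[OF \<phi>] by simp_all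

text \<open>Slicing \<open>\<Delta>(z)\<close> with a coordinate functional produces the basis elements in the support of \<open>z\<close>.
  Both sides are linear in \<open>z\<close>, so this is read off from \<open>\<Delta>(h i)\<close> and \<open>\<Delta>(y i)\<close>.\<close>

lemma slice_coord:
  assumes i: "i \<in> I" and z: "z \<in> carrier A"
  shows slice_left_y: "slice_left (\<pi> (True, i)) (comult A z) = \<pi> (True, i) z \<odot>\<^bsub>A\<^esub> h i"
    and slice_right_y: "slice_right (\<pi> (True, i)) (comult A z) = \<pi> (True, i) z \<odot>\<^bsub>A\<^esub> h (\<sigma> i)"
    and slice_left_h: "slice_left (\<pi> (False, i)) (comult A z) =
      \<pi> (False, i) z \<odot>\<^bsub>A\<^esub> h i \<oplus>\<^bsub>A\<^esub> \<pi> (True, \<sigma> i) z \<odot>\<^bsub>A\<^esub> y (\<sigma> i)"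
proof -
  note \<sigma>i = \<sigma>[OF i]
  note on_span = module_hom_eq_on_span[OF module_self module_self _ _ basis_span cb.v_sub _ z]
  note slice_hom = module_hom_comp[OF \<Delta>(1) slice(1)[OF coord_hom]] module_hom_comp[OF \<Delta>(1) slice(2)[OF coord_hom]]
  note vals = skew_slice_left[OF coord_hom skew] grouplike_slice[OF coord_hom gl]
  have rhs: "(\<lambda>z. \<pi> (s, j) z \<odot>\<^bsub>A\<^esub> w) \<in> module_hom K A A" if "j \<in> I" "w \<in> carrier A" for s j w
    by (rule module_homI) (use that in \<open>simp_all add: coord_lin smult_l_distr smult_assoc1\<close>)
  have \<sigma>_eq: "\<sigma> j = i \<longleftrightarrow> j = \<sigma> i" if "j \<in> I" for j using \<sigma>(2)[OF that] \<sigma>(2)[OF i] by auto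
  show "slice_left (\<pi> (True, i)) (comult A z) = \<pi> (True, i) z \<odot>\<^bsub>A\<^esub> h i"
  proof (rule on_span[OF slice_hom(1)[OF i] rhs])
    fix b assume "b \<in> v ` (UNIV \<times> I)"
    then obtain s j where b: "b = (if s then y j else h j)" and j: "j \<in> I" by auto
    then show "slice_left (\<pi> (True, i)) (comult A b) = \<pi> (True, i) b \<odot>\<^bsub>A\<^esub> h i"
      using i \<sigma>(1)[OF j] by (cases s) (auto simp: vals)
  qed (use i in auto)
  show "slice_right (\<pi> (True, i)) (comult A z) = \<pi> (True, i) z \<odot>\<^bsub>A\<^esub> h (\<sigma> i)"
  proof (rule on_span[OF slice_hom(2)[OF i] rhs])
    fix b assume "b \<in> v ` (UNIV \<times> I)"
    then obtain s j where b: "b = (if s then y j else h j)" and j: "j \<in> I" by auto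
    then show "slice_right (\<pi> (True, i)) (comult A b) = \<pi> (True, i) b \<odot>\<^bsub>A\<^esub> h (\<sigma> i)"
      using i \<sigma>i \<sigma>(1)[OF j] by (cases s) (auto simp: vals)
  qed (use i \<sigma>i in auto)
  have rhs2: "(\<lambda>z. \<pi> (False, i) z \<odot>\<^bsub>A\<^esub> h i \<oplus>\<^bsub>A\<^esub> \<pi> (True, \<sigma> i) z \<odot>\<^bsub>A\<^esub> y (\<sigma> i)) \<in> module_hom K A A"
    by (rule module_homI)
      (use i \<sigma>i in \<open>simp_all add: coord_lin smult_l_distr smult_r_distr smult_assoc1 M.a_ac\<close>)
  show "slice_left (\<pi> (False, i)) (comult A z) =
      \<pi> (False, i) z \<odot>\<^bsub>A\<^esub> h i \<oplus>\<^bsub>A\<^esub> \<pi> (True, \<sigma> i) z \<odot>\<^bsub>A\<^esub> y (\<sigma> i)"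
  proof (rule on_span[OF slice_hom(1)[OF i] rhs2])
    fix b assume "b \<in> v ` (UNIV \<times> I)"
    then obtain s j where b: "b = (if s then y j else h j)" and j: "j \<in> I" by auto
    then show "slice_left (\<pi> (False, i)) (comult A b) =
        \<pi> (False, i) b \<odot>\<^bsub>A\<^esub> h i \<oplus>\<^bsub>A\<^esub> \<pi> (True, \<sigma> i) b \<odot>\<^bsub>A\<^esub> y (\<sigma> i)"
      using i \<sigma>i \<sigma>(1)[OF j] \<sigma>_eq[OF j] by (cases s) (auto simp: vals)
  qed
qed

lemma smult_cancel:
  assumes "r \<in> carrier K" "r \<noteq> \<zero>\<^bsub>K\<^esub>" "a \<in> carrier A" "b \<in> carrier A" "r \<odot>\<^bsub>A\<^esub> a = r \<odot>\<^bsub>A\<^esub> b"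
  shows "a = b"
proof -
  have r: "r \<in> Units K" using assms field_Units by auto
  have *: "inv\<^bsub>K\<^esub> r \<odot>\<^bsub>A\<^esub> (r \<odot>\<^bsub>A\<^esub> z) = z" if "z \<in> carrier A" for z
    using that assms(1) r by (simp add: smult_assoc1[symmetric])
  show ?thesis using *[OF assms(3)] *[OF assms(4)] unfolding assms(5) by simp
qed

text \<open>Slicing \<open>\<Delta>(k) = k \<otimes> k\<close> gives \<open>\<lambda> k = \<lambda> h i\<close> for the coordinate \<open>\<lambda>\<close> in question. If it were nonzero,
  \<open>k\<close> would be \<open>h i\<close>, whose coordinate at \<open>y i\<close> is zero.\<close>

lemma grouplike_coord_y:
  assumes k: "grouplike K A k" and i: "i \<in> I" shows "\<pi> (True, i) k = \<zero>\<^bsub>K\<^esub>"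
proof (rule ccontr)
  assume ne: "\<pi> (True, i) k \<noteq> \<zero>\<^bsub>K\<^esub>"
  have kc: "k \<in> carrier A" by (rule grouplikeD(1)[OF k])
  have "\<pi> (True, i) k \<odot>\<^bsub>A\<^esub> k = \<pi> (True, i) k \<odot>\<^bsub>A\<^esub> h i"
    using slice_left_y[OF i kc] grouplike_slice(1)[OF coord_hom[OF i] k] by simp
  then have "k = h i" by (rule smult_cancel[OF coord_lin(1)[OF i kc] ne kc hy_closed(1)[OF i]])
  then show False using ne i by simp
qed

lemma skew_primitive_coord_y:
  assumes z: "skew_primitive K A (h i) k z" and i: "i \<in> I" and j: "j \<in> I" "j \<noteq> i"
  shows "\<pi> (True, j) z = \<zero>\<^bsub>K\<^esub>"
proof -
  note zc = skew_primitiveD(3)[OF z]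
  note k = skew_primitiveD(2)[OF z]
  have "\<pi> (True, j) z \<odot>\<^bsub>A\<^esub> h j = \<pi> (True, j) z \<odot>\<^bsub>A\<^esub> h i"
    using slice_left_y[OF j(1) zc] skew_slice_left(1)[OF coord_hom[OF j(1)] z] zc i j
      grouplike_coord_y[OF k j(1)] by (simp add: coord_lin)
  from arg_cong[OF this, of "\<pi> (False, j)"] show ?thesis
    using i j zc by (simp add: coord_lin split: if_splits)
qed

text \<open>Both conclusions compare the slices of \<open>\<Delta>(z)\<close> known from the basis with those given by
  \<open>\<Delta>(z) = z \<otimes> h i + k \<otimes> z\<close>. The second one says that \<open>z\<close> is a multiple of \<open>y i\<close> plus a multiple of
  \<open>h (\<sigma> i) - h i\<close>.\<close>

lemma skew_primitive_form:
  assumes z: "skew_primitive K A (h i) k z" and i: "i \<in> I" and ne: "\<pi> (True, i) z \<noteq> \<zero>\<^bsub>K\<^esub>"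
  shows "k = h (\<sigma> i)"
    and "z \<oplus>\<^bsub>A\<^esub> \<pi> (False, \<sigma> i) z \<odot>\<^bsub>A\<^esub> h i =
      \<pi> (True, i) z \<odot>\<^bsub>A\<^esub> y i \<oplus>\<^bsub>A\<^esub> \<pi> (False, \<sigma> i) z \<odot>\<^bsub>A\<^esub> h (\<sigma> i)"
proof -
  note zc = skew_primitiveD(3)[OF z]
  note k = skew_primitiveD(2)[OF z]
  note \<sigma>i = \<sigma>[OF i]
  have "\<pi> (True, i) z \<odot>\<^bsub>A\<^esub> k = \<pi> (True, i) z \<odot>\<^bsub>A\<^esub> h (\<sigma> i)"
    using slice_right_y[OF i zc] skew_slice_left(2)[OF coord_hom[OF i] z] zc i
      grouplikeD(1)[OF k] by (simp add: coord_lin)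
  then show k_eq: "k = h (\<sigma> i)"
    by (rule smult_cancel[OF coord_lin(1)[OF i zc] ne grouplikeD(1)[OF k] hy_closed(1)[OF \<sigma>i(1)]])
  show "z \<oplus>\<^bsub>A\<^esub> \<pi> (False, \<sigma> i) z \<odot>\<^bsub>A\<^esub> h i =
      \<pi> (True, i) z \<odot>\<^bsub>A\<^esub> y i \<oplus>\<^bsub>A\<^esub> \<pi> (False, \<sigma> i) z \<odot>\<^bsub>A\<^esub> h (\<sigma> i)"
    using slice_left_h[OF \<sigma>i(1) zc] skew_slice_left(1)[OF coord_hom[OF \<sigma>i(1)] z] zc i \<sigma>i
      k_eq by (simp add: coord_lin M.a_comm)
qed

lemma subcoalgebra_slice:
  assumes D: "subcoalgebra K A D" and z: "z \<in> D" and \<phi>: "\<phi> \<in> module_hom K A (self_algebra K)"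
  shows "slice_left \<phi> (comult A z) \<in> D"
proof -
  interpret T: k_algebra K "tensor K A A" by (rule AA.k_algebra_tensor)
  have sub: "submodule K D A" using D by (simp add: subcoalgebra_def)
  interpret D: submodule K D A by (rule sub)
  note L = slice[OF \<phi>] and L' = module_homD[OF slice(1)[OF \<phi>]]
  have Dc: "d \<in> D \<Longrightarrow> d \<in> carrier A" for d using D.subset by auto
  let ?P = "{AA.pt a b | a b. a \<in> D \<and> b \<in> D}"
  have "submodule K {t \<in> carrier (tensor K A A). slice_left \<phi> t \<in> D} (tensor K A A)"
    using module_hom_zero[OF T.module_self module_self L(1)]
    by unfold_locales (auto simp: L')
  moreover have "?P \<subseteq> {t \<in> carrier (tensor K A A). slice_left \<phi> t \<in> D}"
  proof
    fix t assume "t \<in> ?P"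
    then obtain a b where t: "t = AA.pt a b" "a \<in> D" "b \<in> D" by auto
    then show "t \<in> {t \<in> carrier (tensor K A A). slice_left \<phi> t \<in> D}"
      using Dc[of a] Dc[of b] module_homD(1)[OF \<phi>, of a] by (simp add: L)
  qed
  ultimately have "T.span ?P \<subseteq> {t \<in> carrier (tensor K A A). slice_left \<phi> t \<in> D}"
    by (rule T.span_is_subset[rotated])
  moreover have "comult A z \<in> T.span ?P"
    using D z by (auto simp: subcoalgebra_def)
  ultimately show ?thesis by auto
qed

text \<open>Take a nonzero element of a subcoalgebra \<open>D\<close>. If it has a coordinate at some \<open>y i\<close>, slicing at
  \<open>y i\<close> puts \<open>h i\<close> into \<open>D\<close>; otherwise it has a coordinate at some \<open>h i\<close>, and slicing there does so. The line
  spanned by \<open>h i\<close> is a subcoalgebra, so a simple \<open>D\<close> is this line.\<close>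

lemma pointed: "pointed K A"
  unfolding pointed_def
proof (intro allI impI)
  fix D assume D: "simple_subcoalgebra K A D"
  then have sub: "subcoalgebra K A D" and ne: "D \<noteq> {\<zero>\<^bsub>A\<^esub>}"
    and simple: "\<And>D'. subcoalgebra K A D' \<Longrightarrow> D' \<subseteq> D \<Longrightarrow> D' = {\<zero>\<^bsub>A\<^esub>} \<or> D' = D"
    by (auto simp: simple_subcoalgebra_def)
  have subm: "submodule K D A" using sub by (simp add: subcoalgebra_def)
  interpret D: submodule K D A by (rule subm)
  interpret T: k_algebra K "tensor K A A" by (rule AA.k_algebra_tensor)
  have cancel: "h i \<in> D" if "r \<in> carrier K" "r \<noteq> \<zero>\<^bsub>K\<^esub>" "r \<odot>\<^bsub>A\<^esub> h i \<in> D" "i \<in> I" for r i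
  proof -
    have "r \<in> Units K" using that field_Units by auto
    then have "inv\<^bsub>K\<^esub> r \<odot>\<^bsub>A\<^esub> (r \<odot>\<^bsub>A\<^esub> h i) = h i" "inv\<^bsub>K\<^esub> r \<in> carrier K"
      using that by (simp_all add: smult_assoc1[symmetric])
    then show ?thesis using D.smult_closed[of "inv\<^bsub>K\<^esub> r", OF _ that(3)] by simp
  qed
  obtain i where i: "i \<in> I" "h i \<in> D"
  proof -
    obtain z where z: "z \<in> D" "z \<noteq> \<zero>\<^bsub>A\<^esub>" using ne D.zero_closed by auto
    have zc: "z \<in> carrier A" using z D.subset by auto
    show thesis
    proof (cases "\<exists>i\<in>I. \<pi> (True, i) z \<noteq> \<zero>\<^bsub>K\<^esub>")
      case True
      then obtain i where i: "i \<in> I" "\<pi> (True, i) z \<noteq> \<zero>\<^bsub>K\<^esub>" by auto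
      have "\<pi> (True, i) z \<odot>\<^bsub>A\<^esub> h i \<in> D"
        using subcoalgebra_slice[OF sub z(1) coord_hom[OF i(1), of True]] slice_left_y[OF i(1) zc] by simp
      then show thesis using that cancel i coord_lin(1)[OF i(1) zc] by blast
    next
      case False
      obtain u where u: "u \<in> UNIV \<times> I" "\<pi> u z \<noteq> \<zero>\<^bsub>K\<^esub>" by (rule cb.ex_coordinate_nonzero[OF zc z(2)])
      then obtain i where i: "i \<in> I" "u = (False, i)"
        using False by (cases u) (metis (full_types) mem_Sigma_iff)
      have "\<pi> (False, i) z \<odot>\<^bsub>A\<^esub> h i \<in> D"
        using subcoalgebra_slice[OF sub z(1) coord_hom[OF i(1), of False]] slice_left_h[OF i(1) zc]
          False \<sigma>(1)[OF i(1)] i(1) zc by (simp add: coord_lin)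
      then show thesis using that cancel u i coord_lin(1)[OF i(1) zc] by blast
    qed
  qed
  let ?L = "{r \<odot>\<^bsub>A\<^esub> h i | r. r \<in> carrier K}"
  have L_mem: "r \<odot>\<^bsub>A\<^esub> h i \<in> ?L" if "r \<in> carrier K" for r using that by auto
  have hL: "h i \<in> ?L" using L_mem[OF R.one_closed] i by simp
  have L_sub: "submodule K ?L A"
  proof (unfold_locales)
    show "?L \<subseteq> carrier A" using i by auto
    show "w \<oplus>\<^bsub>A\<^esub> z \<in> ?L" if wz: "w \<in> ?L" "z \<in> ?L" for w z
    proof -
      obtain r s where "r \<in> carrier K" "w = r \<odot>\<^bsub>A\<^esub> h i" "s \<in> carrier K" "z = s \<odot>\<^bsub>A\<^esub> h i" using wz by auto
      then show ?thesis using L_mem[of "r \<oplus>\<^bsub>K\<^esub> s"] i by (simp add: smult_l_distr)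
    qed
    show "\<zero>\<^bsub>A\<^esub> \<in> ?L" using L_mem[OF R.zero_closed] i by simp
    show "r \<odot>\<^bsub>A\<^esub> z \<in> ?L" if rz: "r \<in> carrier K" "z \<in> ?L" for r z
    proof -
      obtain s where "s \<in> carrier K" "z = s \<odot>\<^bsub>A\<^esub> h i" using rz by auto
      then show ?thesis using L_mem[of "r \<otimes>\<^bsub>K\<^esub> s"] i rz by (simp add: smult_assoc1)
    qed
  qed
  have "subcoalgebra K A ?L"
    unfolding subcoalgebra_def
  proof (intro conjI L_sub image_subsetI)
    fix z assume "z \<in> ?L"
    then obtain r where r: "r \<in> carrier K" "z = r \<odot>\<^bsub>A\<^esub> h i" by auto
    let ?P = "{AA.pt a b | a b. a \<in> ?L \<and> b \<in> ?L}"
    have P: "?P \<subseteq> carrier (tensor K A A)" using i by auto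
    interpret S: submodule K "T.span ?P" "tensor K A A" by (rule T.span_is_submodule[OF P])
    have "AA.pt (h i) (h i) \<in> ?P" using hL by blast
    then have "AA.pt (h i) (h i) \<in> T.span ?P" using T.in_own_span[OF P] by blast
    then have "r \<odot>\<^bsub>tensor K A A\<^esub> AA.pt (h i) (h i) \<in> T.span ?P" by (rule S.smult_closed[OF r(1)])
    then show "comult A z \<in> T.span ?P"
      using r i grouplikeD(2)[OF gl[OF i(1)]] \<Delta>(6) by simp
  qed
  moreover have "?L \<subseteq> D" using i(2) D.smult_closed by auto
  moreover have h0: "h i \<noteq> \<zero>\<^bsub>A\<^esub>"
    using coord_simps(3)[OF i(1) i(1)] module_hom_zero[OF module_self cb.self_module coord_hom[OF i(1)], of False]
    by auto
  ultimately have D_eq: "D = ?L" using simple[of ?L] hL by blast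
  have V: "vectorspace K (A\<lparr>carrier := D\<rparr>)"
    by (rule subspace_is_vs) (use subm vectorspace_axioms in \<open>simp add: subspace_def\<close>)
  interpret V: vectorspace K "A\<lparr>carrier := D\<rparr>" by (rule V)
  interpret C: coordinate_basis K "A\<lparr>carrier := D\<rparr>" "{()}" "\<lambda>_. h i" "\<lambda>_. \<pi> (False, i)"
  proof unfold_locales
    show "finite {()}" by simp
    show "h i \<in> carrier (A\<lparr>carrier := D\<rparr>)" using i by simp
    have Dc: "d \<in> carrier A" if "d \<in> D" for d using that D.subset by auto
    have "\<pi> (False, i) \<in> module_hom K (A\<lparr>carrier := D\<rparr>) (self_algebra K)"
      by (rule module_homI) (simp_all add: coord_lin i Dc)
    then show "coordinates K (A\<lparr>carrier := D\<rparr>) {()} (\<lambda>_. h i) (\<lambda>_. \<pi> (False, i))"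
      using coord_simps(3)[OF i(1) i(1)] by (simp add: coordinates_def)
    have B: "{h i} \<subseteq> carrier (A\<lparr>carrier := D\<rparr>)" using i by simp
    interpret S: submodule K "V.span {h i}" "A\<lparr>carrier := D\<rparr>" by (rule V.span_is_submodule[OF B])
    have "h i \<in> V.span {h i}" using V.in_own_span[OF B] by simp
    then have "D \<subseteq> V.span {h i}" using S.smult_closed by (auto simp: D_eq)
    then show "V.span ((\<lambda>_. h i) ` {()}) = carrier (A\<lparr>carrier := D\<rparr>)"
      using V.span_is_subset2[OF B] by auto
  qed
  show "V.fin_dim \<and> V.dim = 1" using C.fin_dim C.dim_eq by simp
qed

end

text \<open>The monomials \<open>g\<^sup>a c\<^sup>d\<close> are group-like, and \<open>g\<^sup>a x c\<^sup>d\<close> is skew-primitive between \<open>g\<^sup>a c\<^sup>d\<close> and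
  \<open>g\<^bsup>a+1\<^esup> c\<^sup>d\<close>. Only \<open>g\<^sup>2 = 1\<close> enters, so this applies before any commutation rule is known.\<close>

lemma (in hopf_algebra) pointed_basis_monomials:
  assumes gl: "grouplike K A g" "grouplike K A c" and sk: "skew_primitive K A \<one>\<^bsub>A\<^esub> g x"
    and gg: "g \<otimes>\<^bsub>A\<^esub> g = \<one>\<^bsub>A\<^esub>" and span: "span (monomial A g x c ` indices n) = carrier A"
    and \<pi>: "coordinates K A (indices n) (monomial A g x c) \<pi>"
  shows "pointed_basis K A (UNIV \<times> {..<n}) (\<lambda>i. monomial A g x c (False, i))
    (\<lambda>i. monomial A g x c (True, i)) (\<lambda>(a, d). (\<not> a, d)) \<pi>"
proof -
  let ?M = "monomial A g x c"
  have v: "(\<lambda>(s, i). if s then ?M (True, i) else ?M (False, i)) = ?M"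
    by (auto simp: fun_eq_iff split: prod.splits)
  have sk: "skew_primitive K A (?M (False, i)) (?M (False, case i of (a, d) \<Rightarrow> (\<not> a, d))) (?M (True, i))" for i
    using skew_primitive_monomial[OF gl sk gg] by (cases i) simp
  show ?thesis
    by (intro pointed_basis.intro pointed_basis_axioms.intro hopf_algebra_axioms; (unfold v)?)
      (use sk span \<pi> in auto)
qed

lemma sweedler_hopf_homI:
  assumes A: "sweedler_hopf K A g x c n \<omega>" and B: "sweedler_hopf K B g' x' c' m \<omega>'"
    and f: "f \<in> alg_hom K A B"
    and f_mon: "\<And>u. u \<in> indices n \<Longrightarrow> f (monomial A g x c u) = monomial B g' x' c' u"
  shows "f \<in> hopf_hom K A B"
proof -
  interpret A: sweedler_hopf K A g x c n \<omega> by fact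
  interpret B: sweedler_hopf K B g' x' c' m \<omega>' by fact
  show ?thesis
  proof (rule hopf_homI[OF A.hopf_algebra_axioms B.hopf_algebra_axioms f A.spanning])
    fix z assume "z \<in> A.\<mu> ` indices n"
    then obtain s a d where z: "z = A.\<mu> (s, a, d)" and d: "d < n" by auto
    have m: "f (A.\<mu> (t, b, d)) = B.\<mu> (t, b, d)" for t b by (rule f_mon) (use d in simp)
    show "(grouplike K A z \<and> grouplike K B (f z)) \<or>
      (\<exists>h k. skew_primitive K A h k z \<and> skew_primitive K B (f h) (f k) (f z))"
    proof (cases s)
      case False
      with z have "z = A.\<mu> (False, a, d)" by simp
      then show ?thesis using A.gl_mon[of a d] B.gl_mon[of a d] m by simp
    next
      case True
      with z have z': "z = A.\<mu> (True, a, d)" by simp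
      have "skew_primitive K A (A.\<mu> (False, a, d)) (A.\<mu> (False, \<not> a, d)) z \<and>
          skew_primitive K B (f (A.\<mu> (False, a, d))) (f (A.\<mu> (False, \<not> a, d))) (f z)"
        unfolding z' m using A.sk_mon[of a d] B.sk_mon[of a d] by simp
      then show ?thesis by blast
    qed
  qed
qed

section \<open>Factorizations through \<open>H\<^sub>4\<close> and \<open>k[C\<^sub>n]\<close>\<close>

lemma integer_mod_group_facts:
  assumes n: "n > 0"
  shows "carrier (integer_mod_group n) = {0..<int n}" "\<one>\<^bsub>integer_mod_group n\<^esub> = 0"
    "p \<otimes>\<^bsub>integer_mod_group n\<^esub> q = (p + q) mod int n"
  using n by (simp_all add: integer_mod_group_def)

lemma basis_coordinates:
  assumes K: "field K" and G: "Group.group G"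
  shows "coordinates K (group_hopf_algebra K G) (carrier G) (basis_elt K) (\<lambda>p f. f p)"
proof -
  interpret K: field K by fact
  show ?thesis unfolding coordinates_def
    by (auto intro!: module_homI simp: monoid_algebra_simps basis_elt_def image_subset_iff)
qed

locale cyclic_setting = K: field K for K :: "('k, 'c) ring_scheme" (structure) +
  fixes n :: nat
  assumes n_pos: "n > 0"
begin

abbreviation "Cn \<equiv> integer_mod_group n"
abbreviation "KC \<equiv> group_hopf_algebra K Cn"
abbreviation "HH \<equiv> H4 K"
abbreviation "g4 \<equiv> H4_gen K Gen_g"
abbreviation "x4 \<equiv> H4_gen K Gen_x"

lemma field: "field K" ..

lemma Cn_group: "Group.group Cn" by simp

lemma monoid_over_Cn: "monoid_over_field K Cn"
  by (intro monoid_over_field.intro field group.is_monoid[OF Cn_group])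

sublocale KC: hopf_algebra K KC by (rule hopf_algebra_group[OF field Cn_group])

sublocale HH: sweedler_hopf K HH g4 x4 "\<one>\<^bsub>HH\<^esub>" 1 "\<one>\<^bsub>K\<^esub>" by (rule sweedler_hopf_H4[OF field])

lemmas Cn_simps = integer_mod_group_facts[OF n_pos]

abbreviation "e d \<equiv> basis_elt K (int d mod int n)"

lemma e_closed: "e d \<in> carrier KC"
  using n_pos K.basis_elt_in_carrier[of "int d mod int n" Cn] by (simp add: Cn_simps)

lemma e_mult: "e d \<otimes>\<^bsub>KC\<^esub> e d' = e (d + d')"
proof -
  interpret M: monoid_over_field K Cn by (rule monoid_over_Cn)
  show ?thesis
    using n_pos M.mult_basis_elt[of "int d mod int n" "int d' mod int n"]
    by (simp add: Cn_simps mod_simps)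
qed

lemma one_KC: "\<one>\<^bsub>KC\<^esub> = e 0"
  by (simp add: monoid_algebra_simps)

lemma e_pow: "e 1 [^]\<^bsub>KC\<^esub> (d::nat) = e d"
proof (induction d)
  case 0
  show ?case by (simp only: KC.A.nat_pow_0 one_KC)
next
  case (Suc d)
  have "e 1 [^]\<^bsub>KC\<^esub> Suc d = e 1 [^]\<^bsub>KC\<^esub> d \<otimes>\<^bsub>KC\<^esub> e 1" by (rule KC.A.nat_pow_Suc)
  also have "\<dots> = e (d + 1)" unfolding Suc by (rule e_mult)
  finally show ?case unfolding Suc_eq_plus1 .
qed

lemma e_gl: "grouplike K KC (e d)"
  by (rule grouplike_basis_elt[OF field Cn_group]) (use n_pos in \<open>simp add: Cn_simps\<close>)

lemma KC_basis: "basis_elt K ` carrier Cn = e ` {..<n}"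
proof -
  have "carrier Cn = (\<lambda>d. int d mod int n) ` {..<n}"
    using n_pos unfolding Cn_simps by (auto simp: image_iff) (metis lessThan_iff nat_less_iff mod_pos_pos_trivial int_nat_eq)
  then show ?thesis by (simp add: image_image)
qed

sublocale HC: two_algebras K HH KC
  by (intro two_algebras.intro HH.k_algebra_self KC.k_algebra_self)

text \<open>The basis of \<open>H\<^sub>4 \<otimes> k[C\<^sub>n]\<close>, indexed so that multiplication takes it to the monomials of \<open>E\<close>.\<close>

definition tensor_basis :: "bool \<times> bool \<times> nat \<Rightarrow> _" where
  "tensor_basis = (\<lambda>(s, a, d). HC.pt (HH.\<mu> (s, a, 0)) (e d))"

lemma tensor_basis_closed: "tensor_basis u \<in> carrier HC.T"
  by (cases u) (simp add: tensor_basis_def e_closed del: group_hopf_algebra_simps)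

lemma tensor_basis_coordinates:
  obtains \<pi> where "coordinates K HC.T (indices n) tensor_basis \<pi>"
proof -
  obtain \<pi>1 where 1: "coordinates K HH (indices 1) HH.\<mu> \<pi>1" by (rule coordinates_H4[OF field])
  obtain \<pi> where 2: "coordinates K HC.T (indices 1 \<times> carrier Cn) (\<lambda>(u, w). HC.pt (HH.\<mu> u) (basis_elt K w)) \<pi>"
    by (rule HC.coordinates_tensor[OF 1 _ basis_coordinates[OF field Cn_group]])
      (use K.basis_elt_in_carrier[of _ Cn] in auto)
  let ?r = "\<lambda>(s, a, d). ((s, a, 0::nat), int d mod int n)"
  have "coordinates K HC.T (indices n) (\<lambda>u. (\<lambda>(u, w). HC.pt (HH.\<mu> u) (basis_elt K w)) (?r u)) (\<lambda>u. \<pi> (?r u))"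
    by (rule coordinates_reindex[OF 2]) (use n_pos in \<open>auto simp: inj_on_def Cn_simps\<close>)
  then show thesis
    by (rule that[OF coordinates_cong]) (auto simp: tensor_basis_def)
qed

lemma tensor_basis_span: "module.span K HC.T (tensor_basis ` indices n) = carrier HC.T"
proof -
  have "{HC.pt a b | a b. a \<in> HH.\<mu> ` indices 1 \<and> b \<in> basis_elt K ` carrier Cn} = tensor_basis ` indices n"
    unfolding KC_basis by (force simp: tensor_basis_def image_iff)
  moreover have "basis_elt K ` carrier Cn \<subseteq> carrier KC"
    unfolding KC_basis by (intro image_subsetI e_closed)
  moreover have "HH.\<mu> ` indices 1 \<subseteq> carrier HH" by (intro image_subsetI HH.mon_closed)
  ultimately show ?thesis
    using HC.span_tensor[OF HH.spanning _ span_group_hopf_algebra[OF field Cn_group]] by presburger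
qed

lemma mult_map:
  assumes E: "k_algebra K E" and i: "i \<in> alg_hom K HH E" and j: "j \<in> alg_hom K KC E"
  shows mult_map_hom: "tensor_lift K E (\<lambda>(a, h). i a \<otimes>\<^bsub>E\<^esub> j h) \<in> module_hom K HC.T E"
    and mult_map_basis: "tensor_lift K E (\<lambda>(a, h). i a \<otimes>\<^bsub>E\<^esub> j h) (tensor_basis u) = monomial E (i g4) (i x4) (j (e 1)) u"
proof -
  interpret E: k_algebra K E by fact
  note i' = alg_homD[OF i] and j' = alg_homD[OF j]
  have bil: "bilinear K HH KC E (\<lambda>a h. i a \<otimes>\<^bsub>E\<^esub> j h)"
    by (intro bilinearI module_homI)
      (simp_all add: i' j' E.A.l_distr E.A.r_distr E.smult_mult_left E.smult_mult_right del: group_hopf_algebra_simps)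
  show "tensor_lift K E (\<lambda>(a, h). i a \<otimes>\<^bsub>E\<^esub> j h) \<in> module_hom K HC.T E"
    by (rule HC.tensor_lift_hom[OF E.module_self bil])
  obtain s a d where u: "u = (s, a, d)" by (cases u)
  have "j (e d) = j (e 1) [^]\<^bsub>E\<^esub> d"
    using alg_hom_pow[OF KC.k_algebra_self E j e_closed[of 1], of d] by (simp only: e_pow)
  moreover have "i (HH.\<mu> (s, a, 0)) = monomial E (i g4) (i x4) \<one>\<^bsub>E\<^esub> (s, a, 0)"
    using alg_hom_monomial[OF HH.k_algebra_self E i HH.closed(1-3)] i'(7) by simp
  ultimately have "tensor_lift K E (\<lambda>(a, h). i a \<otimes>\<^bsub>E\<^esub> j h) (tensor_basis u)
      = monomial E (i g4) (i x4) \<one>\<^bsub>E\<^esub> (s, a, 0) \<otimes>\<^bsub>E\<^esub> j (e 1) [^]\<^bsub>E\<^esub> d"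
    unfolding u tensor_basis_def prod.case
    by (subst HC.tensor_lift_pt[OF E.module_self bil HH.mon_closed e_closed]) simp
  also have "\<dots> = monomial E (i g4) (i x4) (j (e 1)) u"
    using i'(3)[OF HH.closed(1)] i'(3)[OF HH.closed(2)] j'(3)[OF e_closed[of 1]] unfolding u monomial_def prod.case
    by (simp add: E.A.m_assoc)
  finally show "tensor_lift K E (\<lambda>(a, h). i a \<otimes>\<^bsub>E\<^esub> j h) (tensor_basis u) = monomial E (i g4) (i x4) (j (e 1)) u" .
qed

lemma vectorspace_T: "vectorspace K HC.T"
proof -
  interpret T: k_algebra K HC.T by (rule HC.k_algebra_tensor)
  show ?thesis ..
qed

text \<open>The subalgebras generated by \<open>G\<close>, \<open>Y\<close> and by \<open>C\<close> are images of \<open>H\<^sub>4\<close> and \<open>k[C\<^sub>n]\<close>, and multiplication takes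
  the basis of the tensor product to the basis of monomials.\<close>

lemma factorizes_if_sweedler_hopf:
  assumes "sweedler_hopf K E G Y C n \<omega>" and \<pi>: "coordinates K E (indices n) (monomial E G Y C) \<pi>"
  shows "factorizes K E HH KC"
proof -
  interpret E: sweedler_hopf K E G Y C n \<omega> by fact
  obtain i where i: "i \<in> alg_hom K HH E" "i g4 = G" "i x4 = Y"
    by (rule H4_lift[OF E.sweedler_relations_axioms])
  note i' = alg_homD[OF i(1)]
  interpret M: monoid_over_field K Cn by (rule monoid_over_Cn)
  let ?b = "\<lambda>p. C [^]\<^bsub>E\<^esub> nat p"
  have pow_mod: "C [^]\<^bsub>E\<^esub> (m mod n) = C [^]\<^bsub>E\<^esub> m" for m :: nat
  proof -
    have "C [^]\<^bsub>E\<^esub> m = (C [^]\<^bsub>E\<^esub> n) [^]\<^bsub>E\<^esub> (m div n) \<otimes>\<^bsub>E\<^esub> C [^]\<^bsub>E\<^esub> (m mod n)"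
      by (simp add: E.A.nat_pow_pow E.A.nat_pow_mult)
    then show ?thesis by (simp add: E.cn)
  qed
  define j where "j = lin_ext K E ?b"
  have b: "?b \<in> carrier Cn \<rightarrow> carrier E" by auto
  have "j \<in> alg_hom K (monoid_algebra K Cn) E"
    unfolding j_def
  proof (rule M.lin_ext_alg_hom[OF E.k_algebra_self b])
    show "?b \<one>\<^bsub>Cn\<^esub> = \<one>\<^bsub>E\<^esub>" by simp
    fix p q assume pq: "p \<in> carrier Cn" "q \<in> carrier Cn"
    then have "nat (p \<otimes>\<^bsub>Cn\<^esub> q) = (nat p + nat q) mod n"
      unfolding Cn_simps by (simp add: nat_mod_distrib nat_add_distrib)
    then show "?b (p \<otimes>\<^bsub>Cn\<^esub> q) = ?b p \<otimes>\<^bsub>E\<^esub> ?b q"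
      by (simp add: pow_mod E.A.nat_pow_mult del: mult_integer_mod_group)
  qed
  then have j: "j \<in> alg_hom K KC E" by (subst alg_hom_cong[of KC "monoid_algebra K Cn" E E]) simp_all
  note j' = alg_homD[OF j]
  have j_basis: "j (basis_elt K p) = C [^]\<^bsub>E\<^esub> nat p" if "p \<in> carrier Cn" for p
    unfolding j_def by (rule K.lin_ext_basis[OF E.module_self b that])
  have j_e: "j (e d) = C [^]\<^bsub>E\<^esub> d" for d
    using j_basis[of "int d mod int n"] n_pos pow_mod[of d]
    by (simp add: Cn_simps nat_mod_distrib)
  have i_mon: "i (HH.\<mu> u) = E.\<mu> u" if u1: "u \<in> indices 1" for u
  proof -
    obtain s a where u: "u = (s, a, 0)" using u1 by auto
    show ?thesis
      using alg_hom_monomial[OF HH.k_algebra_self E.k_algebra_self i(1) HH.closed(1-3), of u]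
      unfolding i(2,3) i'(7) u by (simp add: monomial_def)
  qed
  have i_hopf: "i \<in> hopf_hom K HH E"
    by (rule sweedler_hopf_homI[OF HH.sweedler_hopf_axioms assms(1) i(1) i_mon])
  have j_hopf: "j \<in> hopf_hom K KC E"
  proof (rule hopf_homI[OF KC.hopf_algebra_axioms E.hopf_algebra_axioms j span_group_hopf_algebra[OF field Cn_group]])
    fix a assume "a \<in> basis_elt K ` carrier Cn"
    then obtain d where "a = e d" unfolding KC_basis by (elim imageE)
    then show "(grouplike K KC a \<and> grouplike K E (j a)) \<or>
      (\<exists>h k. skew_primitive K KC h k a \<and> skew_primitive K E (j h) (j k) (j a))"
      using e_gl[of d] j_e[of d] E.grouplike_pow[OF E.gl_c, of d] by simp
  qed
  have i_inj: "inj_on i (carrier HH)"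
  proof (rule coordinates_inj[OF _ _ i'(1) _ _ HH.spanning])
    have "coordinates K E (indices 1) E.\<mu> \<pi>"
      using coordinates_reindex[OF \<pi>, of "\<lambda>u. u" "indices 1"] n_pos by auto
    then show "coordinates K E (indices 1) (\<lambda>u. i (HH.\<mu> u)) \<pi>"
      by (rule coordinates_cong) (simp add: i_mon)
  qed (auto intro: HH.vectorspace_axioms E.vectorspace_axioms)
  have j_inj: "inj_on j (carrier KC)"
  proof (rule coordinates_inj[OF _ _ j'(1) _ _ span_group_hopf_algebra[OF field Cn_group]])
    have "coordinates K E (carrier Cn) (\<lambda>p. E.\<mu> (False, False, nat p)) (\<lambda>p. \<pi> (False, False, nat p))"
      by (rule coordinates_reindex[OF \<pi>]) (auto simp: inj_on_def Cn_simps)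
    then show "coordinates K E (carrier Cn) (\<lambda>p. j (basis_elt K p)) (\<lambda>p. \<pi> (False, False, nat p))"
      by (rule coordinates_cong) (simp add: j_basis monomial_def del: carrier_integer_mod_group)
    show "finite (carrier Cn)" unfolding Cn_simps by simp
    show "basis_elt K u \<in> carrier KC" if "u \<in> carrier Cn" for u
      using K.basis_elt_in_carrier[OF that] by simp
  qed (auto intro: KC.vectorspace_axioms E.vectorspace_axioms)
  let ?m = "tensor_lift K E (\<lambda>(a, h). i a \<otimes>\<^bsub>E\<^esub> j h)"
  have m: "?m \<in> module_hom K HC.T E" by (rule mult_map_hom[OF E.k_algebra_self i(1) j])
  have j1: "j (e 1) = C" using j_e[of 1] by simp
  have m_basis: "?m (tensor_basis u) = E.\<mu> u" for u
    using mult_map_basis[OF E.k_algebra_self i(1) j, of u] unfolding i(2,3) j1 .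
  have "inj_on ?m (carrier HC.T)"
    by (rule coordinates_inj[OF vectorspace_T E.vectorspace_axioms m _ tensor_basis_closed tensor_basis_span])
      (use \<pi> in \<open>simp_all add: m_basis\<close>)
  moreover have "?m ` carrier HC.T = carrier E"
  proof (rule surj_on_span[OF vectorspace_T E.vectorspace_axioms m _ E.spanning])
    show "E.\<mu> ` indices n \<subseteq> ?m ` carrier HC.T"
    proof (rule image_subsetI)
      show "E.\<mu> u \<in> ?m ` carrier HC.T" for u
        using imageI[OF tensor_basis_closed[of u], of ?m] by (simp only: m_basis)
    qed
  qed
  ultimately have "bij_betw ?m (carrier HC.T) (carrier E)" by (simp add: bij_betw_def)
  then show ?thesis
    unfolding factorizes_def by (intro bexI[OF _ i_hopf] bexI[OF _ j_hopf] conjI i_inj j_inj)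
qed

text \<open>The heart of the matter: the coalgebra structure of \<open>E\<close>, known from the monomial basis, determines
  the conjugates \<open>k = CGC'\<close> and \<open>Y' = CYC'\<close>, where \<open>D\<close> below is \<open>C' = C\<^bsup>n-1\<^esup>\<close>.\<close>

lemma sweedler_hopf_if_factorizes:
  assumes E: "hopf_algebra K E" and fact: "factorizes K E HH KC"
    and char2: "\<one>\<^bsub>K\<^esub> \<oplus>\<^bsub>K\<^esub> \<one>\<^bsub>K\<^esub> \<noteq> \<zero>\<^bsub>K\<^esub>"
  obtains \<omega> G Y C \<pi> where "\<omega> \<in> U n K" "sweedler_hopf K E G Y C n \<omega>"
    "coordinates K E (indices n) (monomial E G Y C) \<pi>"
proof -
  interpret E: hopf_algebra K E by fact
  obtain i j where i: "i \<in> hopf_hom K HH E" and j: "j \<in> hopf_hom K KC E"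
    and bij: "bij_betw (tensor_lift K E (\<lambda>(a, h). i a \<otimes>\<^bsub>E\<^esub> j h)) (carrier HC.T) (carrier E)"
    using fact unfolding factorizes_def by (elim bexE conjE)
  note i_alg = hopf_homD(1)[OF i] and j_alg = hopf_homD(1)[OF j]
  note i' = alg_homD[OF i_alg] and j' = alg_homD[OF j_alg]
  define G Y C where "G = i g4" and "Y = i x4" and "C = j (e 1)"
  let ?m = "tensor_lift K E (\<lambda>(a, h). i a \<otimes>\<^bsub>E\<^esub> j h)"
  let ?M = "monomial E G Y C"
  have m: "?m \<in> module_hom K HC.T E" by (rule mult_map_hom[OF E.k_algebra_self i_alg j_alg])
  have m_basis: "?m (tensor_basis u) = ?M u" for u
    unfolding G_def Y_def C_def by (rule mult_map_basis[OF E.k_algebra_self i_alg j_alg])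
  have gl_G: "grouplike K E G"
    unfolding G_def by (rule hopf_hom_grouplike[OF HH.k_algebra_self E.k_algebra_self i HH.gl_g])
  have gl_C: "grouplike K E C"
    unfolding C_def by (rule hopf_hom_grouplike[OF KC.k_algebra_self E.k_algebra_self j e_gl])
  have sk_Y: "skew_primitive K E \<one>\<^bsub>E\<^esub> G Y"
    unfolding G_def Y_def
    using hopf_hom_skew_primitive[OF HH.k_algebra_self E.k_algebra_self i HH.sk_x] i'(7) by simp
  have c: "G \<in> carrier E" "Y \<in> carrier E" "C \<in> carrier E"
    by (rule grouplikeD(1)[OF gl_G] grouplikeD(1)[OF gl_C] skew_primitiveD(3)[OF sk_Y])+
  have img: "sweedler_relations K E G Y (i \<one>\<^bsub>HH\<^esub>) 1 \<one>\<^bsub>K\<^esub>"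
    unfolding G_def Y_def
    by (rule relations_image[OF HH.sweedler_relations_axioms E.k_algebra_self i_alg])
  have GG: "G \<otimes>\<^bsub>E\<^esub> G = \<one>\<^bsub>E\<^esub>" and XX: "Y \<otimes>\<^bsub>E\<^esub> Y = \<zero>\<^bsub>E\<^esub>" and XG: "Y \<otimes>\<^bsub>E\<^esub> G = \<ominus>\<^bsub>E\<^esub> (G \<otimes>\<^bsub>E\<^esub> Y)"
    by (rule sweedler_relations.gg[OF img] sweedler_relations.xx[OF img] sweedler_relations.xg[OF img])+
  have Cn: "C [^]\<^bsub>E\<^esub> n = \<one>\<^bsub>E\<^esub>"
  proof -
    have "C [^]\<^bsub>E\<^esub> n = j (e n)"
      unfolding C_def using alg_hom_pow[OF KC.k_algebra_self E.k_algebra_self j_alg e_closed[of 1], of n]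
      by (simp only: e_pow)
    also have "e n = e 0" by simp
    finally show ?thesis using j'(7) by (simp only: one_KC)
  qed
  have M_closed: "?M u \<in> carrier E" for u by (rule E.monomial_closed[OF c])
  have M_sub: "?M ` indices n \<subseteq> carrier E" using M_closed by auto
  \<comment> \<open>The bijection \<open>?m\<close> takes a basis of the tensor product to the monomials.\<close>
  have M_span: "E.span (?M ` indices n) = carrier E"
  proof -
    have "?m ` tensor_basis ` indices n = ?M ` indices n" by (simp add: image_image m_basis)
    then show ?thesis
      using span_surj_image[OF vectorspace_T E.vectorspace_axioms m bij_betw_imp_surj_on[OF bij] tensor_basis_span]
        image_subsetI[of "indices n" tensor_basis, OF tensor_basis_closed] by simp
  qed
  obtain \<pi> where \<pi>: "coordinates K E (indices n) ?M \<pi>"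
  proof -
    obtain \<pi>T where \<pi>T: "coordinates K HC.T (indices n) tensor_basis \<pi>T" by (rule tensor_basis_coordinates)
    let ?h = "inv_into (carrier HC.T) ?m"
    interpret VT: vectorspace K HC.T by (rule vectorspace_T)
    have h: "?h \<in> module_hom K E HC.T" by (rule module_hom_inverse[OF VT.module_axioms m bij])
    have hM: "tensor_basis u = ?h (?M u)" for u
      using inv_into_f_f[OF bij_betw_imp_inj_on[OF bij] tensor_basis_closed[of u]] m_basis[of u] by simp
    have "coordinates K HC.T (indices n) (\<lambda>u. ?h (?M u)) \<pi>T"
      by (rule coordinates_cong[OF \<pi>T hM])
    then show thesis by (rule that[OF coordinates_pullback[OF h]])
  qed
  let ?\<sigma> = "\<lambda>(a, d). (\<not> a, d)"
  interpret P: pointed_basis K E "UNIV \<times> {..<n}" "\<lambda>i. ?M (False, i)" "\<lambda>i. ?M (True, i)" ?\<sigma> \<pi>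
    by (rule E.pointed_basis_monomials[OF gl_G gl_C sk_Y GG M_span \<pi>])
  let ?o = "(False, 0::nat)"
  have o: "?o \<in> UNIV \<times> {..<n}" "?\<sigma> ?o \<in> UNIV \<times> {..<n}" using n_pos by auto
  have M0: "?M (False, ?o) = \<one>\<^bsub>E\<^esub>" "?M (True, ?o) = Y" "?M (False, ?\<sigma> ?o) = G"
    "?M (True, ?\<sigma> ?o) = G \<otimes>\<^bsub>E\<^esub> Y"
    using c by (simp_all add: monomial_def)
  define D where "D = C [^]\<^bsub>E\<^esub> (n - 1)"
  have D: "D \<in> carrier E" "grouplike K E D" "C \<otimes>\<^bsub>E\<^esub> D = \<one>\<^bsub>E\<^esub>" "D \<otimes>\<^bsub>E\<^esub> C = \<one>\<^bsub>E\<^esub>"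
    using c Cn n_pos E.grouplike_pow[OF gl_C, of "n - 1"]
      E.A.nat_pow_Suc[of C "n - 1"] E.A.nat_pow_Suc2[OF c(3), of "n - 1"] by (simp_all add: D_def)
  have CD: "C \<otimes>\<^bsub>E\<^esub> (D \<otimes>\<^bsub>E\<^esub> z) = z" "D \<otimes>\<^bsub>E\<^esub> (C \<otimes>\<^bsub>E\<^esub> z) = z" if "z \<in> carrier E" for z
    using that c D by (simp_all add: E.A.m_assoc[symmetric])
  define k Y' where "k = C \<otimes>\<^bsub>E\<^esub> G \<otimes>\<^bsub>E\<^esub> D" and "Y' = C \<otimes>\<^bsub>E\<^esub> Y \<otimes>\<^bsub>E\<^esub> D"
  have Y'_skew: "skew_primitive K E (?M (False, ?o)) k Y'"
    using E.skew_primitive_mult(2)[OF E.skew_primitive_mult(1)[OF sk_Y gl_C] D(2)] c D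
    unfolding M0(1) k_def Y'_def by simp
  note Y'_closed = skew_primitiveD(3)[OF Y'_skew]
  define \<omega> where "\<omega> = \<pi> (True, ?o) Y'"
  have \<omega>_closed: "\<omega> \<in> carrier K" unfolding \<omega>_def by (rule P.coord_lin(1)[OF o(1) Y'_closed])
  \<comment> \<open>Otherwise \<open>Y'\<close> would be a combination of the \<open>G\<^sup>a C\<^sup>d\<close>, whose conjugates are group-like; but the
      coordinate of \<open>Y\<close> at \<open>Y\<close> is \<open>1\<close>, and that of a group-like element is \<open>0\<close>.\<close>
  have \<omega>_ne: "\<omega> \<noteq> \<zero>\<^bsub>K\<^esub>"
  proof
    assume \<omega>0: "\<omega> = \<zero>\<^bsub>K\<^esub>"
    define \<psi> where "\<psi> z = \<pi> (True, ?o) (D \<otimes>\<^bsub>E\<^esub> z \<otimes>\<^bsub>E\<^esub> C)" for z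
    have "\<psi> \<in> module_hom K E (self_algebra K)"
      unfolding \<psi>_def
      by (rule module_homI)
        (use c D in \<open>simp_all add: P.coord_lin[OF o(1)] E.A.l_distr E.A.r_distr E.smult_mult_left E.smult_mult_right\<close>)
    then have "\<psi> Y' = \<zero>\<^bsub>K\<^esub>"
    proof (rule P.cb.functional_zero[OF _ Y'_closed])
      fix u :: "bool \<times> bool \<times> nat" assume u: "u \<in> UNIV \<times> (UNIV \<times> {..<n})"
      obtain s l where sl: "u = (s, l)" by (cases u)
      have l: "l \<in> UNIV \<times> {..<n}" using u sl by auto
      show "\<pi> u Y' = \<zero>\<^bsub>K\<^esub> \<or> \<psi> ((\<lambda>(s, i). if s then ?M (True, i) else ?M (False, i)) u) = \<zero>\<^bsub>K\<^esub>"
      proof (cases s)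
        case True
        have "\<pi> (True, l) Y' = \<zero>\<^bsub>K\<^esub>"
          using P.skew_primitive_coord_y[OF Y'_skew o(1) l] \<omega>0 by (cases "l = ?o") (simp_all add: \<omega>_def)
        then show ?thesis using sl True by simp
      next
        case False
        have "\<psi> (?M (False, l)) = \<zero>\<^bsub>K\<^esub>"
          unfolding \<psi>_def
          by (rule P.grouplike_coord_y[OF _ o(1)]) (intro E.grouplike_mult D(2) gl_C P.gl[OF l])
        then show ?thesis using sl False by simp
      qed
    qed
    moreover have "D \<otimes>\<^bsub>E\<^esub> Y' \<otimes>\<^bsub>E\<^esub> C = Y"
      unfolding Y'_def using c D CD by (simp add: E.A.m_assoc)
    ultimately show False
      using P.coord_simps(1)[OF o(1) o(1)] unfolding \<psi>_def M0(2) by simp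
  qed
  have form: "k = G" "Y' \<oplus>\<^bsub>E\<^esub> \<pi> (False, ?\<sigma> ?o) Y' \<odot>\<^bsub>E\<^esub> \<one>\<^bsub>E\<^esub> =
      \<omega> \<odot>\<^bsub>E\<^esub> Y \<oplus>\<^bsub>E\<^esub> \<pi> (False, ?\<sigma> ?o) Y' \<odot>\<^bsub>E\<^esub> G"
    using P.skew_primitive_form[OF Y'_skew o(1)] \<omega>_ne unfolding \<omega>_def M0 by auto
  define \<alpha> where "\<alpha> = \<pi> (False, ?\<sigma> ?o) Y'"
  have \<alpha>: "\<alpha> \<in> carrier K" unfolding \<alpha>_def by (rule P.coord_lin(1)[OF o(2) Y'_closed])
  have CG: "C \<otimes>\<^bsub>E\<^esub> G = G \<otimes>\<^bsub>E\<^esub> C"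
  proof -
    have "C \<otimes>\<^bsub>E\<^esub> G = k \<otimes>\<^bsub>E\<^esub> C" unfolding k_def using c D by (simp add: E.A.m_assoc)
    then show ?thesis unfolding form(1) .
  qed
  have DG: "D \<otimes>\<^bsub>E\<^esub> G = G \<otimes>\<^bsub>E\<^esub> D"
  proof -
    have "D \<otimes>\<^bsub>E\<^esub> G = D \<otimes>\<^bsub>E\<^esub> (G \<otimes>\<^bsub>E\<^esub> C) \<otimes>\<^bsub>E\<^esub> D" using c D by (simp add: E.A.m_assoc)
    also have "\<dots> = G \<otimes>\<^bsub>E\<^esub> D" unfolding CG[symmetric] using c D CD by (simp add: E.A.m_assoc)
    finally show ?thesis .
  qed
  have anti: "Y' \<otimes>\<^bsub>E\<^esub> G = \<ominus>\<^bsub>E\<^esub> (G \<otimes>\<^bsub>E\<^esub> Y')"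
  proof -
    have "Y' \<otimes>\<^bsub>E\<^esub> G = C \<otimes>\<^bsub>E\<^esub> (Y \<otimes>\<^bsub>E\<^esub> G) \<otimes>\<^bsub>E\<^esub> D"
      unfolding Y'_def using c D by (simp add: E.A.m_assoc DG)
    also have "\<dots> = \<ominus>\<^bsub>E\<^esub> ((C \<otimes>\<^bsub>E\<^esub> G) \<otimes>\<^bsub>E\<^esub> Y \<otimes>\<^bsub>E\<^esub> D)"
      unfolding XG using c D by (simp add: E.A.l_minus E.A.r_minus E.A.m_assoc)
    also have "\<dots> = \<ominus>\<^bsub>E\<^esub> (G \<otimes>\<^bsub>E\<^esub> Y')"
      unfolding CG Y'_def using c D by (simp add: E.A.m_assoc)
    finally show ?thesis .
  qed
  \<comment> \<open>Compare the coefficients of \<open>1\<close> in \<open>Y'G\<close> and \<open>-GY'\<close>, which are \<open>\<alpha>\<close> and \<open>-\<alpha>\<close>.\<close>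
  have "\<alpha> \<oplus>\<^bsub>K\<^esub> \<alpha> = \<zero>\<^bsub>K\<^esub>"
  proof -
    let ?p = "\<pi> (False, ?o)"
    note p = P.coord_lin[OF o(1), where s = False]
    have vals: "?p \<one>\<^bsub>E\<^esub> = \<one>\<^bsub>K\<^esub>" "?p G = \<zero>\<^bsub>K\<^esub>" "?p Y = \<zero>\<^bsub>K\<^esub>" "?p (G \<otimes>\<^bsub>E\<^esub> Y) = \<zero>\<^bsub>K\<^esub>"
      using P.coord_simps(3)[OF o(1) o(1)] P.coord_simps(3)[OF o(1) o(2)]
        P.coord_simps(4)[OF o(1) o(1)] P.coord_simps(4)[OF o(1) o(2)] unfolding M0 by simp_all
    have neg: "?p (\<ominus>\<^bsub>E\<^esub> z) = \<ominus>\<^bsub>K\<^esub> ?p z" if "z \<in> carrier E" for z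
      using p(3)[of "\<ominus>\<^bsub>K\<^esub> \<one>\<^bsub>K\<^esub>" z] p(1)[OF that] that by (simp add: E.smult_l_minus K.l_minus)
    have f: "Y' \<oplus>\<^bsub>E\<^esub> \<alpha> \<odot>\<^bsub>E\<^esub> \<one>\<^bsub>E\<^esub> = \<omega> \<odot>\<^bsub>E\<^esub> Y \<oplus>\<^bsub>E\<^esub> \<alpha> \<odot>\<^bsub>E\<^esub> G"
      using form(2) unfolding \<alpha>_def .
    have "?p ((Y' \<oplus>\<^bsub>E\<^esub> \<alpha> \<odot>\<^bsub>E\<^esub> \<one>\<^bsub>E\<^esub>) \<otimes>\<^bsub>E\<^esub> G) = ?p ((\<omega> \<odot>\<^bsub>E\<^esub> Y \<oplus>\<^bsub>E\<^esub> \<alpha> \<odot>\<^bsub>E\<^esub> G) \<otimes>\<^bsub>E\<^esub> G)"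
      using f by simp
    then have 1: "?p (Y' \<otimes>\<^bsub>E\<^esub> G) = \<alpha>"
      using c \<alpha> \<omega>_closed Y'_closed
      by (simp add: E.A.l_distr E.smult_mult_left p vals neg XG GG)
    have "?p (G \<otimes>\<^bsub>E\<^esub> (Y' \<oplus>\<^bsub>E\<^esub> \<alpha> \<odot>\<^bsub>E\<^esub> \<one>\<^bsub>E\<^esub>)) = ?p (G \<otimes>\<^bsub>E\<^esub> (\<omega> \<odot>\<^bsub>E\<^esub> Y \<oplus>\<^bsub>E\<^esub> \<alpha> \<odot>\<^bsub>E\<^esub> G))"
      using f by simp
    then have 2: "?p (G \<otimes>\<^bsub>E\<^esub> Y') = \<alpha>"
      using c \<alpha> \<omega>_closed Y'_closed
      by (simp add: E.A.r_distr E.smult_mult_right p vals GG)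
    have "\<alpha> = \<ominus>\<^bsub>K\<^esub> \<alpha>"
      using 1 2 neg[of "G \<otimes>\<^bsub>E\<^esub> Y'"] c Y'_closed unfolding anti by simp
    then show ?thesis using \<alpha> K.r_neg[OF \<alpha>] by simp
  qed
  then have "(\<one>\<^bsub>K\<^esub> \<oplus>\<^bsub>K\<^esub> \<one>\<^bsub>K\<^esub>) \<otimes>\<^bsub>K\<^esub> \<alpha> = \<zero>\<^bsub>K\<^esub>" using \<alpha> by (simp add: K.l_distr)
  then have \<alpha>0: "\<alpha> = \<zero>\<^bsub>K\<^esub>" using \<alpha> char2 K.integral[of "\<one>\<^bsub>K\<^esub> \<oplus>\<^bsub>K\<^esub> \<one>\<^bsub>K\<^esub>" \<alpha>] by simp
  have Y'_eq: "Y' = \<omega> \<odot>\<^bsub>E\<^esub> Y"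
    using form(2) c \<omega>_closed Y'_closed unfolding \<alpha>_def[symmetric] \<alpha>0 by simp
  have CX: "C \<otimes>\<^bsub>E\<^esub> Y = \<omega> \<odot>\<^bsub>E\<^esub> (Y \<otimes>\<^bsub>E\<^esub> C)"
  proof -
    have "C \<otimes>\<^bsub>E\<^esub> Y = Y' \<otimes>\<^bsub>E\<^esub> C" unfolding Y'_def using c D by (simp add: E.A.m_assoc)
    then show ?thesis unfolding Y'_eq using c \<omega>_closed by (simp add: E.smult_mult_left)
  qed
  have rel: "sweedler_relations K E G Y C n \<omega>"
    by unfold_locales (use c \<omega>_closed n_pos GG XX XG Cn CG CX in auto)
  interpret R: sweedler_relations K E G Y C n \<omega> by (rule rel)
  have "Y = (\<omega> [^]\<^bsub>K\<^esub> n) \<odot>\<^bsub>E\<^esub> Y" using R.c_pow_x[of n] c unfolding Cn by simp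
  then have "\<pi> (True, ?o) Y = \<omega> [^]\<^bsub>K\<^esub> n \<otimes>\<^bsub>K\<^esub> \<pi> (True, ?o) Y"
    using P.coord_lin(3)[OF o(1), of "\<omega> [^]\<^bsub>K\<^esub> n" Y True] c \<omega>_closed by simp
  moreover have "\<pi> (True, ?o) Y = \<one>\<^bsub>K\<^esub>" using P.coord_simps(1)[OF o(1) o(1)] unfolding M0 by simp
  ultimately have \<omega>: "\<omega> \<in> U n K" using \<omega>_closed by (simp add: U_def)
  have "sweedler_comult K E G Y C n \<omega>"
    by (intro sweedler_comult.intro sweedler_comult_axioms.intro rel E.comult_algebra_axioms gl_G gl_C sk_Y M_span)
  then have "sweedler_hopf K E G Y C n \<omega>" by (intro sweedler_hopf.intro E)
  then show thesis by (rule that[OF \<omega> _ \<pi>])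
qed

text \<open>The presentation gives a map from \<open>H\<^bsub>4n,\<omega>\<^esub>\<close> to \<open>E\<close> that matches the monomials, which span the first
  algebra and are a basis of the second. The isomorphism is its inverse.\<close>

lemma isomorphic_if_sweedler_hopf:
  assumes E: "sweedler_hopf K E G Y C n \<omega>" and \<pi>: "coordinates K E (indices n) (monomial E G Y C) \<pi>"
  shows "hopf_isomorphic K E (H4n K n \<omega>)"
proof -
  interpret E: sweedler_hopf K E G Y C n \<omega> by fact
  let ?H = "H4n K n \<omega>"
  interpret H: sweedler_hopf K ?H "H4n_gen K n \<omega> Gen_g" "H4n_gen K n \<omega> Gen_x" "H4n_gen K n \<omega> Gen_c" n \<omega>
    by (rule sweedler_hopf_H4n[OF field n_pos E.closed(4)])
  obtain f where f: "f \<in> alg_hom K ?H E" "f (H4n_gen K n \<omega> Gen_g) = G"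
    "f (H4n_gen K n \<omega> Gen_x) = Y" "f (H4n_gen K n \<omega> Gen_c) = C"
    by (rule H4n_lift[OF E.sweedler_relations_axioms])
  note f' = alg_homD[OF f(1)]
  have f_mon: "f (H.\<mu> u) = E.\<mu> u" for u
    using alg_hom_monomial[OF H.k_algebra_self E.k_algebra_self f(1) H.closed(1-3)] unfolding f(2-4) .
  have f_hopf: "f \<in> hopf_hom K ?H E"
    by (rule sweedler_hopf_homI[OF H.sweedler_hopf_axioms E f(1) f_mon])
  have "inj_on f (carrier ?H)"
    by (rule coordinates_inj[OF H.vectorspace_axioms E.vectorspace_axioms f'(1) _ H.mon_closed H.spanning])
      (use \<pi> in \<open>simp_all add: f_mon\<close>)
  moreover have "f ` carrier ?H = carrier E"
  proof (rule surj_on_span[OF H.vectorspace_axioms E.vectorspace_axioms f'(1) _ E.spanning])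
    show "E.\<mu> ` indices n \<subseteq> f ` carrier ?H"
    proof (rule image_subsetI)
      show "E.\<mu> u \<in> f ` carrier ?H" for u
        using imageI[OF H.mon_closed[of u], of f] by (simp only: f_mon)
    qed
  qed
  ultimately have bij: "bij_betw f (carrier ?H) (carrier E)" by (simp add: bij_betw_def)
  have "inv_into (carrier ?H) f \<in> hopf_hom K E ?H"
    by (rule hopf_hom_inverse[OF H.k_algebra_self E.k_algebra_self H.comult_alg_hom H.antipode_linear f_hopf bij])
  then show ?thesis
    unfolding hopf_isomorphic_def
    using bij_betw_inv_into[OF bij] by (intro bexI)
qed

lemma sweedler_hopf_if_isomorphic:
  assumes E: "hopf_algebra K E" and iso: "hopf_isomorphic K E (H4n K n \<omega>)" and \<omega>: "\<omega> \<in> U n K"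
  obtains G Y C \<pi> where "sweedler_hopf K E G Y C n \<omega>" "coordinates K E (indices n) (monomial E G Y C) \<pi>"
proof -
  interpret E: hopf_algebra K E by fact
  let ?H = "H4n K n \<omega>" and ?g = "H4n_gen K n \<omega> Gen_g" and ?x = "H4n_gen K n \<omega> Gen_x" and ?c = "H4n_gen K n \<omega> Gen_c"
  have \<omega>': "\<omega> \<in> carrier K" using \<omega> by (simp add: U_def)
  interpret H: sweedler_hopf K ?H ?g ?x ?c n \<omega> by (rule sweedler_hopf_H4n[OF field n_pos \<omega>'])
  obtain \<pi> where \<pi>: "coordinates K ?H (indices n) H.\<mu> \<pi>" by (rule coordinates_H4n[OF field n_pos \<omega>])
  obtain f where f: "f \<in> hopf_hom K E ?H" and bij: "bij_betw f (carrier E) (carrier ?H)"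
    using iso unfolding hopf_isomorphic_def by (elim bexE)
  define h where "h = inv_into (carrier E) f"
  have h: "h \<in> hopf_hom K ?H E"
    unfolding h_def
    by (rule hopf_hom_inverse[OF E.k_algebra_self H.k_algebra_self E.comult_alg_hom E.antipode_linear f bij])
  note h_alg = hopf_homD(1)[OF h]
  note h' = alg_homD[OF h_alg]
  have bij_h: "bij_betw h (carrier ?H) (carrier E)" unfolding h_def by (rule bij_betw_inv_into[OF bij])
  have rel: "sweedler_relations K E (h ?g) (h ?x) (h ?c) n \<omega>"
    by (rule relations_image[OF H.sweedler_relations_axioms E.k_algebra_self h_alg])
  have h_mon: "h (H.\<mu> u) = monomial E (h ?g) (h ?x) (h ?c) u" for u
    by (rule alg_hom_monomial[OF H.k_algebra_self E.k_algebra_self h_alg H.closed(1-3)])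
  have gl: "grouplike K E (h ?g)" "grouplike K E (h ?c)"
    by (rule hopf_hom_grouplike[OF H.k_algebra_self E.k_algebra_self h], rule H.gl_g H.gl_c)+
  have sk: "skew_primitive K E \<one>\<^bsub>E\<^esub> (h ?g) (h ?x)"
    using hopf_hom_skew_primitive[OF H.k_algebra_self E.k_algebra_self h H.sk_x] h'(7) by simp
  have "h ` H.\<mu> ` indices n = monomial E (h ?g) (h ?x) (h ?c) ` indices n"
    by (simp add: image_image h_mon)
  moreover have "H.\<mu> ` indices n \<subseteq> carrier ?H" by (intro image_subsetI H.mon_closed)
  ultimately have span: "E.span (monomial E (h ?g) (h ?x) (h ?c) ` indices n) = carrier E"
    using span_surj_image[OF H.vectorspace_axioms E.vectorspace_axioms h'(1) bij_betw_imp_surj_on[OF bij_h] H.spanning]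
    by simp
  have "sweedler_comult K E (h ?g) (h ?x) (h ?c) n \<omega>"
    by (intro sweedler_comult.intro sweedler_comult_axioms.intro rel E.comult_algebra_axioms gl sk span)
  then have sw: "sweedler_hopf K E (h ?g) (h ?x) (h ?c) n \<omega>" by (intro sweedler_hopf.intro E)
  have f_mon: "H.\<mu> u = f (monomial E (h ?g) (h ?x) (h ?c) u)" for u
  proof -
    have "f (h (H.\<mu> u)) = H.\<mu> u"
      unfolding h_def by (rule bij_betw_inv_into_right[OF bij H.mon_closed])
    then show ?thesis unfolding h_mon by simp
  qed
  have "coordinates K E (indices n) (monomial E (h ?g) (h ?x) (h ?c)) (\<lambda>u z. \<pi> u (f z))"
    by (rule coordinates_pullback[OF alg_homD(1)[OF hopf_homD(1)[OF f]] coordinates_cong[OF \<pi> f_mon]])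
  then show thesis by (rule that[OF sw])
qed

end

theorem corollary4p4:
  fixes K :: "('k, 'c) ring_scheme" and n :: nat
  assumes "field K"
    and char_not_2: "\<one>\<^bsub>K\<^esub> \<oplus>\<^bsub>K\<^esub> \<one>\<^bsub>K\<^esub> \<noteq> \<zero>\<^bsub>K\<^esub>"
    and "n > 0"
  shows "(\<forall>E :: ('k, 'e) hopf_data. hopf_algebra K E \<longrightarrow>
            (factorizes K E (H4 K) (group_hopf_algebra K (integer_mod_group n))
              \<longleftrightarrow> (\<exists>\<omega>\<in>U n K. hopf_isomorphic K E (H4n K n \<omega>)))) \<and>
         (\<forall>\<omega>\<in>U n K.
            hopf_algebra K (H4n K n \<omega>) \<and>
            pointed K (H4n K n \<omega>) \<and>
            \<not> semisimple (H4n K n \<omega>) \<and>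
            vectorspace.fin_dim K (H4n K n \<omega>) \<and>
            vectorspace.dim K (H4n K n \<omega>) = 4 * n)"
proof (intro conjI allI impI ballI)
  interpret cyclic_setting K n
    using assms by (simp add: cyclic_setting_def cyclic_setting_axioms_def)
  fix E :: "('k, 'e) hopf_data" assume E: "hopf_algebra K E"
  show "factorizes K E (H4 K) (group_hopf_algebra K (integer_mod_group n))
      \<longleftrightarrow> (\<exists>\<omega>\<in>U n K. hopf_isomorphic K E (H4n K n \<omega>))"
  proof
    assume "factorizes K E (H4 K) (group_hopf_algebra K (integer_mod_group n))"
    then obtain \<omega> G Y C \<pi> where "\<omega> \<in> U n K" "sweedler_hopf K E G Y C n \<omega>"
      "coordinates K E (indices n) (monomial E G Y C) \<pi>"
      by (rule sweedler_hopf_if_factorizes[OF E _ char_not_2])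
    then show "\<exists>\<omega>\<in>U n K. hopf_isomorphic K E (H4n K n \<omega>)"
      by (intro bexI isomorphic_if_sweedler_hopf)
  next
    assume "\<exists>\<omega>\<in>U n K. hopf_isomorphic K E (H4n K n \<omega>)"
    then obtain \<omega> where \<omega>: "\<omega> \<in> U n K" and iso: "hopf_isomorphic K E (H4n K n \<omega>)" by (elim bexE)
    obtain G Y C \<pi> where "sweedler_hopf K E G Y C n \<omega>"
      "coordinates K E (indices n) (monomial E G Y C) \<pi>"
      by (rule sweedler_hopf_if_isomorphic[OF E iso \<omega>])
    then show "factorizes K E (H4 K) (group_hopf_algebra K (integer_mod_group n))"
      by (rule factorizes_if_sweedler_hopf)
  qed
next
  fix \<omega> assume \<omega>: "\<omega> \<in> U n K"
  interpret K: field K by fact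
  let ?H = "H4n K n \<omega>"
  have "\<omega> \<in> carrier K" using \<omega> by (simp add: U_def)
  then interpret H: sweedler_hopf K ?H "H4n_gen K n \<omega> Gen_g" "H4n_gen K n \<omega> Gen_x" "H4n_gen K n \<omega> Gen_c" n \<omega>
    by (rule sweedler_hopf_H4n[OF assms(1,3)])
  obtain \<pi> where \<pi>: "coordinates K ?H (indices n) H.\<mu> \<pi>"
    by (rule coordinates_H4n[OF assms(1,3) \<omega>])
  interpret P: pointed_basis K ?H "UNIV \<times> {..<n}" "\<lambda>i. H.\<mu> (False, i)" "\<lambda>i. H.\<mu> (True, i)"
      "\<lambda>(a, d). (\<not> a, d)" \<pi>
    by (rule H.pointed_basis_monomials[OF H.gl_g H.gl_c H.sk_x H.gg H.spanning \<pi>])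
  show "hopf_algebra K ?H" by (rule H.hopf_algebra_axioms)
  show "pointed K ?H" by (rule P.pointed)
  have o: "(False, 0::nat) \<in> UNIV \<times> {..<n}" using assms(3) by simp
  have "H.\<mu> (True, False, 0) \<noteq> \<zero>\<^bsub>?H\<^esub>"
    using P.coord_simps(1)[OF o o] module_hom_zero[OF H.module_self P.cb.self_module P.coord_hom[OF o, of True]]
    by auto
  then have "H4n_gen K n \<omega> Gen_x \<noteq> \<zero>\<^bsub>?H\<^esub>" by (simp add: monomial_def)
  then show "\<not> semisimple ?H" by (rule H.not_semisimple)
  show "H.fin_dim" by (rule P.cb.fin_dim)
  show "H.dim = 4 * n" unfolding P.cb.dim_eq by simp
qed

end
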